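(* Assume that $\xi\in L^2$, that there is a constant $C_f$ such that, $\mathbb{P}$-a.s., for all $t\in[0,T]$, $y,y'\in\mathbb{R}^m$, $z,z',\tilde z,\tilde z'\in\mathbb{R}^{m\times d}$ and $\mu,\nu\in\mathcal{P}_2(\mathbb{R}^m)$, $$|f(t,y,z,\tilde z,\mu)-f(t,y',z',\tilde z',\nu)|\le C_f\big(|y-y'|+|z-z'|+|\tilde z-\tilde z'|+W_2(\mu,\nu)\big),$$ and that $\mathbb{E}[\int_0^T|f(s,0,0,0,\delta_0)|^2ds]<\infty$. Assume also that, for some $p>4$, $\xi\in L^p$ and $(f(s,0,0,0,\delta_0))_{s\le T}\in\mathcal{H}^p$. Let $\mu_s=\mathcal{L}^1(Y_s)$ and $\mu^n_s=\frac1n\sum_{i=1}^n\delta_{Y^{i,n}_s}$. Then there exists $C_T>0$, not depending on $n$, such that for all $n\ge1$ $$\mathbb{E}\Big[\sup_{t\le T}\mathbb{E}^0\Big[\frac1n\sum_{i=1}^n\Big(|Y^{i,n}_t-\tilde Y^i_t|^2+\int_t^T|Z^{0,i,n}_s-\tilde Z^{0,i}_s|^2ds+\int_t^T\sum_{k=1}^n|Z^{i,k,n}_s-\tilde Z^i_s\delta_{i,k}|^2ds\Big)\Big]\Big]\le C_T\,\mathbb{E}\Big[\sup_{s\le T}\mathbb{E}^0\big[W_2^2(\mu^n_s,\mu_s)\big]\Big],$$ and, for every $i\in\{1,\dots,n\}$, $$\mathbb{E}\Big[\sup_{t\le T}\mathbb{E}^0\Big[|Y^{i,n}_t-\tilde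 Y^i_t|^2+\int_t^T|Z^{0,i,n}_s-\tilde Z^{0,i}_s|^2ds+\int_t^T\sum_{k=1}^n|Z^{i,k,n}_s-\tilde Z^i_s\delta_{i,k}|^2ds\Big]\Big]\le C_T\,\mathbb{E}\Big[\sup_{s\le T}\mathbb{E}^0\big[W_2^2(\mu^n_s,\mu_s)\big]\Big].$$
   Context: Fix a finite horizon $T>0$ and integers $m,d\ge1$; $|\cdot|$ denotes Euclidean norms; $\delta_{i,k}$ is the Kronecker symbol. Let $(\Omega^0,\mathcal{F}^0,\mathbb{P}^0)$ and $(\Omega^1,\mathcal{F}^1,\mathbb{P}^1)$ be complete probability spaces; $\Omega^0$ carries a $d$-dimensional Brownian motion $W^0$ (the common noise) and $\Omega^1$ carries independent $d$-dimensional Brownian motions $W,W^1,W^2,\dots$. On $\Omega=\Omega^0\times\Omega^1$ let $(\mathcal{F},\mathbb{P})$ be the completion of $(\mathcal{F}^0\otimes\mathcal{F}^1,\mathbb{P}^0\otimes\mathbb{P}^1)$; all Brownian motions are extended to $\Omega$. Filtrations are the right-continuous complete augmentations of those generated by the relevant Brownian motions: $(W^0,W)$ for the limit equation, $(W^0,W^i)$ for the $i$-th coupled equation, $(W^0,W^1,\dots,W^n)$ for the $n$-particle system. For a random variable $X$ on $\Omega$, $\mathcal{L}^1(X)$ is the random measure $\omega^0\mapsto$ law of $X(\omega^0,\cdot)$ under $\mathbb{P}^1$ (the conditional law given the common noise), and $\mathbb{E}^0[X]$ is the conditional expectation given the common noise, i.e. $\mathbb{E}^0[X](\omega^0)=\int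 X(\omega^0,\omega^1)\,\mathbb{P}^1(d\omega^1)$. $\mathcal{P}_2(\mathbb{R}^m)$ is the set of probability measures on $\mathbb{R}^m$ with finite second moment and $W_2$ is the 2-Wasserstein distance. For $p\ge1$: $L^p$ denotes $p$-integrable terminal random variables; $\mathcal{S}^p$ denotes progressively measurable processes $y$ with $\mathbb{E}[\sup_{t\le T}|y_t|^p]<\infty$; $\mathcal{H}^p$ denotes progressively measurable processes $z$ with $\mathbb{E}[(\int_0^T|z_s|^2ds)^{p/2}]<\infty$. The driver $f:\Omega\times[0,T]\times\mathbb{R}^m\times\mathbb{R}^{m\times d}\times\mathbb{R}^{m\times d}\times\mathcal{P}_2(\mathbb{R}^m)\to\mathbb{R}^m$ is progressively measurable and depends on $\omega$ only through $\omega^0$. The terminal conditions are $\xi=\Psi(W^0,W)$ and $\xi^i=\Psi(W^0,W^i)$ for a common measurable map $\Psi$ of the paths on $[0,T]$, so that the $\xi^i$ are i.i.d. copies of $\xi$ conditionally on the common noise. Limit equation: $(Y,Z,Z^0)\in\mathcal{S}^2\times\mathcal{H}^2\times\mathcal{H}^2$ is the unique solution of $$Y_t=\xi+\int_t^Tf(s,Y_s,Z_s,Z^0_s,\mathcal{L}^1(Y_s))\,ds-\int_t^TZ_s\,dW_s-\int_t^TZ^0_s\,dW^0_s.$$ Particle system: for $i=1,\dots,n$, with $\mu^n_s=\frac1n\sum_{j=1}^n\delta_{Y^{j,n}_s}$, the processes $Y^{i,n}\in\mathcal{S}^2$, $Z^{i,k,n},Z^{0,i,n}\in\mathcal{H}^2$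 form the unique solution of $$Y^{i,n}_t=\xi^i+\int_t^Tf(s,Y^{i,n}_s,Z^{i,i,n}_s,Z^{0,i,n}_s,\mu^n_s)\,ds-\int_t^T\sum_{k=1}^nZ^{i,k,n}_s\,dW^k_s-\int_t^TZ^{0,i,n}_s\,dW^0_s.$$ Coupled system: for $i\ge1$, $(\tilde Y^i,\tilde Z^i,\tilde Z^{0,i})\in\mathcal{S}^2\times\mathcal{H}^2\times\mathcal{H}^2$ is the unique solution of $$\tilde Y^i_t=\xi^i+\int_t^Tf(s,\tilde Y^i_s,\tilde Z^i_s,\tilde Z^{0,i}_s,\mathcal{L}^1(Y_s))\,ds-\int_t^T\tilde Z^i_s\,dW^i_s-\int_t^T\tilde Z^{0,i}_s\,dW^0_s;$$ the $\tilde Y^i$ are i.i.d. conditionally on the common noise. *)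

theory Defs
  imports "HOL-Probability.Probability"
begin

definition prod_space :: "'a measure \<Rightarrow> 'b measure \<Rightarrow> ('a \<times> 'b) measure" where
  "prod_space P0 P1 = completion (P0 \<Otimes>\<^sub>M P1)"

definition ext0 :: "(real \<Rightarrow> 'a \<Rightarrow> 'v) \<Rightarrow> real \<Rightarrow> 'a \<times> 'b \<Rightarrow> 'v" where
  "ext0 X = (\<lambda>t \<omega>. X t (fst \<omega>))"

definition ext1 :: "(real \<Rightarrow> 'b \<Rightarrow> 'v) \<Rightarrow> real \<Rightarrow> 'a \<times> 'b \<Rightarrow> 'v" where
  "ext1 X = (\<lambda>t \<omega>. X t (snd \<omega>))"

text \<open>Conditional law and conditional expectation given the common noise, as functions on the
  first factor; the latter only for nonnegative, possibly infinite, random variables.\<close>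

definition cond_law :: "'b measure \<Rightarrow> ('a \<times> 'b \<Rightarrow> 'v::topological_space) \<Rightarrow> 'a \<Rightarrow> 'v measure" where
  "cond_law P1 X \<omega>0 = distr P1 borel (\<lambda>\<omega>1. X (\<omega>0, \<omega>1))"

definition cond_exp0 :: "'b measure \<Rightarrow> ('a \<times> 'b \<Rightarrow> ennreal) \<Rightarrow> 'a \<Rightarrow> ennreal" where
  "cond_exp0 P1 X \<omega>0 = (\<integral>\<^sup>+\<omega>1. X (\<omega>0, \<omega>1) \<partial>P1)"

definition sample_path :: "real \<Rightarrow> (real \<Rightarrow> 'w \<Rightarrow> 'v) \<Rightarrow> 'w \<Rightarrow> (real \<Rightarrow> 'v)" where
  "sample_path T X \<omega> = restrict (\<lambda>t. X t \<omega>) {0..T}"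

text \<open>The Borel sets of the space of continuous paths (with the supremum norm) are generated by the
  evaluations. Brownian paths lie in this space almost surely.\<close>

definition path_space :: "real \<Rightarrow> (real \<Rightarrow> 'v::topological_space) measure" where
  "path_space T = restrict_space (Pi\<^sub>M {0..T} (\<lambda>_. borel)) {w. continuous_on {0..T} w}"

definition brownian_motion ::
  "'w measure \<Rightarrow> real \<Rightarrow> (real \<Rightarrow> 'w \<Rightarrow> real ^ 'd) \<Rightarrow> bool" where
  "brownian_motion M T B \<longleftrightarrow>
     (\<forall>t\<in>{0..T}. B t \<in> borel_measurable M) \<and>
     (AE \<omega> in M. B 0 \<omega> = 0) \<and>
     (AE \<omega> in M. continuous_on {0..T} (\<lambda>t. B t \<omega>)) \<and>
     (\<forall>s t. 0 \<le> s \<and> s < t \<and> t \<le> T \<longrightarrow>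
        distributed M lborel (\<lambda>\<omega>. B t \<omega> - B s \<omega>)
          (\<lambda>x. ennreal (\<Prod>j\<in>UNIV. normal_density 0 (sqrt (t - s)) (x $ j)))) \<and>
     (\<forall>k \<tau>. (\<forall>j\<le>k. \<tau> j \<in> {0..T}) \<and> (\<forall>j<k. \<tau> j \<le> \<tau> (Suc j)) \<longrightarrow>
        prob_space.indep_vars M (\<lambda>_. borel) (\<lambda>j \<omega>. B (\<tau> (Suc j)) \<omega> - B (\<tau> j) \<omega>) {..<k::nat})"

text \<open>\<open>M\<close> is meant to be complete: then \<open>null_sets M\<close> contains all subsets of null sets.
  The generated filtration is constant after \<open>T\<close>, so that the right limit at \<open>T\<close> adds nothing.\<close>

definition completed_filtration ::
  "'w measure \<Rightarrow> real \<Rightarrow> (real \<Rightarrow> 'w \<Rightarrow> 'v::topological_space) set \<Rightarrow> real \<Rightarrow> 'w measure" where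
  "completed_filtration M T \<W> t = sigma (space M)
     ({X s -` A \<inter> space M |X s A. X \<in> \<W> \<and> 0 \<le> s \<and> s \<le> min t T \<and> A \<in> sets borel} \<union> null_sets M)"

definition aug_filtration ::
  "'w measure \<Rightarrow> real \<Rightarrow> (real \<Rightarrow> 'w \<Rightarrow> 'v::topological_space) set \<Rightarrow> real \<Rightarrow> 'w measure" where
  "aug_filtration M T \<W> t = sigma (space M) (\<Inter>u\<in>{t<..}. sets (completed_filtration M T \<W> u))"

definition epowr :: "ennreal \<Rightarrow> real \<Rightarrow> ennreal" where
  "epowr x a = (if x = \<infinity> then \<infinity> else ennreal (enn2real x powr a))"

definition prog_measurable ::
  "real \<Rightarrow> (real \<Rightarrow> 'w measure) \<Rightarrow> (real \<Rightarrow> 'w \<Rightarrow> 'v::topological_space) \<Rightarrow> bool" where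
  "prog_measurable T F X \<longleftrightarrow>
     (\<forall>t\<in>{0..T}. (\<lambda>(s, \<omega>). X s \<omega>) \<in> borel_measurable (restrict_space borel {0..t} \<Otimes>\<^sub>M F t))"

definition Lp :: "'w measure \<Rightarrow> real \<Rightarrow> ('w \<Rightarrow> 'v::real_normed_vector) set" where
  "Lp M p = {x \<in> borel_measurable M. (\<integral>\<^sup>+\<omega>. ennreal (norm (x \<omega>) powr p) \<partial>M) < \<infinity>}"

definition Sp :: "'w measure \<Rightarrow> real \<Rightarrow> (real \<Rightarrow> 'w measure) \<Rightarrow> real
    \<Rightarrow> (real \<Rightarrow> 'w \<Rightarrow> 'v::real_normed_vector) set" where
  "Sp M T F p = {y. prog_measurable T F y \<and>
     (\<integral>\<^sup>+\<omega>. (SUP t\<in>{0..T}. ennreal (norm (y t \<omega>) powr p)) \<partial>M) < \<infinity>}"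

definition Hp :: "'w measure \<Rightarrow> real \<Rightarrow> (real \<Rightarrow> 'w measure) \<Rightarrow> real
    \<Rightarrow> (real \<Rightarrow> 'w \<Rightarrow> 'v::real_normed_vector) set" where
  "Hp M T F p = {z. prog_measurable T F z \<and>
     (\<integral>\<^sup>+\<omega>. epowr (\<integral>\<^sup>+s\<in>{0..T}. ennreal ((norm (z s \<omega>))\<^sup>2) \<partial>lborel) (p / 2) \<partial>M) < \<infinity>}"

definition P2 :: "'v::real_normed_vector measure set" where
  "P2 = {\<mu>. sets \<mu> = sets borel \<and> prob_space \<mu> \<and> (\<integral>\<^sup>+x. ennreal ((norm x)\<^sup>2) \<partial>\<mu>) < \<infinity>}"

text \<open>On \<open>P2\<close> over a Euclidean space the Borel sets of the Wasserstein distance are generated by the evaluations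
  \<open>\<mu> \<mapsto> \<mu> A\<close>, that is, they form the trace of the \<open>\<sigma>\<close>-algebra of \<^const>\<open>prob_algebra\<close>.\<close>

definition P2_algebra :: "'v::real_normed_vector measure measure" where
  "P2_algebra = restrict_space (prob_algebra borel) P2"

definition couplings :: "'v::topological_space measure \<Rightarrow> 'v measure \<Rightarrow> ('v \<times> 'v) measure set" where
  "couplings \<mu> \<nu> = {\<pi>. sets \<pi> = sets (borel \<Otimes>\<^sub>M borel) \<and> distr \<pi> borel fst = \<mu> \<and> distr \<pi> borel snd = \<nu>}"

definition W2 :: "'v::euclidean_space measure \<Rightarrow> 'v measure \<Rightarrow> real" where
  "W2 \<mu> \<nu> = sqrt (enn2real (INF \<pi>\<in>couplings \<mu> \<nu>. \<integral>\<^sup>+(x, y). ennreal ((norm (x - y))\<^sup>2) \<partial>\<pi>))"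

definition empirical :: "nat \<Rightarrow> (nat \<Rightarrow> 'v::topological_space) \<Rightarrow> 'v measure" where
  "empirical n x = distr (uniform_count_measure {1..n}) borel x"

lemma emeasure_empirical:
  assumes "n \<ge> 1" and A: "A \<in> sets borel"
  shows "emeasure (empirical n x) A = ennreal (1 / real n) * (\<Sum>j=1..n. emeasure (return borel (x j)) A)"
proof -
  have "emeasure (empirical n x) A = emeasure (uniform_count_measure {1..n}) (x -` A \<inter> {1..n})"
    unfolding empirical_def using A
    by (subst emeasure_distr) (auto simp: measurable_def sets_uniform_count_measure
        space_uniform_count_measure)
  also have "\<dots> = ennreal (real (card (x -` A \<inter> {1..n})) / real n)"
    by (subst emeasure_uniform_count_measure) auto
  also have "real (card (x -` A \<inter> {1..n})) = (\<Sum>j=1..n. indicator A (x j))"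
    by (simp add: indicator_def sum.If_cases Int_def vimage_def conj_commute)
  also have "ennreal (\<dots> / real n) = ennreal (1 / real n) * ennreal (\<Sum>j=1..n. indicator A (x j))"
    by (subst ennreal_mult[symmetric]) (auto intro: sum_nonneg)
  also have "ennreal (\<Sum>j=1..n. indicator A (x j)) = (\<Sum>j=1..n. emeasure (return borel (x j)) A)"
    using A by (subst sum_ennreal[symmetric]) (auto simp: ennreal_indicator)
  finally show ?thesis .
qed

definition elementary ::
  "real \<Rightarrow> (real \<Rightarrow> 'w measure) \<Rightarrow> nat \<Rightarrow> (nat \<Rightarrow> real) \<Rightarrow> (nat \<Rightarrow> 'w \<Rightarrow> real ^ 'd ^ 'm) \<Rightarrow> bool" where
  "elementary T F N \<tau> \<eta> \<longleftrightarrow>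
     (\<forall>j\<le>N. \<tau> j \<in> {0..T}) \<and> (\<forall>j<N. \<tau> j \<le> \<tau> (Suc j)) \<and>
     (\<forall>j<N. \<eta> j \<in> borel_measurable (F (\<tau> j)) \<and> (\<exists>c. \<forall>\<omega>\<in>space (F (\<tau> j)). norm (\<eta> j \<omega>) \<le> c))"

definition elem_process ::
  "nat \<Rightarrow> (nat \<Rightarrow> real) \<Rightarrow> (nat \<Rightarrow> 'w \<Rightarrow> real ^ 'd ^ 'm) \<Rightarrow> real \<Rightarrow> 'w \<Rightarrow> real ^ 'd ^ 'm" where
  "elem_process N \<tau> \<eta> s \<omega> = (\<Sum>j<N. indicator {\<tau> j<..\<tau> (Suc j)} s *\<^sub>R \<eta> j \<omega>)"

definition elem_integral ::
  "(real \<Rightarrow> 'w \<Rightarrow> real ^ 'd) \<Rightarrow> nat \<Rightarrow> (nat \<Rightarrow> real) \<Rightarrow> (nat \<Rightarrow> 'w \<Rightarrow> real ^ 'd ^ 'm)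
    \<Rightarrow> real \<Rightarrow> 'w \<Rightarrow> real ^ 'm" where
  "elem_integral B N \<tau> \<eta> t \<omega> =
     (\<Sum>j<N. \<eta> j \<omega> *v (B (min t (\<tau> (Suc j))) \<omega> - B (min t (\<tau> j)) \<omega>))"

text \<open>\<open>ito_integral M T F B Z I\<close>: the process \<open>I\<close> is a version with continuous paths of
  \<open>t \<mapsto> \<integral>\<^sub>0\<^sup>t Z\<^sub>s dB\<^sub>s\<close>. For a Brownian motion \<open>B\<close> relative to \<open>F\<close> and \<open>Z \<in> Hp M T F 2\<close> such a process exists,
  is unique up to indistinguishability, and does not depend on the approximating sequence.\<close>

definition ito_integral ::
  "'w measure \<Rightarrow> real \<Rightarrow> (real \<Rightarrow> 'w measure) \<Rightarrow> (real \<Rightarrow> 'w \<Rightarrow> real ^ 'd)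
    \<Rightarrow> (real \<Rightarrow> 'w \<Rightarrow> real ^ 'd ^ 'm) \<Rightarrow> (real \<Rightarrow> 'w \<Rightarrow> real ^ 'm) \<Rightarrow> bool" where
  "ito_integral M T F B Z I \<longleftrightarrow>
     (\<forall>t\<in>{0..T}. I t \<in> borel_measurable (F t)) \<and>
     (AE \<omega> in M. continuous_on {0..T} (\<lambda>t. I t \<omega>)) \<and>
     (\<exists>N \<tau> \<eta>. (\<forall>k::nat. elementary T F (N k) (\<tau> k) (\<eta> k)) \<and>
        (\<lambda>k. \<integral>\<^sup>+\<omega>. (\<integral>\<^sup>+s\<in>{0..T}.
            ennreal ((norm (elem_process (N k) (\<tau> k) (\<eta> k) s \<omega> - Z s \<omega>))\<^sup>2) \<partial>lborel) \<partial>M)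
          \<longlonglongrightarrow> 0 \<and>
        (\<forall>t\<in>{0..T}. (\<lambda>k. \<integral>\<^sup>+\<omega>.
            ennreal ((norm (elem_integral B (N k) (\<tau> k) (\<eta> k) t \<omega> - I t \<omega>))\<^sup>2) \<partial>M)
          \<longlonglongrightarrow> 0))"

text \<open>Solution in \<open>S\<^sup>2 \<times> H\<^sup>2 \<times> H\<^sup>2\<close> of
  \<open>Y\<^sub>t = \<xi> + \<integral>\<^sub>t\<^sup>T g\<^sub>s ds - \<integral>\<^sub>t\<^sup>T \<Sum>\<^sub>k Z\<^sup>k\<^sub>s dB\<^sup>k\<^sub>s - \<integral>\<^sub>t\<^sup>T Z\<^sup>0\<^sub>s dW\<^sup>0\<^sub>s\<close>, where \<open>k\<close> ranges over \<open>K\<close> and the drift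
  \<open>g\<close> is the driver evaluated along the solution. Integrability of \<open>g\<close> is part of the equation,
  since the Bochner integral of a non-integrable function is \<open>0\<close>.\<close>

definition bsde_solution ::
  "'w measure \<Rightarrow> real \<Rightarrow> (real \<Rightarrow> 'w measure) \<Rightarrow> 'k set \<Rightarrow> ('k \<Rightarrow> real \<Rightarrow> 'w \<Rightarrow> real ^ 'd)
    \<Rightarrow> (real \<Rightarrow> 'w \<Rightarrow> real ^ 'd) \<Rightarrow> ('w \<Rightarrow> real ^ 'm) \<Rightarrow> (real \<Rightarrow> 'w \<Rightarrow> real ^ 'm)
    \<Rightarrow> (real \<Rightarrow> 'w \<Rightarrow> real ^ 'm) \<Rightarrow> ('k \<Rightarrow> real \<Rightarrow> 'w \<Rightarrow> real ^ 'd ^ 'm) \<Rightarrow> (real \<Rightarrow> 'w \<Rightarrow> real ^ 'd ^ 'm)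
    \<Rightarrow> bool" where
  "bsde_solution M T F K B W0 \<xi> g Y Z Z0 \<longleftrightarrow>
     Y \<in> Sp M T F 2 \<and> (\<forall>k\<in>K. Z k \<in> Hp M T F 2) \<and> Z0 \<in> Hp M T F 2 \<and>
     (\<exists>I I0. (\<forall>k\<in>K. ito_integral M T F (B k) (Z k) (I k)) \<and> ito_integral M T F W0 Z0 I0 \<and>
        (AE \<omega> in M. set_integrable lborel {0..T} (\<lambda>s. g s \<omega>) \<and>
           (\<forall>t\<in>{0..T}. Y t \<omega> = \<xi> \<omega> + (LINT s:{t..T}|lborel. g s \<omega>)
              - (\<Sum>k\<in>K. I k T \<omega> - I k t \<omega>) - (I0 T \<omega> - I0 t \<omega>))))"

type_synonym ('w, 'm, 'd) driver =
  "'w \<Rightarrow> real \<Rightarrow> real ^ 'm \<Rightarrow> real ^ 'd ^ 'm \<Rightarrow> real ^ 'd ^ 'm \<Rightarrow> (real ^ 'm) measure \<Rightarrow> real ^ 'm"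

definition prog_measurable_driver ::
  "real \<Rightarrow> (real \<Rightarrow> 'w measure) \<Rightarrow> ('w, 'm::finite, 'd::finite) driver \<Rightarrow> bool" where
  "prog_measurable_driver T F f \<longleftrightarrow>
     (\<forall>t\<in>{0..T}. (\<lambda>(s, \<omega>, y, z, z0, \<mu>). f \<omega> s y z z0 \<mu>) \<in> borel_measurable
        (restrict_space borel {0..t} \<Otimes>\<^sub>M F t \<Otimes>\<^sub>M borel \<Otimes>\<^sub>M borel \<Otimes>\<^sub>M borel \<Otimes>\<^sub>M P2_algebra))"

definition limit_solution where
  "limit_solution P0 P1 T W0 W f \<xi> Y Z Z0 \<longleftrightarrow>
     (let M = prod_space P0 P1 in
      bsde_solution M T (aug_filtration M T {ext0 W0, ext1 W}) {()} (\<lambda>_. ext1 W) (ext0 W0) \<xi>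
        (\<lambda>s \<omega>. f \<omega> s (Y s \<omega>) (Z s \<omega>) (Z0 s \<omega>) (cond_law P1 (Y s) (fst \<omega>)))
        Y (\<lambda>_. Z) Z0)"

definition coupled_solution where
  "coupled_solution P0 P1 T W0 B f \<xi> Y i Yt Zt Z0t \<longleftrightarrow>
     (let M = prod_space P0 P1 in
      bsde_solution M T (aug_filtration M T {ext0 W0, ext1 (B i)}) {i} (\<lambda>k. ext1 (B k)) (ext0 W0) \<xi>
        (\<lambda>s \<omega>. f \<omega> s (Yt s \<omega>) (Zt s \<omega>) (Z0t s \<omega>) (cond_law P1 (Y s) (fst \<omega>)))
        Yt (\<lambda>_. Zt) Z0t)"

definition particle_solution where
  "particle_solution P0 P1 T W0 B f \<xi> (n::nat) Y Z Z0 \<longleftrightarrow>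
     (let M = prod_space P0 P1 in
      \<forall>i\<in>{1..n}.
        bsde_solution M T (aug_filtration M T (insert (ext0 W0) ((\<lambda>k. ext1 (B k)) ` {1..n})))
          {1..n} (\<lambda>k. ext1 (B k)) (ext0 W0) (\<xi> i)
          (\<lambda>s \<omega>. f \<omega> s (Y i s \<omega>) (Z i i s \<omega>) (Z0 i s \<omega>) (empirical n (\<lambda>j. Y j s \<omega>)))
          (Y i) (Z i) (Z0 i))"

definition particle_error ::
  "real \<Rightarrow> nat \<Rightarrow> nat \<Rightarrow> (real \<Rightarrow> 'w \<Rightarrow> real ^ 'm) \<Rightarrow> (nat \<Rightarrow> real \<Rightarrow> 'w \<Rightarrow> real ^ 'd ^ 'm)
    \<Rightarrow> (real \<Rightarrow> 'w \<Rightarrow> real ^ 'd ^ 'm) \<Rightarrow> (real \<Rightarrow> 'w \<Rightarrow> real ^ 'm) \<Rightarrow> (real \<Rightarrow> 'w \<Rightarrow> real ^ 'd ^ 'm)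
    \<Rightarrow> (real \<Rightarrow> 'w \<Rightarrow> real ^ 'd ^ 'm) \<Rightarrow> real \<Rightarrow> 'w \<Rightarrow> ennreal" where
  "particle_error T n i Y Z Z0 Yt Zt Z0t t \<omega> =
     ennreal ((norm (Y t \<omega> - Yt t \<omega>))\<^sup>2)
     + (\<integral>\<^sup>+s\<in>{t..T}. ennreal ((norm (Z0 s \<omega> - Z0t s \<omega>))\<^sup>2) \<partial>lborel)
     + (\<integral>\<^sup>+s\<in>{t..T}. (\<Sum>k=1..n. ennreal ((norm (Z k s \<omega> - of_bool (i = k) *\<^sub>R Zt s \<omega>))\<^sup>2)) \<partial>lborel)"

end

theory Submission
  imports Defs
begin

text \<open>
  Fix \<open>n\<close> and a particle \<open>i\<close>. The difference \<open>D\<close> of the solution of the particle equation and of its coupled copy solves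
  the backward equation \<open>D\<^sub>t = \<integral>\<^sub>t\<^sup>T G\<^sub>s ds - (N\<^sub>T - N\<^sub>t)\<close> with terminal value \<open>0\<close>, where \<open>G\<close> is the difference of the drivers and
  \<open>N\<close> is a martingale in the filtration generated by all Brownian motions of the system. The bracket of \<open>N\<close> has the density
  \<open>q\<close>, the sum of the squared differences of the integrands. By the Lipschitz condition, \<open>G\<close> is bounded by a multiple of
  \<open>|D| + sqrt q\<close> plus the Wasserstein distance between the empirical measure and the conditional law. Hence the usual a
  priori estimate for Lipschitz backward equations bounds the mean of \<open>sup |D|\<^sup>2 + \<integral> q\<close> by a multiple of the mean of
  \<open>\<integral> W2\<^sup>2 ds\<close>, with a constant that depends on \<open>T\<close> and on the Lipschitz constant only. Both claims follow, since a supremum of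
  conditional expectations is at most the conditional expectation of the supremum, and since the time integral of the mean
  of \<open>W2\<^sup>2\<close> is at most \<open>T\<close> times the mean of the supremum of its conditional expectations.

  The a priori estimate (\<open>a_priori_estimate\<close>) is proved without Ito's formula. For \<open>s \<le> t\<close> the variable \<open>D\<^sub>s\<close> is orthogonal
  to \<open>N\<^sub>t - N\<^sub>s\<close>, so \<open>E |D\<^sub>s|\<^sup>2 + E \<integral>\<^sub>s\<^sup>t q = E |D\<^sub>t + \<integral>\<^sub>s\<^sup>t G|\<^sup>2 \<le> 2 E |D\<^sub>t|\<^sup>2 + 2 (t - s) E \<integral>\<^sub>s\<^sup>t |G|\<^sup>2\<close>. On a short interval the
  last term is absorbed up to the source; a fixed number of backward steps from \<open>T\<close> reaches \<open>0\<close>. The supremum over time is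
  then added by Doob's maximal inequality (\<open>doob_maximal\<close>), which follows from an inequality between real numbers
  (\<open>pathwise_doob\<close>), orthogonality and Fatou's lemma.

  The properties of \<open>N\<close> (\<open>ito_sum_difference\<close>) rest on the covariances of Brownian increments given the
  right-continuous augmented filtration (\<open>aug_increment_moments\<close>), which come from independence on cylinder events, a Dynkin
  argument and a limit from later times. The isometry is carried through in polarised form, for two integrals with
  different integrands, partitions and Brownian motions, so that integrals can be subtracted without refining partitions.

  Two points concern measurability. The conditional law has a jointly measurable version with values in \<open>P2\<close>
  (\<open>cond_law_version\<close>), whence \<open>G\<close> is jointly measurable. The Wasserstein distance enters only through a
  measurable process that it dominates (\<open>particle_error_estimate\<close>).
\<close>

section \<open>Square-integrable functions\<close>

definition square_integrable :: "'w measure \<Rightarrow> ('w \<Rightarrow> 'v::euclidean_space) \<Rightarrow> bool" where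
  "square_integrable M f \<longleftrightarrow> f \<in> borel_measurable M \<and> integrable M (\<lambda>x. (norm (f x))\<^sup>2)"

lemma square_integrable_iff_nn_integral:
  assumes [measurable]: "f \<in> borel_measurable M"
  shows "square_integrable M f \<longleftrightarrow> (\<integral>\<^sup>+x. ennreal ((norm (f x))\<^sup>2) \<partial>M) < \<infinity>"
  by (simp add: square_integrable_def integrable_iff_bounded)

lemma nn_integral_square_integrable:
  "square_integrable M f \<Longrightarrow>
    (\<integral>\<^sup>+x. ennreal ((norm (f x))\<^sup>2) \<partial>M) = ennreal (\<integral>x. (norm (f x))\<^sup>2 \<partial>M)"
  by (intro nn_integral_eq_integral) (auto simp: square_integrable_def)

lemma square_integrable_zero[simp]: "square_integrable M (\<lambda>_. 0)"
  by (simp add: square_integrable_def)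

lemma norm_add_power2_le: "(norm (x + y))\<^sup>2 \<le> 2 * (norm x)\<^sup>2 + 2 * (norm (y::'v::real_normed_vector))\<^sup>2"
proof -
  have "(norm (x + y))\<^sup>2 \<le> (norm x + norm y)\<^sup>2" by (intro power_mono norm_triangle_ineq) auto
  also have "\<dots> \<le> 2 * (norm x)\<^sup>2 + 2 * (norm y)\<^sup>2"
    using sum_squares_bound[of "norm x" "norm y"] by (simp add: power2_sum)
  finally show ?thesis .
qed

lemma ennreal_le_twice_add:
  assumes "a \<le> 2 * b + 2 * c" "0 \<le> b" "0 \<le> c"
  shows "ennreal a \<le> 2 * ennreal b + 2 * ennreal c"
proof -
  have "ennreal a \<le> ennreal (2 * b + 2 * c)" by (rule ennreal_leI[OF assms(1)])
  also have "\<dots> = 2 * ennreal b + 2 * ennreal c" using assms by (simp add: ennreal_mult)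
  finally show ?thesis .
qed

lemma square_integrable_add:
  assumes f: "square_integrable M f" and g: "square_integrable M g"
  shows "square_integrable M (\<lambda>x. f x + g x)"
proof -
  have [measurable]: "f \<in> borel_measurable M" "g \<in> borel_measurable M"
    using f g by (auto simp: square_integrable_def)
  have "integrable M (\<lambda>x. 2 * (norm (f x))\<^sup>2 + 2 * (norm (g x))\<^sup>2)"
    using f g by (auto simp: square_integrable_def)
  then have "integrable M (\<lambda>x. (norm (f x + g x))\<^sup>2)"
    by (rule Bochner_Integration.integrable_bound)
      (auto intro!: order_trans[OF norm_add_power2_le])
  then show ?thesis by (simp add: square_integrable_def)
qed

lemma square_integrable_bounded_scaleR:
  assumes f: "square_integrable M f" and [measurable]: "\<phi> \<in> borel_measurable M"
    and c: "\<And>x. x \<in> space M \<Longrightarrow> \<bar>\<phi> x\<bar> \<le> c"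
  shows "square_integrable M (\<lambda>x. \<phi> x *\<^sub>R f x)"
proof -
  have [measurable]: "f \<in> borel_measurable M" using f by (auto simp: square_integrable_def)
  have "integrable M (\<lambda>x. c\<^sup>2 * (norm (f x))\<^sup>2)"
    using f by (auto simp: square_integrable_def)
  then have "integrable M (\<lambda>x. (norm (\<phi> x *\<^sub>R f x))\<^sup>2)"
  proof (rule Bochner_Integration.integrable_bound)
    show "AE x in M. norm ((norm (\<phi> x *\<^sub>R f x))\<^sup>2) \<le> norm (c\<^sup>2 * (norm (f x))\<^sup>2)"
      using c by (auto simp: power_mult_distrib intro!: AE_I2 mult_right_mono abs_le_square_iff[THEN iffD1]
          order_trans[OF _ abs_ge_self])
  qed simp
  then show ?thesis by (simp add: square_integrable_def)
qed

lemma square_integrable_scaleR: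
  "square_integrable M f \<Longrightarrow> square_integrable M (\<lambda>x. c *\<^sub>R f x)"
  by (rule square_integrable_bounded_scaleR[where c="\<bar>c\<bar>"]) auto

lemma square_integrable_diff:
  assumes "square_integrable M f" "square_integrable M g"
  shows "square_integrable M (\<lambda>x. f x - g x)"
  using square_integrable_add[OF assms(1) square_integrable_scaleR[OF assms(2), of "-1"]] by simp

lemma square_integrable_sum:
  "(\<And>i. i \<in> I \<Longrightarrow> square_integrable M (f i)) \<Longrightarrow> square_integrable M (\<lambda>x. \<Sum>i\<in>I. f i x)"
  by (induction I rule: infinite_finite_induct) (auto intro: square_integrable_add)

lemma square_integrable_bound:
  assumes f: "square_integrable M f" and [measurable]: "g \<in> borel_measurable M"
    and "\<And>x. x \<in> space M \<Longrightarrow> norm (g x) \<le> norm (f x)"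
  shows "square_integrable M g"
proof -
  have "integrable M (\<lambda>x. (norm (f x))\<^sup>2)" using f by (simp add: square_integrable_def)
  then have "integrable M (\<lambda>x. (norm (g x))\<^sup>2)"
    by (rule Bochner_Integration.integrable_bound) (use assms(3) in \<open>auto intro!: AE_I2 power_mono\<close>)
  then show ?thesis by (simp add: square_integrable_def)
qed

lemma square_integrable_norm:
  "square_integrable M f \<Longrightarrow> square_integrable M (\<lambda>x. norm (f x))"
  by (auto simp: square_integrable_def)

lemma borel_measurable_nth:
  fixes f :: "'x \<Rightarrow> 'v::euclidean_space ^ 'n"
  shows "f \<in> borel_measurable N \<Longrightarrow> (\<lambda>\<omega>. f \<omega> $ j) \<in> borel_measurable N"
  by (rule measurable_compose[where g="\<lambda>v. v $ j"])
    (auto intro!: borel_measurable_continuous_onI continuous_intros)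

lemma square_integrable_component:
  fixes f :: "'w \<Rightarrow> 'v::euclidean_space ^ 'm"
  shows "square_integrable M f \<Longrightarrow> square_integrable M (\<lambda>x. f x $ j)"
proof (rule square_integrable_bound[of M f])
  assume "square_integrable M f"
  then have [measurable]: "f \<in> borel_measurable M" by (simp add: square_integrable_def)
  show "(\<lambda>x. f x $ j) \<in> borel_measurable M" by (rule borel_measurable_nth) simp
qed (auto intro: Finite_Cartesian_Product.norm_nth_le)

lemma (in finite_measure) square_integrable_bounded:
  assumes [measurable]: "f \<in> borel_measurable M" and "\<And>x. x \<in> space M \<Longrightarrow> norm (f x) \<le> c"
  shows "square_integrable M f"
  unfolding square_integrable_def
proof
  show "integrable M (\<lambda>x. (norm (f x))\<^sup>2)"
    by (rule integrable_const_bound[where B="c\<^sup>2"]) (use assms(2) in \<open>auto intro!: power_mono\<close>)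
qed simp

text \<open>Cauchy--Schwarz in \<open>L\<^sup>2\<close>. The nonnegative integral version is applied to the norms; integrability of their
product comes from \<open>2 a b \<le> a\<^sup>2 + b\<^sup>2\<close>.\<close>

lemma square_integrable_inner:
  assumes f: "square_integrable M f" and g: "square_integrable M g"
  shows "integrable M (\<lambda>x. f x \<bullet> g x)"
    and "\<bar>\<integral>x. f x \<bullet> g x \<partial>M\<bar> \<le> sqrt (\<integral>x. (norm (f x))\<^sup>2 \<partial>M) * sqrt (\<integral>x. (norm (g x))\<^sup>2 \<partial>M)"
proof -
  have [measurable]: "f \<in> borel_measurable M" "g \<in> borel_measurable M"
    using f g by (auto simp: square_integrable_def)
  define a where "a = (\<integral>x. (norm (f x))\<^sup>2 \<partial>M)"
  define b where "b = (\<integral>x. (norm (g x))\<^sup>2 \<partial>M)"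
  have ab: "0 \<le> a" "0 \<le> b" by (auto simp: a_def b_def)
  have I: "integrable M (\<lambda>x. norm (f x) * norm (g x))"
  proof (rule Bochner_Integration.integrable_bound)
    show "integrable M (\<lambda>x. (norm (f x))\<^sup>2 + (norm (g x))\<^sup>2)"
      using f g by (auto simp: square_integrable_def)
    have "norm (f x) * norm (g x) \<le> (norm (f x))\<^sup>2 + (norm (g x))\<^sup>2" for x
      using sum_squares_bound[of "norm (f x)" "norm (g x)"]
        mult_nonneg_nonneg[OF norm_ge_zero norm_ge_zero, of "f x" "g x"] unfolding mult.assoc by linarith
    then show "AE x in M. norm (norm (f x) * norm (g x)) \<le> norm ((norm (f x))\<^sup>2 + (norm (g x))\<^sup>2)"
      by simp
  qed simp
  show J: "integrable M (\<lambda>x. f x \<bullet> g x)"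
    by (rule Bochner_Integration.integrable_bound[OF I]) (auto simp: Cauchy_Schwarz_ineq2)
  define e where "e = (\<integral>x. norm (f x) * norm (g x) \<partial>M)"
  have e: "0 \<le> e" by (auto simp: e_def)
  have "(\<integral>\<^sup>+x. ennreal (norm (f x)) * ennreal (norm (g x)) \<partial>M)\<^sup>2
      \<le> (\<integral>\<^sup>+x. ennreal (norm (f x)) ^ 2 \<partial>M) * (\<integral>\<^sup>+x. ennreal (norm (g x)) ^ 2 \<partial>M)"
    by (rule Cauchy_Schwarz_nn_integral) auto
  also have "(\<integral>\<^sup>+x. ennreal (norm (f x)) ^ 2 \<partial>M) = ennreal a"
    using nn_integral_square_integrable[OF f] by (simp add: a_def ennreal_power)
  also have "(\<integral>\<^sup>+x. ennreal (norm (g x)) ^ 2 \<partial>M) = ennreal b"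
    using nn_integral_square_integrable[OF g] by (simp add: b_def ennreal_power)
  also have "(\<integral>\<^sup>+x. ennreal (norm (f x)) * ennreal (norm (g x)) \<partial>M) = ennreal e"
    using nn_integral_eq_integral[OF I] by (simp add: e_def ennreal_mult)
  finally have "e\<^sup>2 \<le> a * b" using ab e by (simp add: ennreal_power flip: ennreal_mult)
  then have "e \<le> sqrt a * sqrt b" using e by (simp add: real_le_rsqrt flip: real_sqrt_mult)
  moreover have "\<bar>\<integral>x. f x \<bullet> g x \<partial>M\<bar> \<le> e"
  proof -
    have "\<bar>\<integral>x. f x \<bullet> g x \<partial>M\<bar> \<le> (\<integral>x. \<bar>f x \<bullet> g x\<bar> \<partial>M)" by (rule integral_abs_bound)
    also have "\<dots> \<le> e" unfolding e_def
      by (intro integral_mono I integrable_abs J Cauchy_Schwarz_ineq2)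
    finally show ?thesis .
  qed
  ultimately show "\<bar>\<integral>x. f x \<bullet> g x \<partial>M\<bar> \<le> sqrt (\<integral>x. (norm (f x))\<^sup>2 \<partial>M) * sqrt (\<integral>x. (norm (g x))\<^sup>2 \<partial>M)"
    by (simp add: a_def b_def)
qed

text \<open>Convergence is expressed by nonnegative integrals, as in the definition of the stochastic integral, so that
it makes sense before the limit is known to be square-integrable.\<close>

definition L2_tendsto :: "'w measure \<Rightarrow> (nat \<Rightarrow> 'w \<Rightarrow> 'v::euclidean_space) \<Rightarrow> ('w \<Rightarrow> 'v) \<Rightarrow> bool" where
  "L2_tendsto M f g \<longleftrightarrow> (\<lambda>n. \<integral>\<^sup>+x. ennreal ((norm (f n x - g x))\<^sup>2) \<partial>M) \<longlonglongrightarrow> 0"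

lemma L2_tendsto_const[simp]: "L2_tendsto M (\<lambda>_. f) f"
  by (simp add: L2_tendsto_def)

lemma L2_tendsto_bound:
  assumes f: "L2_tendsto M f g"
    and "\<And>n x. x \<in> space M \<Longrightarrow> norm (f' n x - g' x) \<le> norm (f n x - g x)"
  shows "L2_tendsto M f' g'"
  unfolding L2_tendsto_def
proof (rule tendsto_sandwich[OF _ _ tendsto_const f[unfolded L2_tendsto_def]])
  show "\<forall>\<^sub>F n in sequentially. (\<integral>\<^sup>+x. ennreal ((norm (f' n x - g' x))\<^sup>2) \<partial>M)
      \<le> (\<integral>\<^sup>+x. ennreal ((norm (f n x - g x))\<^sup>2) \<partial>M)"
    using assms(2) by (intro always_eventually allI nn_integral_mono ennreal_leI power_mono) auto
qed auto

lemma L2_tendsto_add: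
  assumes f: "L2_tendsto M f f'" and g: "L2_tendsto M g g'"
    and [measurable]: "\<And>n. f n \<in> borel_measurable M" "\<And>n. g n \<in> borel_measurable M"
      "f' \<in> borel_measurable M" "g' \<in> borel_measurable M"
  shows "L2_tendsto M (\<lambda>n x. f n x + g n x) (\<lambda>x. f' x + g' x)"
  unfolding L2_tendsto_def
proof (rule tendsto_sandwich[OF _ _ tendsto_const])
  let ?a = "\<lambda>n. \<integral>\<^sup>+x. ennreal ((norm (f n x - f' x))\<^sup>2) \<partial>M"
  let ?b = "\<lambda>n. \<integral>\<^sup>+x. ennreal ((norm (g n x - g' x))\<^sup>2) \<partial>M"
  have "(\<lambda>n. 2 * ?a n + 2 * ?b n) \<longlonglongrightarrow> 2 * 0 + 2 * 0"
    using f g unfolding L2_tendsto_def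
    by (intro tendsto_add ennreal_tendsto_cmult) auto
  then show "(\<lambda>n. 2 * ?a n + 2 * ?b n) \<longlonglongrightarrow> 0" by simp
  have "(\<integral>\<^sup>+x. ennreal ((norm (f n x + g n x - (f' x + g' x)))\<^sup>2) \<partial>M) \<le> 2 * ?a n + 2 * ?b n" for n
  proof -
    have "(norm (f n x + g n x - (f' x + g' x)))\<^sup>2
      \<le> 2 * (norm (f n x - f' x))\<^sup>2 + 2 * (norm (g n x - g' x))\<^sup>2" for x
      using norm_add_power2_le[of "f n x - f' x" "g n x - g' x"] by (simp add: algebra_simps)
    then have "(\<integral>\<^sup>+x. ennreal ((norm (f n x + g n x - (f' x + g' x)))\<^sup>2) \<partial>M)
      \<le> (\<integral>\<^sup>+x. 2 * ennreal ((norm (f n x - f' x))\<^sup>2) + 2 * ennreal ((norm (g n x - g' x))\<^sup>2) \<partial>M)"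
      by (intro nn_integral_mono ennreal_le_twice_add) auto
    also have "\<dots> = 2 * ?a n + 2 * ?b n"
      by (simp add: nn_integral_add nn_integral_cmult)
    finally show ?thesis .
  qed
  then show "\<forall>\<^sub>F n in sequentially. (\<integral>\<^sup>+x. ennreal ((norm (f n x + g n x - (f' x + g' x)))\<^sup>2) \<partial>M)
    \<le> 2 * ?a n + 2 * ?b n" by (intro always_eventually allI)
qed auto

lemma L2_tendsto_diff:
  assumes f: "L2_tendsto M f f'" and g: "L2_tendsto M g g'"
    and [measurable]: "\<And>n. f n \<in> borel_measurable M" "\<And>n. g n \<in> borel_measurable M"
      "f' \<in> borel_measurable M" "g' \<in> borel_measurable M"
  shows "L2_tendsto M (\<lambda>n x. f n x - g n x) (\<lambda>x. f' x - g' x)"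
proof -
  have "L2_tendsto M (\<lambda>n x. - g n x) (\<lambda>x. - g' x)"
    using g by (rule L2_tendsto_bound) (simp add: norm_minus_commute)
  from L2_tendsto_add[OF f this] show ?thesis by simp
qed

lemma L2_tendsto_square_integrable:
  assumes lim: "L2_tendsto M f g" and f: "\<And>n. square_integrable M (f n)"
    and [measurable]: "g \<in> borel_measurable M"
  shows "square_integrable M g"
proof -
  have [measurable]: "f n \<in> borel_measurable M" for n using f by (auto simp: square_integrable_def)
  have "\<forall>\<^sub>F n in sequentially. (\<integral>\<^sup>+x. ennreal ((norm (f n x - g x))\<^sup>2) \<partial>M) < 1"
    using lim unfolding L2_tendsto_def by (rule order_tendstoD) simp
  then obtain n where n: "(\<integral>\<^sup>+x. ennreal ((norm (f n x - g x))\<^sup>2) \<partial>M) < 1"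
    by (auto dest: eventually_happens)
  then have "square_integrable M (\<lambda>x. f n x - g x)"
    by (subst square_integrable_iff_nn_integral) (auto intro: less_trans)
  from square_integrable_diff[OF f[of n] this] show ?thesis by simp
qed

text \<open>The \<open>L\<^sup>2\<close> inner product is jointly continuous:
\<open>f\<^sub>n \<bullet> g\<^sub>n - f' \<bullet> g'\<close> splits into \<open>(f\<^sub>n - f') \<bullet> (g\<^sub>n - g')\<close> and two mixed terms, and Cauchy--Schwarz makes each of them small.
Every passage to the limit below, from later to earlier times and from elementary to general integrands, goes through
this lemma.\<close>

lemma L2_tendsto_inner:
  assumes f: "L2_tendsto M f f'" "\<And>n. square_integrable M (f n)" "f' \<in> borel_measurable M"
    and g: "L2_tendsto M g g'" "\<And>n. square_integrable M (g n)" "g' \<in> borel_measurable M"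
  shows "(\<lambda>n. \<integral>x. f n x \<bullet> g n x \<partial>M) \<longlonglongrightarrow> (\<integral>x. f' x \<bullet> g' x \<partial>M)"
proof -
  note f' = L2_tendsto_square_integrable[OF f] and g' = L2_tendsto_square_integrable[OF g]
  note df = square_integrable_diff[OF f(2) f'] and dg = square_integrable_diff[OF g(2) g']
  define a where "a n = sqrt (\<integral>x. (norm (f n x - f' x))\<^sup>2 \<partial>M)" for n
  define b where "b n = sqrt (\<integral>x. (norm (g n x - g' x))\<^sup>2 \<partial>M)" for n
  let ?F = "sqrt (\<integral>x. (norm (f' x))\<^sup>2 \<partial>M)" and ?G = "sqrt (\<integral>x. (norm (g' x))\<^sup>2 \<partial>M)"
  have "(\<lambda>n. ennreal (\<integral>x. (norm (f n x - f' x))\<^sup>2 \<partial>M)) \<longlonglongrightarrow> ennreal 0"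
    using f(1) by (simp add: L2_tendsto_def nn_integral_square_integrable[OF df])
  then have "a \<longlonglongrightarrow> sqrt 0" unfolding a_def by (intro tendsto_real_sqrt) (subst (asm) tendsto_ennreal_iff, auto)
  moreover have "(\<lambda>n. ennreal (\<integral>x. (norm (g n x - g' x))\<^sup>2 \<partial>M)) \<longlonglongrightarrow> ennreal 0"
    using g(1) by (simp add: L2_tendsto_def nn_integral_square_integrable[OF dg])
  then have "b \<longlonglongrightarrow> sqrt 0" unfolding b_def by (intro tendsto_real_sqrt) (subst (asm) tendsto_ennreal_iff, auto)
  ultimately have "(\<lambda>n. a n * b n + a n * ?G + ?F * b n) \<longlonglongrightarrow> sqrt 0 * sqrt 0 + sqrt 0 * ?G + ?F * sqrt 0"
    by (intro tendsto_intros)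
  then have lim0: "(\<lambda>n. a n * b n + a n * ?G + ?F * b n) \<longlonglongrightarrow> 0" by simp
  have "norm ((\<integral>x. f n x \<bullet> g n x \<partial>M) - (\<integral>x. f' x \<bullet> g' x \<partial>M)) \<le> a n * b n + a n * ?G + ?F * b n" for n
  proof -
    note I = square_integrable_inner(1)
    have "(\<integral>x. f n x \<bullet> g n x \<partial>M) - (\<integral>x. f' x \<bullet> g' x \<partial>M) = (\<integral>x. f n x \<bullet> g n x - f' x \<bullet> g' x \<partial>M)"
      by (simp add: I[OF f(2) g(2)] I[OF f' g'])
    also have "\<dots> = (\<integral>x. (f n x - f' x) \<bullet> (g n x - g' x) + (f n x - f' x) \<bullet> g' x
        + f' x \<bullet> (g n x - g' x) \<partial>M)"
      by (intro Bochner_Integration.integral_cong) (auto simp: algebra_simps inner_diff_left inner_diff_right)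
    also have "\<dots> = (\<integral>x. (f n x - f' x) \<bullet> (g n x - g' x) \<partial>M) + (\<integral>x. (f n x - f' x) \<bullet> g' x \<partial>M)
        + (\<integral>x. f' x \<bullet> (g n x - g' x) \<partial>M)"
      by (simp add: I[OF df dg] I[OF df g'] I[OF f' dg])
    finally show ?thesis
      using square_integrable_inner(2)[OF df[of n] dg[of n]] square_integrable_inner(2)[OF df[of n] g']
        square_integrable_inner(2)[OF f' dg[of n]] unfolding a_def b_def by simp
  qed
  then have "(\<lambda>n. (\<integral>x. f n x \<bullet> g n x \<partial>M) - (\<integral>x. f' x \<bullet> g' x \<partial>M)) \<longlonglongrightarrow> 0"
    by (intro Lim_null_comparison[OF _ lim0]) auto
  then show ?thesis by (simp add: LIM_zero_iff)
qed

section \<open>Increments of a Brownian motion\<close>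

text \<open>Lebesgue measure on \<open>real ^ 'd\<close> is the image of a product measure indexed by the basis vectors, which
correspond to the coordinates through \<open>j \<mapsto> axis j 1\<close>.\<close>

lemma lborel_cart_integral_prod:
  fixes f :: "'d::finite \<Rightarrow> real \<Rightarrow> real"
  assumes f: "\<And>j. integrable lborel (f j)"
  shows "integrable lborel (\<lambda>x :: real ^ 'd. \<Prod>j\<in>UNIV. f j (x $ j))"
    and "(\<integral>x. (\<Prod>j\<in>UNIV. f j (x $ j)) \<partial>(lborel :: (real ^ 'd) measure)) = (\<Prod>j\<in>UNIV. \<integral>x. f j x \<partial>lborel)"
proof -
  have [measurable]: "f j \<in> borel_measurable borel" for j using borel_measurable_integrable[OF f[of j]] by simp
  interpret product_sigma_finite "\<lambda>_ :: real ^ 'd. lborel :: real measure"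
    by standard
  let ?B = "Basis :: (real ^ 'd) set"
  let ?P = "\<Pi>\<^sub>M b\<in>?B. (lborel :: real measure)"
  have Basis: "?B = (\<lambda>j. axis j 1) ` UNIV" by (auto simp: Basis_vec_def)
  have inj: "inj (\<lambda>j::'d. axis j (1::real))" by (auto simp: inj_def axis_eq_axis)
  have lb: "(lborel :: (real ^ 'd) measure) = distr ?P borel (\<lambda>f. \<Sum>b\<in>?B. f b *\<^sub>R b)"
    by (subst lborel_def) (subst lborel_eq_real, rule refl)
  have nth: "(\<Sum>b\<in>?B. y b *\<^sub>R b) $ j = y (axis j 1)" for y :: "real ^ 'd \<Rightarrow> real" and j
    by (subst cart_eq_inner_axis) (rule inner_sum_left_Basis, simp)
  have m[measurable]: "(\<lambda>f. \<Sum>b\<in>?B. f b *\<^sub>R b) \<in> ?P \<rightarrow>\<^sub>M borel" by measurable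
  have n[measurable]: "(\<lambda>x :: real ^ 'd. \<Prod>j\<in>UNIV. f j (x $ j)) \<in> borel_measurable borel" by measurable
  define h where "h b = f (axis_index b)" for b :: "real ^ 'd"
  have h: "(\<Prod>j\<in>UNIV. f j (y (axis j 1))) = (\<Prod>b\<in>?B. h b (y b))" for y
    unfolding Basis using inj by (simp add: prod.reindex h_def)
  have eq: "(\<Prod>j\<in>UNIV. f j ((\<Sum>b\<in>?B. y b *\<^sub>R b) $ j)) = (\<Prod>b\<in>?B. h b (y b))" for y
    by (simp only: nth h)
  have hI: "integrable lborel (h b)" for b by (simp add: h_def f)
  show "integrable lborel (\<lambda>x :: real ^ 'd. \<Prod>j\<in>UNIV. f j (x $ j))"
    unfolding lb integrable_distr_eq[OF m n] eq by (intro product_integrable_prod hI) auto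
  have "(\<integral>x. (\<Prod>j\<in>UNIV. f j (x $ j)) \<partial>(lborel :: (real ^ 'd) measure)) = (\<integral>y. (\<Prod>b\<in>?B. h b (y b)) \<partial>?P)"
    unfolding lb integral_distr[OF m n] eq ..
  also have "\<dots> = (\<Prod>b\<in>?B. \<integral>x. h b x \<partial>lborel)"
    by (intro product_integral_prod hI) auto
  also have "\<dots> = (\<Prod>j\<in>UNIV. \<integral>x. f j x \<partial>lborel)"
    unfolding Basis using inj by (simp add: prod.reindex h_def)
  finally show "(\<integral>x. (\<Prod>j\<in>UNIV. f j (x $ j)) \<partial>(lborel :: (real ^ 'd) measure)) = (\<Prod>j\<in>UNIV. \<integral>x. f j x \<partial>lborel)" .
qed

text \<open>The coordinates of an increment have a product density, so moments of products over the coordinates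
factorise. The choices of \<open>g\<close> that matter have at most two factors different from \<open>1\<close>.\<close>

lemma brownian_increment_prod_moment:
  fixes B :: "real \<Rightarrow> 'w \<Rightarrow> real ^ 'd"
  assumes B: "brownian_motion M T B" and uv: "0 \<le> u" "u < v" "v \<le> T"
    and [measurable]: "\<And>j. g j \<in> borel_measurable borel"
    and g: "\<And>j. integrable lborel (\<lambda>x. normal_density 0 (sqrt (v - u)) x * g j x)"
  shows "integrable M (\<lambda>\<omega>. \<Prod>j\<in>UNIV. g j ((B v \<omega> - B u \<omega>) $ j))"
    and "(\<integral>\<omega>. (\<Prod>j\<in>UNIV. g j ((B v \<omega> - B u \<omega>) $ j)) \<partial>M)
      = (\<Prod>j\<in>UNIV. \<integral>x. normal_density 0 (sqrt (v - u)) x * g j x \<partial>lborel)"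
proof -
  have D: "distributed M lborel (\<lambda>\<omega>. B v \<omega> - B u \<omega>)
          (\<lambda>x. ennreal (\<Prod>j\<in>UNIV. normal_density 0 (sqrt (v - u)) (x $ j)))"
    using B uv unfolding brownian_motion_def by blast
  have m: "(\<lambda>x :: real ^ 'd. \<Prod>j\<in>UNIV. g j (x $ j)) \<in> borel_measurable lborel" by measurable
  have nn: "0 \<le> (\<Prod>j\<in>UNIV. normal_density 0 (sqrt (v - u)) (x $ j))" for x :: "real ^ 'd"
    by (intro prod_nonneg) auto
  note I = lborel_cart_integral_prod[of "\<lambda>j x. normal_density 0 (sqrt (v - u)) x * g j x", OF g]
  show "integrable M (\<lambda>\<omega>. \<Prod>j\<in>UNIV. g j ((B v \<omega> - B u \<omega>) $ j))"
    using distributed_integrable[OF D m nn] I(1) by (simp add: prod.distrib)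
  show "(\<integral>\<omega>. (\<Prod>j\<in>UNIV. g j ((B v \<omega> - B u \<omega>) $ j)) \<partial>M)
      = (\<Prod>j\<in>UNIV. \<integral>x. normal_density 0 (sqrt (v - u)) x * g j x \<partial>lborel)"
    using distributed_integral[OF D m nn] I(2) by (simp add: prod.distrib)
qed

lemma normal_density_moments:
  assumes "0 < \<sigma>"
  shows "integrable lborel (\<lambda>x. normal_density 0 \<sigma> x)" "(\<integral>x. normal_density 0 \<sigma> x \<partial>lborel) = 1"
    "integrable lborel (\<lambda>x. normal_density 0 \<sigma> x * x)" "(\<integral>x. normal_density 0 \<sigma> x * x \<partial>lborel) = 0"
    "integrable lborel (\<lambda>x. normal_density 0 \<sigma> x * x\<^sup>2)" "(\<integral>x. normal_density 0 \<sigma> x * x\<^sup>2 \<partial>lborel) = \<sigma>\<^sup>2"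
proof -
  show "integrable lborel (\<lambda>x. normal_density 0 \<sigma> x * x)" "(\<integral>x. normal_density 0 \<sigma> x * x \<partial>lborel) = 0"
    by (rule integrable_normal_moment_nz_1[OF assms] integral_normal_moment_nz_1[OF assms])+
  show "integrable lborel (\<lambda>x. normal_density 0 \<sigma> x * x\<^sup>2)"
    using integrable_normal_moment[OF assms, of 0 2] by simp
  show "(\<integral>x. normal_density 0 \<sigma> x * x\<^sup>2 \<partial>lborel) = \<sigma>\<^sup>2"
    using integral_normal_moment_even[OF assms, of 0 1] by simp
qed (use assms in auto)

lemma brownian_increment_moments:
  fixes B :: "real \<Rightarrow> 'w \<Rightarrow> real ^ 'd"
  assumes B: "brownian_motion M T B" and uv: "0 \<le> u" "u < v" "v \<le> T"
  shows "integrable M (\<lambda>\<omega>. (B v \<omega> - B u \<omega>) $ j)"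
    and "(\<integral>\<omega>. (B v \<omega> - B u \<omega>) $ j \<partial>M) = 0"
    and "integrable M (\<lambda>\<omega>. (B v \<omega> - B u \<omega>) $ j * (B v \<omega> - B u \<omega>) $ j')"
    and "(\<integral>\<omega>. (B v \<omega> - B u \<omega>) $ j * (B v \<omega> - B u \<omega>) $ j' \<partial>M) = of_bool (j = j') * (v - u)"
proof -
  have \<sigma>: "0 < sqrt (v - u)" "(sqrt (v - u))\<^sup>2 = v - u" using uv by auto
  note N = normal_density_moments[OF \<sigma>(1)]
  define g1 where "g1 i x = (if i = j then x else 1)" for i and x :: real
  have g1: "(\<Prod>i\<in>UNIV. g1 i (y i)) = y j" for y unfolding g1_def by simp
  have Ig1: "integrable lborel (\<lambda>x. normal_density 0 (sqrt (v - u)) x * g1 i x)" for i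
    using N by (cases "i = j") (auto simp: g1_def)
  have [measurable]: "g1 i \<in> borel_measurable borel" for i unfolding g1_def by measurable
  show "integrable M (\<lambda>\<omega>. (B v \<omega> - B u \<omega>) $ j)"
    using brownian_increment_prod_moment(1)[OF B uv, of g1, OF _ Ig1] by (simp add: g1 del: vector_minus_component)
  have "(\<integral>\<omega>. (B v \<omega> - B u \<omega>) $ j \<partial>M)
      = (\<Prod>i\<in>UNIV. \<integral>x. normal_density 0 (sqrt (v - u)) x * g1 i x \<partial>lborel)"
    using brownian_increment_prod_moment(2)[OF B uv, of g1, OF _ Ig1] by (simp add: g1 del: vector_minus_component)
  also have "\<dots> = 0" by (rule prod_zero) (auto intro!: exI[of _ j] simp: g1_def N)
  finally show "(\<integral>\<omega>. (B v \<omega> - B u \<omega>) $ j \<partial>M) = 0" .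
  define g2 where "g2 i x = (if i = j then x else 1) * (if i = j' then x else 1)" for i and x :: real
  have g2: "(\<Prod>i\<in>UNIV. g2 i (y i)) = y j * y j'" for y unfolding g2_def by (simp add: prod.distrib)
  have Ig2: "integrable lborel (\<lambda>x. normal_density 0 (sqrt (v - u)) x * g2 i x)" for i
    using N by (cases "i = j"; cases "i = j'") (auto simp: g2_def power2_eq_square)
  have [measurable]: "g2 i \<in> borel_measurable borel" for i unfolding g2_def by measurable
  show "integrable M (\<lambda>\<omega>. (B v \<omega> - B u \<omega>) $ j * (B v \<omega> - B u \<omega>) $ j')"
    using brownian_increment_prod_moment(1)[OF B uv, of g2, OF _ Ig2] by (simp add: g2 del: vector_minus_component)
  have "(\<integral>\<omega>. (B v \<omega> - B u \<omega>) $ j * (B v \<omega> - B u \<omega>) $ j' \<partial>M)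
      = (\<Prod>i\<in>UNIV. \<integral>x. normal_density 0 (sqrt (v - u)) x * g2 i x \<partial>lborel)"
    using brownian_increment_prod_moment(2)[OF B uv, of g2, OF _ Ig2] by (simp add: g2 del: vector_minus_component)
  also have "\<dots> = of_bool (j = j') * (v - u)"
  proof (cases "j = j'")
    case True
    then have "(\<Prod>i\<in>UNIV. \<integral>x. normal_density 0 (sqrt (v - u)) x * g2 i x \<partial>lborel)
      = (\<Prod>i\<in>UNIV. if i = j then v - u else 1)"
      using N \<sigma> by (intro prod.cong) (auto simp: g2_def power2_eq_square)
    then show ?thesis using True by simp
  next
    case False
    then have "(\<Prod>i\<in>UNIV. \<integral>x. normal_density 0 (sqrt (v - u)) x * g2 i x \<partial>lborel) = 0"
      by (intro prod_zero) (auto intro!: exI[of _ j] simp: g2_def N)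
    then show ?thesis using False by simp
  qed
  finally show "(\<integral>\<omega>. (B v \<omega> - B u \<omega>) $ j * (B v \<omega> - B u \<omega>) $ j' \<partial>M) = of_bool (j = j') * (v - u)" .
qed

text \<open>An increment is independent of every event that concerns finitely many earlier values. The definition
of Brownian motion only speaks of increments along an ordered grid, so the times are sorted into a grid that starts at
\<open>0\<close> and reaches \<open>v\<close> in its last step; since \<open>B 0 = 0\<close> almost surely, the earlier values are partial sums of the
earlier increments.\<close>

lemma (in prob_space) brownian_increment_past_cylinder:
  fixes B :: "real \<Rightarrow> 'a \<Rightarrow> real ^ 'd" and g :: "real ^ 'd \<Rightarrow> real"
  assumes B: "brownian_motion M T B" and uv: "0 \<le> u" "u < v" "v \<le> T"
    and S: "finite S" "S \<subseteq> {0..u}" and E: "\<And>s. s \<in> S \<Longrightarrow> E s \<in> sets borel"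
    and g[measurable]: "g \<in> borel_measurable borel" and gI: "integrable M (\<lambda>\<omega>. g (B v \<omega> - B u \<omega>))"
  shows "(\<integral>\<omega>. (\<Prod>s\<in>S. indicator (E s) (B s \<omega>)) * g (B v \<omega> - B u \<omega>) \<partial>M)
    = (\<integral>\<omega>. (\<Prod>s\<in>S. indicator (E s) (B s \<omega>)) \<partial>M) * (\<integral>\<omega>. g (B v \<omega> - B u \<omega>) \<partial>M)"
proof -
  \<comment> \<open>\<open>L\<close> runs from \<open>0\<close> to \<open>u\<close>; appending \<open>v\<close> makes the increment from \<open>u\<close> to \<open>v\<close> the last one, with index \<open>k - 1\<close>.\<close>
  define L where "L = sorted_list_of_set (insert 0 (insert u S))"
  define k where "k = length L"
  have setL: "set L = insert 0 (insert u S)" and sL: "sorted L"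
    using S(1) unfolding L_def
    by (simp_all only: set_sorted_list_of_set sorted_sorted_list_of_set finite_insert)
  have kpos: "0 < k" using setL by (auto simp: k_def)
  have L0: "L ! 0 = 0"
  proof -
    obtain i where "i < k" "L ! i = 0" using setL by (metis insertI1 in_set_conv_nth k_def)
    then have "L ! 0 \<le> 0" using sL sorted_nth_mono[of L 0 i] by (simp add: k_def)
    moreover have "L ! 0 \<in> {0..u}" using nth_mem[of 0 L] kpos S(2) uv(1) unfolding setL k_def by auto
    ultimately show ?thesis by auto
  qed
  have Lk: "L ! (k - 1) = u"
  proof -
    obtain i where "i < k" "L ! i = u" using setL by (metis insertI1 insert_commute in_set_conv_nth k_def)
    then have "u \<le> L ! (k - 1)" using sL sorted_nth_mono[of L i "k - 1"] by (simp add: k_def)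
    moreover have "L ! (k - 1) \<in> {0..u}"
      using nth_mem[of "k - 1" L] kpos S(2) uv(1) unfolding setL k_def by auto
    ultimately show ?thesis by auto
  qed
  define \<tau> where "\<tau> j = (if j < k then L ! j else v)" for j
  have Lin: "j < k \<Longrightarrow> L ! j \<in> {0..u}" for j
    using nth_mem[of j L] S(2) uv(1) unfolding setL k_def by auto
  have \<tau>1: "\<forall>j\<le>k. \<tau> j \<in> {0..T}" using Lin uv by (force simp: \<tau>_def)
  have \<tau>2: "\<forall>j<k. \<tau> j \<le> \<tau> (Suc j)"
    using Lin uv sL by (force simp: \<tau>_def k_def sorted_iff_nth_Suc)
  define X where "X j \<omega> = B (\<tau> (Suc j)) \<omega> - B (\<tau> j) \<omega>" for j \<omega>
  have ind: "indep_vars (\<lambda>_. borel) X {..<k}"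
    using B \<tau>1 \<tau>2 unfolding brownian_motion_def X_def by blast
  have B0: "AE \<omega> in M. B 0 \<omega> = 0" using B by (auto simp: brownian_motion_def)
  have tele: "(\<Sum>l<i. X l \<omega>) = B (\<tau> i) \<omega> - B (\<tau> 0) \<omega>" for i \<omega>
    by (induction i) (auto simp: X_def)
  have \<tau>0: "\<tau> 0 = 0" using L0 kpos by (simp add: \<tau>_def)
  have "\<exists>i<k. \<tau> i = s" if "s \<in> S" for s
    using that setL by (metis (full_types) \<tau>_def in_set_conv_nth insertCI k_def)
  then obtain ix where ix: "\<And>s. s \<in> S \<Longrightarrow> ix s < k \<and> \<tau> (ix s) = s" by metis
  let ?J = "{..<k - 1}"
  define \<phi> :: "(nat \<Rightarrow> real ^ 'd) \<Rightarrow> real" where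
    "\<phi> y = (\<Prod>s\<in>S. indicator (E s) (\<Sum>l<ix s. y l))" for y
  have m\<phi>: "\<phi> \<in> borel_measurable (PiM ?J (\<lambda>_. borel))"
    unfolding \<phi>_def
  proof (rule borel_measurable_prod)
    fix s assume s: "s \<in> S"
    have "(\<lambda>y. y l) \<in> PiM ?J (\<lambda>_. borel) \<rightarrow>\<^sub>M (borel :: (real ^ 'd) measure)" if "l < ix s" for l
      using ix[OF s] that by (intro measurable_component_singleton) auto
    then have "(\<lambda>y. \<Sum>l<ix s. y l) \<in> borel_measurable (PiM ?J (\<lambda>_. borel :: (real ^ 'd) measure))"
      by (intro borel_measurable_sum) auto
    then show "(\<lambda>y. indicator (E s) (\<Sum>l<ix s. y l) :: real) \<in> borel_measurable (PiM ?J (\<lambda>_. borel))"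
      by (rule measurable_compose[OF _ borel_measurable_indicator[OF E[OF s]]])
  qed
  have mg: "(\<lambda>y. g (y (k - 1))) \<in> borel_measurable (PiM {k - 1} (\<lambda>_. borel))" by measurable
  have "indep_var (PiM ?J (\<lambda>_. borel)) (\<lambda>\<omega>. restrict (\<lambda>i. X i \<omega>) ?J)
      (PiM {k - 1} (\<lambda>_. borel)) (\<lambda>\<omega>. restrict (\<lambda>i. X i \<omega>) {k - 1})"
    using kpos by (intro indep_var_restrict[OF ind]) auto
  from indep_var_compose[OF this m\<phi> mg]
  have iv: "indep_var borel (\<lambda>\<omega>. \<phi> (restrict (\<lambda>i. X i \<omega>) ?J)) borel (\<lambda>\<omega>. g (X (k - 1) \<omega>))"
    by (simp add: comp_def)
  have Xk: "X (k - 1) \<omega> = B v \<omega> - B u \<omega>" for \<omega>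
    using kpos Lk by (simp add: X_def \<tau>_def)
  have \<phi>X: "AE \<omega> in M. \<phi> (restrict (\<lambda>i. X i \<omega>) ?J) = (\<Prod>s\<in>S. indicator (E s) (B s \<omega>))"
    using B0
  proof eventually_elim
    case (elim \<omega>)
    show ?case unfolding \<phi>_def
    proof (intro prod.cong refl arg_cong[where f="indicator _"])
      fix s assume s: "s \<in> S"
      have "(\<Sum>l<ix s. restrict (\<lambda>i. X i \<omega>) ?J l) = (\<Sum>l<ix s. X l \<omega>)"
        using ix[OF s] by (intro sum.cong) auto
      then show "(\<Sum>l<ix s. restrict (\<lambda>i. X i \<omega>) ?J l) = B s \<omega>"
        using tele[of \<omega> "ix s"] elim ix[OF s] \<tau>0 by simp
    qed
  qed
  have Bm[measurable]: "t \<in> {0..T} \<Longrightarrow> B t \<in> borel_measurable M" for t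
    using B by (auto simp: brownian_motion_def)
  have [measurable]: "B u \<in> borel_measurable M" "B v \<in> borel_measurable M" using Bm uv by auto
  have [measurable]: "(\<lambda>\<omega>. \<Prod>s\<in>S. indicator (E s) (B s \<omega>) :: real) \<in> borel_measurable M"
  proof (rule borel_measurable_prod)
    fix s assume s: "s \<in> S"
    then have "B s \<in> borel_measurable M" using S uv by (intro Bm) auto
    then show "(\<lambda>\<omega>. indicator (E s) (B s \<omega>) :: real) \<in> borel_measurable M"
      by (rule measurable_compose[OF _ borel_measurable_indicator[OF E[OF s]]])
  qed
  have m\<phi>X[measurable]: "(\<lambda>\<omega>. \<phi> (restrict (\<lambda>i. X i \<omega>) ?J)) \<in> borel_measurable M"
    using indep_var_rv1[OF iv] .
  have I\<phi>: "integrable M (\<lambda>\<omega>. \<phi> (restrict (\<lambda>i. X i \<omega>) ?J))"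
    by (rule integrable_const_bound[where B=1, OF _ m\<phi>X])
      (auto simp: \<phi>_def abs_prod indicator_def intro!: prod_le_1 AE_I2)
  have "(\<integral>\<omega>. (\<Prod>s\<in>S. indicator (E s) (B s \<omega>)) * g (B v \<omega> - B u \<omega>) \<partial>M)
      = (\<integral>\<omega>. \<phi> (restrict (\<lambda>i. X i \<omega>) ?J) * g (X (k - 1) \<omega>) \<partial>M)"
    unfolding Xk
  proof (rule integral_cong_AE)
    show "AE \<omega> in M. (\<Prod>s\<in>S. indicator (E s) (B s \<omega>)) * g (B v \<omega> - B u \<omega>)
      = \<phi> (restrict (\<lambda>i. X i \<omega>) ?J) * g (B v \<omega> - B u \<omega>)"
      using \<phi>X by eventually_elim (rule arg_cong2[where f="(*)"], auto)
  qed measurable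
  also have "\<dots> = (\<integral>\<omega>. \<phi> (restrict (\<lambda>i. X i \<omega>) ?J) \<partial>M) * (\<integral>\<omega>. g (X (k - 1) \<omega>) \<partial>M)"
    by (rule indep_var_lebesgue_integral[OF iv I\<phi>]) (simp only: Xk gI)
  also have "(\<integral>\<omega>. \<phi> (restrict (\<lambda>i. X i \<omega>) ?J) \<partial>M) = (\<integral>\<omega>. (\<Prod>s\<in>S. indicator (E s) (B s \<omega>)) \<partial>M)"
    by (rule integral_cong_AE[OF _ _ \<phi>X]) measurable
  finally show ?thesis by (simp only: Xk)
qed

text \<open>A Dynkin argument for one fixed integrable variable: the sets on which its integral is
the probability times its mean form a Dynkin system.\<close>

lemma (in prob_space) set_integral_eq_prob_sigma_sets:
  fixes f :: "'a \<Rightarrow> real"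
  assumes G: "Int_stable G" "G \<subseteq> sets M" and f: "integrable M f"
    and basic: "\<And>A. A \<in> G \<Longrightarrow> (LINT x:A|M. f x) = prob A * expectation f"
    and A: "A \<in> sigma_sets (space M) G"
  shows "(LINT x:A|M. f x) = prob A * expectation f"
proof -
  have sub: "sigma_sets (space M) G \<subseteq> sets M" using G(2) by (rule sets.sigma_sets_subset)
  have GP: "G \<subseteq> Pow (space M)" using G(2) sets.sets_into_space by blast
  show ?thesis
    using G(1) GP A
  proof (induction rule: sigma_sets_induct_disjoint)
    case (basic A)
    then show ?case by fact
  next
    case empty
    then show ?case by (simp add: set_lebesgue_integral_def)
  next
    case (compl A)
    then have A: "A \<in> sets M" using sub by auto
    have "(LINT x:(space M - A)|M. f x) = (\<integral>x. f x - indicator A x *\<^sub>R f x \<partial>M)"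
      unfolding set_lebesgue_integral_def
      by (intro Bochner_Integration.integral_cong) (auto simp: indicator_def)
    also have "\<dots> = expectation f - (LINT x:A|M. f x)"
      unfolding set_lebesgue_integral_def
      using f integrable_mult_indicator[OF A f] by (intro Bochner_Integration.integral_diff) auto
    also have "\<dots> = prob (space M - A) * expectation f"
      using compl A by (simp add: prob_compl algebra_simps)
    finally show ?case .
  next
    case (union A)
    have As: "A i \<in> sets M" for i using union(2) sub by blast
    have "(LINT x:(\<Union>i. A i)|M. f x) = (\<Sum>i. LINT x:A i|M. f x)"
    proof (rule lebesgue_integral_countable_add)
      show "set_integrable M (\<Union>i. A i) f"
        unfolding set_integrable_def using As by (intro integrable_mult_indicator f) auto
    qed (use As union(1) in \<open>auto simp: disjoint_family_on_def\<close>)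
    also have "\<dots> = (\<Sum>i. prob (A i) * expectation f)" using union(3) by simp
    also have "\<dots> = (\<Sum>i. prob (A i)) * expectation f"
      using finite_measure_UNION[of A] As union(1) by (intro suminf_mult2[symmetric]) (auto simp: sums_iff)
    also have "(\<Sum>i. prob (A i)) = prob (\<Union>i. A i)"
      using finite_measure_UNION[of A] As union(1) by (auto simp: sums_iff)
    finally show ?case .
  qed
qed

section \<open>Brownian increments and the augmented filtration\<close>

lemma brownian_motion_measurable:
  "brownian_motion M T B \<Longrightarrow> t \<in> {0..T} \<Longrightarrow> B t \<in> borel_measurable M"
  by (auto simp: brownian_motion_def)

text \<open>The sigma-algebras of the filtrations are built from arbitrary functions; they lie inside the underlying
one only if the generating paths are measurable at all times in \<open>{0..T}\<close>.\<close>

definition measurable_paths :: "'w measure \<Rightarrow> real \<Rightarrow> (real \<Rightarrow> 'w \<Rightarrow> 'v::topological_space) set \<Rightarrow> bool" where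
  "measurable_paths M T \<W> \<longleftrightarrow> (\<forall>X\<in>\<W>. \<forall>s\<in>{0..T}. X s \<in> borel_measurable M)"

lemma completed_filtration_gens:
  assumes "measurable_paths M T \<W>"
  shows "{X s -` A \<inter> space M |X s A. X \<in> \<W> \<and> 0 \<le> s \<and> s \<le> min t T \<and> A \<in> sets borel} \<union> null_sets M
    \<subseteq> sets M"
  using assms by (auto simp: measurable_paths_def intro!: measurable_sets)

lemma sets_completed_filtration:
  assumes "measurable_paths M T \<W>"
  shows "sets (completed_filtration M T \<W> t) = sigma_sets (space M)
     ({X s -` A \<inter> space M |X s A. X \<in> \<W> \<and> 0 \<le> s \<and> s \<le> min t T \<and> A \<in> sets borel} \<union> null_sets M)"
  unfolding completed_filtration_def
  by (rule sets_measure_of) (use completed_filtration_gens[OF assms] sets.sets_into_space in blast)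

lemma space_completed_filtration[simp]: "space (completed_filtration M T \<W> t) = space M"
  by (simp add: completed_filtration_def space_measure_of_conv)

lemma completed_filtration_subset:
  "measurable_paths M T \<W> \<Longrightarrow> sets (completed_filtration M T \<W> t) \<subseteq> sets M"
  unfolding sets_completed_filtration by (rule sets.sigma_sets_subset) (rule completed_filtration_gens)

lemma completed_filtration_mono:
  fixes \<V> \<W> :: "(real \<Rightarrow> 'w \<Rightarrow> 'v::topological_space) set"
  assumes "measurable_paths M T \<V>" "\<W> \<subseteq> \<V>" "s \<le> t"
  shows "sets (completed_filtration M T \<W> s) \<subseteq> sets (completed_filtration M T \<V> t)"
proof -
  have W: "measurable_paths M T \<W>" using assms by (auto simp: measurable_paths_def)
  show ?thesis
    unfolding sets_completed_filtration[OF assms(1)] sets_completed_filtration[OF W]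
  proof (rule sigma_sets_mono', rule Un_mono)
    show "{X r -` A \<inter> space M |X r A. X \<in> \<W> \<and> 0 \<le> r \<and> r \<le> min s T \<and> A \<in> sets borel}
      \<subseteq> {X r -` A \<inter> space M |X r A. X \<in> \<V> \<and> 0 \<le> r \<and> r \<le> min t T \<and> A \<in> sets borel}"
    proof safe
      fix X r and A :: "'v set" assume "X \<in> \<W>" "0 \<le> r" "r \<le> min s T" "A \<in> sets borel"
      then show "\<exists>X' r' A'. X r -` A \<inter> space M = X' r' -` A' \<inter> space M \<and> X' \<in> \<V> \<and> 0 \<le> r' \<and> r' \<le> min t T \<and> A' \<in> sets borel"
        using assms by (intro exI[of _ X] exI[of _ r] exI[of _ A]) auto
    qed
  qed auto
qed

lemma space_aug_filtration[simp]: "space (aug_filtration M T \<W> t) = space M"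
  by (simp add: aug_filtration_def space_measure_of_conv)

lemma sets_aug_filtration:
  assumes "measurable_paths M T \<W>"
  shows "sets (aug_filtration M T \<W> t) = (\<Inter>u\<in>{t<..}. sets (completed_filtration M T \<W> u))"
proof -
  let ?I = "\<Inter>u\<in>{t<..}. sets (completed_filtration M T \<W> u)"
  have I: "?I \<subseteq> sets (completed_filtration M T \<W> u)" if "t < u" for u using that by auto
  have "?I \<subseteq> Pow (space M)"
    using I[of "t + 1"] sets.space_closed[of "completed_filtration M T \<W> (t + 1)"] by auto
  then have "sets (aug_filtration M T \<W> t) = sigma_sets (space M) ?I"
    unfolding aug_filtration_def by (rule sets_measure_of)
  also have "\<dots> = ?I"
  proof
    show "sigma_sets (space M) ?I \<subseteq> ?I"
    proof (rule INT_greatest)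
      fix u assume "u \<in> {t<..}"
      then have "sigma_sets (space (completed_filtration M T \<W> u)) ?I \<subseteq> sets (completed_filtration M T \<W> u)"
        by (intro sets.sigma_sets_subset I) auto
      then show "sigma_sets (space M) ?I \<subseteq> sets (completed_filtration M T \<W> u)" by simp
    qed
  qed auto
  finally show ?thesis .
qed

lemma aug_filtration_subset:
  "measurable_paths M T \<W> \<Longrightarrow> sets (aug_filtration M T \<W> t) \<subseteq> sets M"
  using completed_filtration_subset[of M T \<W> "t + 1"] by (auto simp: sets_aug_filtration)

lemma aug_filtration_mono:
  assumes "measurable_paths M T \<V>" "\<W> \<subseteq> \<V>" "s \<le> t"
  shows "sets (aug_filtration M T \<W> s) \<subseteq> sets (aug_filtration M T \<V> t)"
proof -
  have W: "measurable_paths M T \<W>" using assms by (auto simp: measurable_paths_def)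
  show ?thesis
    unfolding sets_aug_filtration[OF assms(1)] sets_aug_filtration[OF W]
    using completed_filtration_mono[OF assms(1,2) order_refl] assms(3) by fastforce
qed

lemma measurable_ident_subset:
  assumes "space F = space M" "sets F \<subseteq> sets M"
  shows "(\<lambda>x. x) \<in> M \<rightarrow>\<^sub>M F"
proof (rule measurableI)
  fix A assume "A \<in> sets F"
  then have "A \<in> sets M" using assms by blast
  then show "(\<lambda>x. x) -` A \<inter> space M \<in> sets M" by simp
qed (simp add: assms)

lemma measurable_sub_algebra:
  assumes "f \<in> borel_measurable F" "space F = space G" "sets F \<subseteq> sets G"
  shows "f \<in> borel_measurable G"
  using assms by (auto simp: measurable_def)

lemma aug_filtration_measurable:
  fixes X :: "real \<Rightarrow> 'w \<Rightarrow> 'v::topological_space"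
  assumes "measurable_paths M T \<W>" "X \<in> \<W>" "0 \<le> s" "s \<le> t" "s \<le> T"
  shows "X s \<in> borel_measurable (aug_filtration M T \<W> t)"
proof (rule measurableI)
  fix A assume A: "A \<in> sets (borel :: 'v measure)"
  have "X s -` A \<inter> space M \<in> sets (completed_filtration M T \<W> u)" if "t < u" for u
    unfolding sets_completed_filtration[OF assms(1)]
    using assms that A by (intro sigma_sets.Basic UnI1 CollectI exI[of _ X] exI[of _ s] exI[of _ A]) auto
  then show "X s -` A \<inter> space (aug_filtration M T \<W> t) \<in> sets (aug_filtration M T \<W> t)"
    using assms by (simp add: sets_aug_filtration)
qed auto

text \<open>Finitely many Brownian motions with mutually independent paths. The common noise and the noises of the
particles form such a family on the product space, and all equations are compared in its filtration.\<close>

locale brownian_family = prob_space M for M :: "'w measure" +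
  fixes T :: real and K :: "'k set" and X :: "'k \<Rightarrow> real \<Rightarrow> 'w \<Rightarrow> real ^ 'd::finite"
  assumes T_pos: "0 < T" and K_finite: "finite K"
    and brownian: "\<And>k. k \<in> K \<Longrightarrow> brownian_motion M T (X k)"
    and paths_indep: "indep_vars (\<lambda>_. Pi\<^sub>M {0..T} (\<lambda>_. borel)) (\<lambda>k. sample_path T (X k)) K"
begin

abbreviation "\<F> \<equiv> aug_filtration M T (X ` K)"

lemma measurable_paths_family: "measurable_paths M T (X ` K)"
  using brownian_motion_measurable[OF brownian] by (auto simp: measurable_paths_def)

lemma X_measurable: "k \<in> K \<Longrightarrow> t \<in> {0..T} \<Longrightarrow> X k t \<in> borel_measurable M"
  using brownian_motion_measurable[OF brownian] by blast

definition cylinders :: "real \<Rightarrow> 'w set set" where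
  "cylinders u = {{\<omega>\<in>space M. \<forall>k\<in>K. \<forall>s\<in>S. X k s \<omega> \<in> E k s} | S E.
     finite S \<and> S \<subseteq> {0..u} \<and> (\<forall>k s. E k s \<in> sets borel)}"

text \<open>Independence across the family turns the integral into a product over \<open>k\<close>; within each factor the past
cylinder splits off. It is enough to consider products of functions of the increments because only first moments and
second mixed moments of their coordinates enter the isometry.\<close>

lemma cylinder_moment:
  fixes g :: "'k \<Rightarrow> real ^ 'd \<Rightarrow> real"
  assumes uv: "0 \<le> u" "u < v" "v \<le> T" and C: "C \<in> cylinders u"
    and g: "\<And>k. g k \<in> borel_measurable borel"
    and gI: "\<And>k. k \<in> K \<Longrightarrow> integrable M (\<lambda>\<omega>. g k (X k v \<omega> - X k u \<omega>))"
  shows "integrable M (\<lambda>\<omega>. \<Prod>k\<in>K. g k (X k v \<omega> - X k u \<omega>))"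
    and "expectation (\<lambda>\<omega>. \<Prod>k\<in>K. g k (X k v \<omega> - X k u \<omega>)) = (\<Prod>k\<in>K. expectation (\<lambda>\<omega>. g k (X k v \<omega> - X k u \<omega>)))"
    and "(LINT \<omega>:C|M. (\<Prod>k\<in>K. g k (X k v \<omega> - X k u \<omega>)))
      = prob C * expectation (\<lambda>\<omega>. \<Prod>k\<in>K. g k (X k v \<omega> - X k u \<omega>))"
proof -
  obtain S E where S: "finite S" "S \<subseteq> {0..u}" and E: "\<And>k s. E k s \<in> sets borel"
    and C_eq: "C = {\<omega>\<in>space M. \<forall>k\<in>K. \<forall>s\<in>S. X k s \<omega> \<in> E k s}"
    using C by (auto simp: cylinders_def)
  let ?P = "Pi\<^sub>M {0..T} (\<lambda>_. borel) :: (real \<Rightarrow> real ^ 'd) measure"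
  let ?ind = "\<lambda>k \<omega>. \<Prod>s\<in>S. indicator (E k s) (X k s \<omega>) :: real"
  have comp: "(\<lambda>p. p s) \<in> borel_measurable ?P" if "s \<in> {0..T}" for s
    using that by (rule measurable_component_singleton)
  have sT: "s \<in> {0..T}" if "s \<in> S" for s using that S uv by auto
  have mi: "(\<lambda>p. \<Prod>s\<in>S. indicator (E k s) (p s) :: real) \<in> borel_measurable ?P" for k
    by (rule borel_measurable_prod, rule measurable_compose[OF comp[OF sT] borel_measurable_indicator[OF E]])
  have mg: "(\<lambda>p. g k (p v - p u)) \<in> borel_measurable ?P" for k
    by (rule measurable_compose[OF borel_measurable_diff[OF comp comp] g]) (use uv in auto)
  have rs: "sample_path T (X k) \<omega> s = X k s \<omega>" if "s \<in> {0..T}" for k s \<omega>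
    using that by (simp add: sample_path_def)
  have uvT: "u \<in> {0..T}" "v \<in> {0..T}" using uv by auto
  have iv_g: "indep_vars (\<lambda>_. borel) (\<lambda>k \<omega>. g k (X k v \<omega> - X k u \<omega>)) K"
    using indep_vars_compose2[OF paths_indep, of "\<lambda>k p. g k (p v - p u)" "\<lambda>_. borel"] mg
    by (simp add: rs[OF uvT(1)] rs[OF uvT(2)])
  have iv_i: "indep_vars (\<lambda>_. borel) ?ind K"
    using indep_vars_compose2[OF paths_indep, of "\<lambda>k p. \<Prod>s\<in>S. indicator (E k s) (p s) :: real" "\<lambda>_. borel"] mi
    by (simp add: rs[OF sT] cong: prod.cong)
  have iv_ig: "indep_vars (\<lambda>_. borel) (\<lambda>k \<omega>. ?ind k \<omega> * g k (X k v \<omega> - X k u \<omega>)) K"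
    using indep_vars_compose2[OF paths_indep, of "\<lambda>k p. (\<Prod>s\<in>S. indicator (E k s) (p s) :: real) * g k (p v - p u)"
        "\<lambda>_. borel"] borel_measurable_times[OF mi mg]
    by (simp add: rs[OF sT] rs[OF uvT(1)] rs[OF uvT(2)] cong: prod.cong)
  have ind_m: "?ind k \<in> borel_measurable M" if "k \<in> K" for k
    using iv_i that by (simp add: indep_vars_def)
  have ind_01: "0 \<le> ?ind k \<omega>" "?ind k \<omega> \<le> 1" for k \<omega>
    by (auto intro!: prod_nonneg prod_le_1 simp: indicator_def)
  have ind_I: "integrable M (?ind k)" if "k \<in> K" for k
    by (rule integrable_const_bound[where B=1, OF _ ind_m[OF that]]) (use ind_01 in auto)
  have ig_I: "integrable M (\<lambda>\<omega>. ?ind k \<omega> * g k (X k v \<omega> - X k u \<omega>))" if "k \<in> K" for k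
  proof (rule Bochner_Integration.integrable_bound[OF gI[OF that]])
    show "(\<lambda>\<omega>. ?ind k \<omega> * g k (X k v \<omega> - X k u \<omega>)) \<in> borel_measurable M"
      using iv_ig that by (simp add: indep_vars_def)
    show "AE \<omega> in M. norm (?ind k \<omega> * g k (X k v \<omega> - X k u \<omega>)) \<le> norm (g k (X k v \<omega> - X k u \<omega>))"
      using ind_01[of k] by (intro AE_I2) (simp add: abs_mult mult_left_le_one_le del: abs_prod)
  qed
  show "integrable M (\<lambda>\<omega>. \<Prod>k\<in>K. g k (X k v \<omega> - X k u \<omega>))"
    by (rule indep_vars_integrable[OF K_finite iv_g gI])
  show eg: "expectation (\<lambda>\<omega>. \<Prod>k\<in>K. g k (X k v \<omega> - X k u \<omega>)) = (\<Prod>k\<in>K. expectation (\<lambda>\<omega>. g k (X k v \<omega> - X k u \<omega>)))"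
    by (rule indep_vars_lebesgue_integral[OF K_finite iv_g gI])
  have indC: "indicator C \<omega> = (\<Prod>k\<in>K. ?ind k \<omega>)" if \<omega>: "\<omega> \<in> space M" for \<omega>
  proof (cases "\<omega> \<in> C")
    case True
    then show ?thesis by (auto simp: C_eq intro!: prod.neutral[symmetric])
  next
    case False
    then obtain k s where "k \<in> K" "s \<in> S" "X k s \<omega> \<notin> E k s" using \<omega> by (auto simp: C_eq)
    then have "?ind k \<omega> = 0" using S(1) by (intro prod_zero) (auto intro!: bexI[of _ s])
    then have "(\<Prod>k\<in>K. ?ind k \<omega>) = 0" using K_finite \<open>k \<in> K\<close> by (intro prod_zero) (auto intro!: bexI[of _ k])
    then show ?thesis using False by simp
  qed
  have Cm: "C \<in> sets M"
  proof -
    have m: "(\<lambda>\<omega>. \<Prod>k\<in>K. ?ind k \<omega>) \<in> borel_measurable M" by (intro borel_measurable_prod ind_m)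
    have "(indicator C :: _ \<Rightarrow> real) \<in> borel_measurable M"
      using measurable_cong[of M "indicator C" "\<lambda>\<omega>. \<Prod>k\<in>K. ?ind k \<omega>" "borel :: real measure"] indC m by blast
    then have "C \<inter> space M \<in> sets M" by (simp add: borel_measurable_indicator_iff)
    moreover have "C \<subseteq> space M" by (auto simp: C_eq)
    ultimately show ?thesis by (simp add: Int_absorb2)
  qed
  have "(LINT \<omega>:C|M. (\<Prod>k\<in>K. g k (X k v \<omega> - X k u \<omega>)))
      = (\<integral>\<omega>. (\<Prod>k\<in>K. ?ind k \<omega> * g k (X k v \<omega> - X k u \<omega>)) \<partial>M)"
    unfolding set_lebesgue_integral_def
    by (intro Bochner_Integration.integral_cong refl) (simp add: indC prod.distrib)
  also have "\<dots> = (\<Prod>k\<in>K. expectation (\<lambda>\<omega>. ?ind k \<omega> * g k (X k v \<omega> - X k u \<omega>)))"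
    by (rule indep_vars_lebesgue_integral[OF K_finite iv_ig ig_I])
  also have "\<dots> = (\<Prod>k\<in>K. expectation (?ind k) * expectation (\<lambda>\<omega>. g k (X k v \<omega> - X k u \<omega>)))"
    by (intro prod.cong refl brownian_increment_past_cylinder[OF brownian uv S] E g gI)
  also have "\<dots> = (\<Prod>k\<in>K. expectation (?ind k)) * expectation (\<lambda>\<omega>. \<Prod>k\<in>K. g k (X k v \<omega> - X k u \<omega>))"
    by (simp add: prod.distrib eg)
  also have "(\<Prod>k\<in>K. expectation (?ind k)) = expectation (\<lambda>\<omega>. \<Prod>k\<in>K. ?ind k \<omega>)"
    by (rule indep_vars_lebesgue_integral[OF K_finite iv_i ind_I, symmetric])
  also have "\<dots> = expectation (indicator C)"
    by (intro Bochner_Integration.integral_cong refl) (simp add: indC)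
  also have "\<dots> = prob C" using Cm by simp
  finally show "(LINT \<omega>:C|M. (\<Prod>k\<in>K. g k (X k v \<omega> - X k u \<omega>)))
      = prob C * expectation (\<lambda>\<omega>. \<Prod>k\<in>K. g k (X k v \<omega> - X k u \<omega>))" .
qed

lemma cylinders_sets: "u \<le> T \<Longrightarrow> cylinders u \<subseteq> sets M"
proof
  fix C assume u: "u \<le> T" and "C \<in> cylinders u"
  then obtain S E where S: "finite S" "S \<subseteq> {0..u}" and E: "\<And>k s. E k s \<in> sets borel"
    and C_eq: "C = {\<omega>\<in>space M. \<forall>k\<in>K. \<forall>s\<in>S. X k s \<omega> \<in> E k s}"
    by (auto simp: cylinders_def)
  have m: "{\<omega>\<in>space M. X k s \<omega> \<in> E k s} \<in> sets M" if "k \<in> K" "s \<in> S" for k s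
    using measurable_sets[OF X_measurable[OF that(1)] E, of s k s] S that u
    by (auto simp: vimage_def Int_def conj_commute)
  show "C \<in> sets M"
    unfolding C_eq by (intro sets.sets_Collect_finite_All' sets.sets_Collect_finite_All m S K_finite)
qed

text \<open>Cylinders together with the null sets form an intersection-stable generator of the completed filtration.\<close>

lemma cylinder_moment_completed:
  fixes g :: "'k \<Rightarrow> real ^ 'd \<Rightarrow> real"
  assumes uv: "0 \<le> u" "u < v" "v \<le> T"
    and g: "\<And>k. g k \<in> borel_measurable borel"
    and gI: "\<And>k. k \<in> K \<Longrightarrow> integrable M (\<lambda>\<omega>. g k (X k v \<omega> - X k u \<omega>))"
    and A: "A \<in> sets (completed_filtration M T (X ` K) u)"
  shows "(LINT \<omega>:A|M. (\<Prod>k\<in>K. g k (X k v \<omega> - X k u \<omega>)))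
      = prob A * (\<Prod>k\<in>K. expectation (\<lambda>\<omega>. g k (X k v \<omega> - X k u \<omega>)))"
proof -
  have uT: "u \<le> T" using uv by simp
  let ?G = "cylinders u \<union> null_sets M"
  have full: "space M \<in> cylinders u"
    unfolding cylinders_def by (intro CollectI exI[of _ "{}"] exI[of _ "\<lambda>_ _. UNIV"]) auto
  note I = cylinder_moment(1)[OF uv full g gI]
  have cap: "C \<inter> D \<in> cylinders u" if CD: "C \<in> cylinders u" "D \<in> cylinders u" for C D
  proof -
    obtain S E where S: "finite S" "S \<subseteq> {0..u}" and E: "\<And>k s. E k s \<in> sets borel"
      and C_eq: "C = {\<omega>\<in>space M. \<forall>k\<in>K. \<forall>s\<in>S. X k s \<omega> \<in> E k s}"
      using CD(1) by (auto simp: cylinders_def)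
    obtain S' E' where S': "finite S'" "S' \<subseteq> {0..u}" and E': "\<And>k s. E' k s \<in> sets borel"
      and D_eq: "D = {\<omega>\<in>space M. \<forall>k\<in>K. \<forall>s\<in>S'. X k s \<omega> \<in> E' k s}"
      using CD(2) by (auto simp: cylinders_def)
    show ?thesis
      unfolding cylinders_def
      by (intro CollectI exI[of _ "S \<union> S'"]
          exI[of _ "\<lambda>k s. (if s \<in> S then E k s else UNIV) \<inter> (if s \<in> S' then E' k s else UNIV)"])
        (use S S' E E' in \<open>auto simp: C_eq D_eq split: if_splits\<close>)
  qed
  have stable: "Int_stable ?G"
  proof (rule Int_stableI)
    fix a b assume "a \<in> ?G" "b \<in> ?G"
    then show "a \<inter> b \<in> ?G"
      using cap cylinders_sets[OF uT] null_set_Int1[of _ M] null_set_Int2[of _ M] by blast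
  qed
  have sub: "?G \<subseteq> sets M" using cylinders_sets[OF uT] by auto
  have "sets (completed_filtration M T (X ` K) u) \<subseteq> sigma_sets (space M) ?G"
    unfolding sets_completed_filtration[OF measurable_paths_family]
  proof (rule sigma_sets_mono', safe)
    fix k s and A :: "(real ^ 'd) set" assume k: "k \<in> K" "0 \<le> s" "s \<le> min u T" "A \<in> sets borel"
      and nc: "X k s -` A \<inter> space M \<notin> null_sets M"
    show "X k s -` A \<inter> space M \<in> cylinders u"
      unfolding cylinders_def
      by (intro CollectI exI[of _ "{s}"] exI[of _ "\<lambda>k' _. if k' = k then A else UNIV"])
        (use k in auto)
  qed
  then have A': "A \<in> sigma_sets (space M) ?G" using A by auto
  have "(LINT \<omega>:A|M. (\<Prod>k\<in>K. g k (X k v \<omega> - X k u \<omega>)))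
      = prob A * expectation (\<lambda>\<omega>. \<Prod>k\<in>K. g k (X k v \<omega> - X k u \<omega>))"
  proof (rule set_integral_eq_prob_sigma_sets[OF stable sub I _ A'])
    fix A assume "A \<in> ?G"
    then show "(LINT \<omega>:A|M. (\<Prod>k\<in>K. g k (X k v \<omega> - X k u \<omega>)))
      = prob A * expectation (\<lambda>\<omega>. \<Prod>k\<in>K. g k (X k v \<omega> - X k u \<omega>))"
    proof
      assume "A \<in> cylinders u"
      then show ?thesis by (rule cylinder_moment(3)[OF uv _ g gI])
    next
      assume A: "A \<in> null_sets M"
      then have "prob A = 0" by (simp add: measure_eq_0_null_sets)
      moreover have "(LINT \<omega>:A|M. (\<Prod>k\<in>K. g k (X k v \<omega> - X k u \<omega>))) = 0"
        unfolding set_lebesgue_integral_def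
        by (rule integral_eq_zero_AE) (use AE_not_in[OF A] in eventually_elim, auto)
      ultimately show ?thesis by simp
    qed
  qed
  then show ?thesis using cylinder_moment(2)[OF uv full g gI] by simp
qed

end

context brownian_family
begin

lemma X_diff_measurable: "k \<in> K \<Longrightarrow> u \<in> {0..T} \<Longrightarrow> v \<in> {0..T} \<Longrightarrow> (\<lambda>\<omega>. X k v \<omega> - X k u \<omega>) \<in> borel_measurable M"
  by (intro borel_measurable_diff X_measurable)

lemma increment_component:
  assumes k: "k \<in> K" and uv: "0 \<le> u" "u \<le> v" "v \<le> T"
  shows "square_integrable M (\<lambda>\<omega>. (X k v \<omega> - X k u \<omega>) $ j)"
    and "(\<integral>\<omega>. (norm ((X k v \<omega> - X k u \<omega>) $ j))\<^sup>2 \<partial>M) = v - u"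
proof -
  have m: "(\<lambda>\<omega>. (X k v \<omega> - X k u \<omega>) $ j) \<in> borel_measurable M"
    using uv by (intro borel_measurable_nth X_diff_measurable k) auto
  have *: "integrable M (\<lambda>\<omega>. (norm ((X k v \<omega> - X k u \<omega>) $ j))\<^sup>2) \<and>
    (\<integral>\<omega>. (norm ((X k v \<omega> - X k u \<omega>) $ j))\<^sup>2 \<partial>M) = v - u"
  proof (cases "u = v")
    case False
    then have "u < v" using uv by simp
    from brownian_increment_moments(3,4)[OF brownian[OF k] uv(1) this uv(3), of j j]
    show ?thesis by (simp add: power2_eq_square)
  qed simp
  then show "square_integrable M (\<lambda>\<omega>. (X k v \<omega> - X k u \<omega>) $ j)"
    "(\<integral>\<omega>. (norm ((X k v \<omega> - X k u \<omega>) $ j))\<^sup>2 \<partial>M) = v - u"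
    using m by (auto simp: square_integrable_def simp del: vector_minus_component)
qed

lemma increment_square_integrable:
  assumes k: "k \<in> K" and uv: "0 \<le> u" "u \<le> v" "v \<le> T"
  shows "square_integrable M (\<lambda>\<omega>. X k v \<omega> - X k u \<omega>)"
proof -
  have "integrable M (\<lambda>\<omega>. \<Sum>j\<in>UNIV. (norm ((X k v \<omega> - X k u \<omega>) $ j))\<^sup>2)"
    using increment_component(1)[OF assms] by (intro Bochner_Integration.integrable_sum) (auto simp: square_integrable_def)
  also have "(\<lambda>\<omega>. \<Sum>j\<in>UNIV. (norm ((X k v \<omega> - X k u \<omega>) $ j))\<^sup>2) = (\<lambda>\<omega>. (norm (X k v \<omega> - X k u \<omega>))\<^sup>2)"
    by (simp only: norm_vec_def L2_set_def real_sqrt_pow2[OF sum_nonneg[OF zero_le_power2]])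
  finally show ?thesis
    using X_diff_measurable[OF k, of u v] uv by (simp add: square_integrable_def)
qed

lemma completed_increment_moments:
  assumes k: "k \<in> K" and l: "l \<in> K" and uv: "0 \<le> u" "u < v" "v \<le> T"
    and A: "A \<in> sets (completed_filtration M T (X ` K) u)"
  shows "(LINT \<omega>:A|M. (X k v \<omega> - X k u \<omega>) $ j) = 0"
    and "(LINT \<omega>:A|M. (X k v \<omega> - X k u \<omega>) $ j * (X l v \<omega> - X l u \<omega>) $ j')
      = prob A * (of_bool (k = l \<and> j = j') * (v - u))"
proof -
  note mom = brownian_increment_moments[OF brownian uv]
  define g1 where "g1 m y = (if m = k then y $ j else 1)" for m and y :: "real ^ 'd"
  have [measurable]: "g1 m \<in> borel_measurable borel" for m
    unfolding g1_def by measurable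
  have g1: "(\<Prod>m\<in>K. g1 m (y m)) = y k $ j" for y
    using k K_finite by (simp add: g1_def if_distrib[of "\<lambda>x. x _"] cong: if_cong)
  have I1: "m \<in> K \<Longrightarrow> integrable M (\<lambda>\<omega>. g1 m (X m v \<omega> - X m u \<omega>))" for m
    using mom(1)[of m j] by (cases "m = k") (auto simp: g1_def)
  have "(LINT \<omega>:A|M. (X k v \<omega> - X k u \<omega>) $ j)
      = prob A * (\<Prod>m\<in>K. expectation (\<lambda>\<omega>. g1 m (X m v \<omega> - X m u \<omega>)))"
    using cylinder_moment_completed[OF uv, of g1, OF _ I1 A] unfolding g1 by simp
  moreover have "(\<Prod>m\<in>K. expectation (\<lambda>\<omega>. g1 m (X m v \<omega> - X m u \<omega>))) = 0"
    using mom(2)[OF k, of j] by (intro prod_zero K_finite bexI[OF _ k]) (simp add: g1_def)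
  ultimately show "(LINT \<omega>:A|M. (X k v \<omega> - X k u \<omega>) $ j) = 0" by simp
  define g2 where "g2 m y = (if m = k then y $ j else 1) * (if m = l then y $ j' else 1)" for m and y :: "real ^ 'd"
  have [measurable]: "g2 m \<in> borel_measurable borel" for m
    unfolding g2_def by measurable
  have g2: "(\<Prod>m\<in>K. g2 m (y m)) = y k $ j * y l $ j'" for y
    using k l K_finite by (simp add: g2_def prod.distrib if_distrib[of "\<lambda>x. x _"] cong: if_cong)
  have I2: "m \<in> K \<Longrightarrow> integrable M (\<lambda>\<omega>. g2 m (X m v \<omega> - X m u \<omega>))" for m
    using mom(1)[of m j] mom(1)[of m j'] mom(3)[of m j j']
    by (cases "m = k"; cases "m = l") (auto simp: g2_def)
  have e1: "(LINT \<omega>:A|M. (X k v \<omega> - X k u \<omega>) $ j * (X l v \<omega> - X l u \<omega>) $ j')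
      = prob A * (\<Prod>m\<in>K. expectation (\<lambda>\<omega>. g2 m (X m v \<omega> - X m u \<omega>)))"
    using cylinder_moment_completed[OF uv, of g2, OF _ I2 A] unfolding g2 by simp
  have "(\<Prod>m\<in>K. expectation (\<lambda>\<omega>. g2 m (X m v \<omega> - X m u \<omega>))) = of_bool (k = l \<and> j = j') * (v - u)"
  proof (cases "k = l")
    case True
    then have "(\<Prod>m\<in>K. expectation (\<lambda>\<omega>. g2 m (X m v \<omega> - X m u \<omega>)))
      = (\<Prod>m\<in>K. if m = k then of_bool (j = j') * (v - u) else 1)"
      using mom(4)[OF k, of j j'] by (intro prod.cong) (auto simp: g2_def prob_space simp del: vector_minus_component)
    also have "\<dots> = of_bool (j = j') * (v - u)" using k K_finite by simp
    finally show ?thesis using True by simp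
  next
    case False
    then have "(\<Prod>m\<in>K. expectation (\<lambda>\<omega>. g2 m (X m v \<omega> - X m u \<omega>))) = 0"
      using mom(2)[OF k, of j] by (intro prod_zero K_finite bexI[OF _ k]) (simp add: g2_def)
    then show ?thesis using False by simp
  qed
  then show "(LINT \<omega>:A|M. (X k v \<omega> - X k u \<omega>) $ j * (X l v \<omega> - X l u \<omega>) $ j')
      = prob A * (of_bool (k = l \<and> j = j') * (v - u))" using e1 by simp
qed

text \<open>A set of the right-continuous augmentation at time \<open>u\<close> belongs to the completed filtration at every later
time \<open>r\<close>, so it is uncorrelated with the increment from \<open>r\<close> to \<open>v\<close>. As \<open>r\<close> decreases to \<open>u\<close>, these
increments converge in \<open>L\<^sup>2\<close>, because the variance of a coordinate between \<open>u\<close> and \<open>r\<close> is \<open>r - u\<close>.\<close>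

lemma aug_increment_moments:
  assumes k: "k \<in> K" and l: "l \<in> K" and uv: "0 \<le> u" "u < v" "v \<le> T"
    and A: "A \<in> sets (\<F> u)"
  shows "(LINT \<omega>:A|M. (X k v \<omega> - X k u \<omega>) $ j) = 0"
    and "(LINT \<omega>:A|M. (X k v \<omega> - X k u \<omega>) $ j * (X l v \<omega> - X l u \<omega>) $ j')
      = prob A * (of_bool (k = l \<and> j = j') * (v - u))"
proof -
  define r where "r n = u + (v - u) * inverse (real (Suc (Suc n)))" for n
  have "(\<lambda>n. inverse (real (Suc (Suc n)))) \<longlonglongrightarrow> 0"
    using LIMSEQ_inverse_real_of_nat by (rule LIMSEQ_Suc)
  then have "r \<longlonglongrightarrow> u + (v - u) * 0" unfolding r_def by (intro tendsto_intros)
  then have r: "r \<longlonglongrightarrow> u" by simp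
  have r1: "u < r n" "r n < v" for n
  proof -
    show "u < r n" using uv by (simp add: r_def)
    have "(v - u) * inverse (real (Suc (Suc n))) < (v - u) * 1"
      using uv by (intro mult_strict_left_mono) (auto simp: inverse_eq_divide)
    then show "r n < v" by (simp add: r_def)
  qed
  have rT: "r n \<in> {0..T}" for n using r1[of n] uv by auto
  have Am: "A \<in> sets M" using A aug_filtration_subset[OF measurable_paths_family] by auto
  have An: "A \<in> sets (completed_filtration M T (X ` K) (r n))" for n
    using A r1[of n] by (simp add: sets_aug_filtration[OF measurable_paths_family])
  let ?x = "\<lambda>m i w \<omega>. (X m v \<omega> - X m w \<omega>) $ i"
  have sq: "square_integrable M (?x m i w)" if "m \<in> K" "0 \<le> w" "w \<le> v" for m i w
    using that uv increment_component(1)[of m w v] by auto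
  have sqr: "square_integrable M (?x m i (r n))" if "m \<in> K" for m i n
    using r1[of n] uv by (intro sq that) auto
  have L2: "L2_tendsto M (\<lambda>n. ?x m i (r n)) (?x m i u)" if "m \<in> K" for m i
  proof -
    have "(\<integral>\<^sup>+\<omega>. ennreal ((norm (?x m i (r n) \<omega> - ?x m i u \<omega>))\<^sup>2) \<partial>M) = ennreal (r n - u)" for n
    proof -
      note c = increment_component[OF that uv(1) less_imp_le[OF r1(1)], of n i]
      have "(\<integral>\<^sup>+\<omega>. ennreal ((norm (?x m i (r n) \<omega> - ?x m i u \<omega>))\<^sup>2) \<partial>M)
        = (\<integral>\<^sup>+\<omega>. ennreal ((norm ((X m (r n) \<omega> - X m u \<omega>) $ i))\<^sup>2) \<partial>M)"
        by (intro nn_integral_cong arg_cong[where f="\<lambda>x. ennreal (x\<^sup>2)"]) (simp add: norm_minus_commute)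
      also have "\<dots> = ennreal (r n - u)"
        using nn_integral_square_integrable[OF c(1)] c(2) rT[of n] by simp
      finally show ?thesis .
    qed
    moreover have "(\<lambda>n. ennreal (r n - u)) \<longlonglongrightarrow> ennreal (u - u)"
      using r by (intro tendsto_ennrealI tendsto_intros)
    ultimately show ?thesis by (simp add: L2_tendsto_def)
  qed
  have ind: "square_integrable M (\<lambda>\<omega>. indicator A \<omega> :: real)"
    using Am by (intro square_integrable_bounded[where c=1]) (auto simp: indicator_def)
  have "(\<lambda>n. \<integral>\<omega>. indicator A \<omega> \<bullet> ?x k j (r n) \<omega> \<partial>M) \<longlonglongrightarrow> (\<integral>\<omega>. indicator A \<omega> \<bullet> ?x k j u \<omega> \<partial>M)"
    using sqr[OF k] sq[OF k uv(1) less_imp_le[OF uv(2)]] ind Am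
    by (intro L2_tendsto_inner L2[OF k]) (auto simp: square_integrable_def)
  moreover have "(\<integral>\<omega>. indicator A \<omega> \<bullet> ?x k j (r n) \<omega> \<partial>M) = 0" for n
    using completed_increment_moments(1)[OF k k _ r1(2) uv(3) An] rT[of n]
    by (simp add: set_lebesgue_integral_def)
  ultimately have "(\<integral>\<omega>. indicator A \<omega> \<bullet> ?x k j u \<omega> \<partial>M) = 0"
    by (simp add: LIMSEQ_const_iff)
  then show "(LINT \<omega>:A|M. (X k v \<omega> - X k u \<omega>) $ j) = 0" by (simp add: set_lebesgue_integral_def)
  have sqA: "square_integrable M (\<lambda>\<omega>. indicator A \<omega> *\<^sub>R ?x k j w \<omega>)" if "0 \<le> w" "w \<le> v" for w
    using that Am by (intro square_integrable_bounded_scaleR[where c=1] sq[OF k]) (auto simp: indicator_def)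
  have lim: "(\<lambda>n. \<integral>\<omega>. (indicator A \<omega> *\<^sub>R ?x k j (r n) \<omega>) \<bullet> ?x l j' (r n) \<omega> \<partial>M)
      \<longlonglongrightarrow> (\<integral>\<omega>. (indicator A \<omega> *\<^sub>R ?x k j u \<omega>) \<bullet> ?x l j' u \<omega> \<partial>M)"
  proof (rule L2_tendsto_inner)
    show "L2_tendsto M (\<lambda>n \<omega>. indicator A \<omega> *\<^sub>R ?x k j (r n) \<omega>) (\<lambda>\<omega>. indicator A \<omega> *\<^sub>R ?x k j u \<omega>)"
      by (rule L2_tendsto_bound[OF L2[OF k, of j]]) (auto simp: indicator_def)
    show "square_integrable M (\<lambda>\<omega>. indicator A \<omega> *\<^sub>R ?x k j (r n) \<omega>)" for n
      using rT[of n] r1[of n] by (intro sqA) auto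
    show "(\<lambda>\<omega>. indicator A \<omega> *\<^sub>R ?x k j u \<omega>) \<in> borel_measurable M"
      using sqA[of u] uv by (simp add: square_integrable_def)
    show "?x l j' u \<in> borel_measurable M"
      using sq[OF l, of u j'] uv by (simp add: square_integrable_def)
  qed (use L2[OF l] sqr[OF l] in auto)
  have eq: "(\<integral>\<omega>. (indicator A \<omega> *\<^sub>R ?x k j (r n) \<omega>) \<bullet> ?x l j' (r n) \<omega> \<partial>M)
      = prob A * (of_bool (k = l \<and> j = j') * (v - r n))" for n
    using completed_increment_moments(2)[OF k l _ r1(2) uv(3) An, of n j j'] rT[of n]
    by (simp add: set_lebesgue_integral_def mult.assoc)
  have "(\<lambda>n. prob A * (of_bool (k = l \<and> j = j') * (v - r n)))
      \<longlonglongrightarrow> prob A * (of_bool (k = l \<and> j = j') * (v - u))"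
    by (intro tendsto_intros r)
  from LIMSEQ_unique[OF lim[unfolded eq] this]
  have "(\<integral>\<omega>. (indicator A \<omega> *\<^sub>R ?x k j u \<omega>) \<bullet> ?x l j' u \<omega> \<partial>M)
      = prob A * (of_bool (k = l \<and> j = j') * (v - u))" .
  then show "(LINT \<omega>:A|M. (X k v \<omega> - X k u \<omega>) $ j * (X l v \<omega> - X l u \<omega>) $ j')
      = prob A * (of_bool (k = l \<and> j = j') * (v - u))"
    by (simp add: set_lebesgue_integral_def mult.assoc)
qed

lemma subalgebra_aug: "subalgebra M (\<F> u)"
  using aug_filtration_subset[OF measurable_paths_family] by (simp add: subalgebra_def)

text \<open>If the integral over each set of \<open>\<F> u\<close> is its probability times \<open>c\<close>, then \<open>c\<close> is the conditional
expectation, and an adapted weight can be taken out.\<close>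

lemma weighted_moment_const:
  assumes f: "integrable M f" and c: "\<And>A. A \<in> sets (\<F> u) \<Longrightarrow> (LINT \<omega>:A|M. f \<omega>) = prob A * c"
    and \<phi>: "\<phi> \<in> borel_measurable (\<F> u)" and I: "integrable M (\<lambda>\<omega>. \<phi> \<omega> * f \<omega>)"
  shows "expectation (\<lambda>\<omega>. \<phi> \<omega> * f \<omega>) = c * expectation \<phi>"
proof -
  interpret finite_measure_subalgebra M "\<F> u"
    by standard (rule subalgebra_aug)
  have [measurable]: "f \<in> borel_measurable M" using f by auto
  have [measurable]: "\<phi> \<in> borel_measurable M" using measurable_from_subalg[OF subalgebra_aug \<phi>] .
  have "AE \<omega> in M. real_cond_exp M (\<F> u) f \<omega> = c"
  proof (rule real_cond_exp_charact)
    fix A assume A: "A \<in> sets (\<F> u)"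
    then have "A \<in> sets M" using subalgebra_aug by (auto simp: subalgebra_def)
    then show "(LINT \<omega>:A|M. f \<omega>) = (LINT \<omega>:A|M. c)"
      using c[OF A] by (simp add: set_lebesgue_integral_def)
  qed (use f in auto)
  then have "AE \<omega> in M. \<phi> \<omega> * real_cond_exp M (\<F> u) f \<omega> = \<phi> \<omega> * c" by eventually_elim simp
  then have "expectation (\<lambda>\<omega>. \<phi> \<omega> * real_cond_exp M (\<F> u) f \<omega>) = expectation (\<lambda>\<omega>. \<phi> \<omega> * c)"
    by (intro integral_cong_AE) auto
  then show ?thesis using real_cond_exp_intg(2)[OF I \<phi>] by (simp add: mult.commute)
qed

lemma weighted_increment_moments:
  assumes k: "k \<in> K" and l: "l \<in> K" and uv: "0 \<le> u" "u \<le> v" "v \<le> T"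
    and \<phi>: "\<phi> \<in> borel_measurable (\<F> u)"
  shows "integrable M (\<lambda>\<omega>. \<phi> \<omega> * (X k v \<omega> - X k u \<omega>) $ j) \<Longrightarrow>
      expectation (\<lambda>\<omega>. \<phi> \<omega> * (X k v \<omega> - X k u \<omega>) $ j) = 0"
    and "integrable M (\<lambda>\<omega>. \<phi> \<omega> * ((X k v \<omega> - X k u \<omega>) $ j * (X l v \<omega> - X l u \<omega>) $ j')) \<Longrightarrow>
      expectation (\<lambda>\<omega>. \<phi> \<omega> * ((X k v \<omega> - X k u \<omega>) $ j * (X l v \<omega> - X l u \<omega>) $ j'))
      = of_bool (k = l \<and> j = j') * (v - u) * expectation \<phi>"
proof -
  note s = increment_component(1)[OF _ uv]
  show "expectation (\<lambda>\<omega>. \<phi> \<omega> * (X k v \<omega> - X k u \<omega>) $ j) = 0"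
    if I: "integrable M (\<lambda>\<omega>. \<phi> \<omega> * (X k v \<omega> - X k u \<omega>) $ j)"
  proof (cases "u = v")
    case False
    then have "u < v" using uv by simp
    note m = aug_increment_moments(1)[OF k k uv(1) this uv(3)]
    have one: "square_integrable M (\<lambda>\<omega>. 1 :: real)" by (rule square_integrable_bounded) auto
    have "integrable M (\<lambda>\<omega>. (X k v \<omega> - X k u \<omega>) $ j)"
      using square_integrable_inner(1)[OF one s[OF k, of j]] by simp
    from weighted_moment_const[OF this _ \<phi> I, of 0] m show ?thesis by simp
  qed simp
  show "expectation (\<lambda>\<omega>. \<phi> \<omega> * ((X k v \<omega> - X k u \<omega>) $ j * (X l v \<omega> - X l u \<omega>) $ j'))
      = of_bool (k = l \<and> j = j') * (v - u) * expectation \<phi>"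
    if I: "integrable M (\<lambda>\<omega>. \<phi> \<omega> * ((X k v \<omega> - X k u \<omega>) $ j * (X l v \<omega> - X l u \<omega>) $ j'))"
  proof (cases "u = v")
    case False
    then have "u < v" using uv by simp
    note m = aug_increment_moments(2)[OF k l uv(1) this uv(3)]
    have "integrable M (\<lambda>\<omega>. (X k v \<omega> - X k u \<omega>) $ j * (X l v \<omega> - X l u \<omega>) $ j')"
      using square_integrable_inner(1)[OF s[OF k, of j] s[OF l, of j']] by simp
    from weighted_moment_const[OF this m \<phi> I] show ?thesis .
  qed simp
qed

end

section \<open>Stochastic integrals of elementary processes\<close>

lemma norm_matrix_vector_mult_le:
  fixes A :: "real ^ 'd ^ 'm"
  shows "norm (A *v x) \<le> norm A * norm x"
proof -
  have "norm (A *v x) = L2_set (\<lambda>i. \<bar>A $ i \<bullet> x\<bar>) UNIV"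
    by (simp add: norm_vec_def matrix_vector_mul_component)
  also have "\<dots> \<le> L2_set (\<lambda>i. norm (A $ i) * norm x) UNIV"
    by (intro L2_set_mono Cauchy_Schwarz_ineq2) auto
  also have "\<dots> = norm A * norm x"
    by (simp add: norm_vec_def L2_set_left_distrib)
  finally show ?thesis .
qed

lemma borel_measurable_vecI:
  fixes f :: "'x \<Rightarrow> real ^ 'n"
  assumes "\<And>i. (\<lambda>\<omega>. f \<omega> $ i) \<in> borel_measurable N"
  shows "f \<in> borel_measurable N"
  unfolding borel_measurable_euclidean_space[of f]
proof
  fix b :: "real ^ 'n" assume "b \<in> Basis"
  then obtain i where "b = axis i 1" by (auto simp: Basis_vec_def)
  then show "(\<lambda>\<omega>. f \<omega> \<bullet> b) \<in> borel_measurable N"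
    using assms[of i] by (simp add: cart_eq_inner_axis)
qed

lemma borel_measurable_matrix_vector_mult:
  fixes A :: "'x \<Rightarrow> real ^ 'd ^ 'm"
  assumes "A \<in> borel_measurable N" "x \<in> borel_measurable N"
  shows "(\<lambda>\<omega>. A \<omega> *v x \<omega>) \<in> borel_measurable N"
proof (rule borel_measurable_vecI)
  fix i show "(\<lambda>\<omega>. (A \<omega> *v x \<omega>) $ i) \<in> borel_measurable N"
    unfolding matrix_vector_mul_component
    by (intro borel_measurable_inner borel_measurable_nth assms)
qed

context brownian_family
begin

definition bounded_at :: "real \<Rightarrow> ('w \<Rightarrow> real ^ 'd ^ 'm) \<Rightarrow> bool" where
  "bounded_at u \<eta> \<longleftrightarrow> \<eta> \<in> borel_measurable (\<F> u) \<and> (\<exists>c. \<forall>\<omega>\<in>space M. norm (\<eta> \<omega>) \<le> c)"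

lemma \<F>_mono: "s \<le> t \<Longrightarrow> sets (\<F> s) \<subseteq> sets (\<F> t)"
  by (rule aug_filtration_mono[OF measurable_paths_family order_refl])

lemma \<F>_measurable_mono: "f \<in> borel_measurable (\<F> s) \<Longrightarrow> s \<le> t \<Longrightarrow> f \<in> borel_measurable (\<F> t)"
  by (erule measurable_sub_algebra) (auto intro: \<F>_mono[THEN subsetD])

lemma \<F>_measurable: "f \<in> borel_measurable (\<F> s) \<Longrightarrow> f \<in> borel_measurable M"
  by (rule measurable_from_subalg[OF subalgebra_aug])

lemma X_adapted:
  "k \<in> K \<Longrightarrow> 0 \<le> s \<Longrightarrow> s \<le> t \<Longrightarrow> s \<le> T \<Longrightarrow> X k s \<in> borel_measurable (\<F> t)"
  by (rule aug_filtration_measurable[OF measurable_paths_family]) auto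

lemma bounded_at_mono: "bounded_at s \<eta> \<Longrightarrow> s \<le> t \<Longrightarrow> bounded_at t \<eta>"
  unfolding bounded_at_def using \<F>_measurable_mono by blast

lemma bounded_at_measurable: "bounded_at s \<eta> \<Longrightarrow> \<eta> \<in> borel_measurable M"
  unfolding bounded_at_def using \<F>_measurable by blast

lemma bounded_at_entry:
  assumes "bounded_at u \<eta>"
  obtains c where "\<And>\<omega> i j. \<omega> \<in> space M \<Longrightarrow> \<bar>\<eta> \<omega> $ i $ j\<bar> \<le> c"
proof -
  obtain c where c: "\<And>\<omega>. \<omega> \<in> space M \<Longrightarrow> norm (\<eta> \<omega>) \<le> c"
    using assms by (auto simp: bounded_at_def)
  have "\<bar>\<eta> \<omega> $ i $ j\<bar> \<le> c" if "\<omega> \<in> space M" for \<omega> i j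
    using component_le_norm_cart[of "\<eta> \<omega> $ i" j] Finite_Cartesian_Product.norm_nth_le[of "\<eta> \<omega>" i] c[OF that]
    by linarith
  then show ?thesis by (rule that)
qed

lemma bounded_mult_square_integrable:
  assumes \<eta>: "bounded_at u \<eta>" and x: "square_integrable M x"
  shows "square_integrable M (\<lambda>\<omega>. \<eta> \<omega> *v x \<omega>)"
proof -
  obtain c where c: "\<And>\<omega>. \<omega> \<in> space M \<Longrightarrow> norm (\<eta> \<omega>) \<le> c"
    using \<eta> by (auto simp: bounded_at_def)
  have [measurable]: "\<eta> \<in> borel_measurable M" by (rule bounded_at_measurable[OF \<eta>])
  have [measurable]: "x \<in> borel_measurable M" using x by (simp add: square_integrable_def)
  have "square_integrable M (\<lambda>\<omega>. norm (\<eta> \<omega>) *\<^sub>R x \<omega>)"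
    by (rule square_integrable_bounded_scaleR[OF x]) (use c in auto)
  then show ?thesis
    by (rule square_integrable_bound)
      (auto intro: borel_measurable_matrix_vector_mult norm_matrix_vector_mult_le)
qed

abbreviation "\<Delta> k u v \<omega> \<equiv> X k v \<omega> - X k u \<omega>"

text \<open>The increment has mean zero given \<open>\<F> u\<close>; the inner product is expanded into coordinates.\<close>

lemma increment_orthogonal:
  fixes H :: "'w \<Rightarrow> real ^ 'm"
  assumes k: "k \<in> K" and uv: "0 \<le> u" "u \<le> v" "v \<le> T"
    and H: "H \<in> borel_measurable (\<F> u)" "square_integrable M H" and \<eta>: "bounded_at u \<eta>"
  shows "expectation (\<lambda>\<omega>. H \<omega> \<bullet> (\<eta> \<omega> *v \<Delta> k u v \<omega>)) = 0"
proof -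
  obtain c where c: "\<And>\<omega> i j. \<omega> \<in> space M \<Longrightarrow> \<bar>\<eta> \<omega> $ i $ j\<bar> \<le> c"
    using bounded_at_entry[OF \<eta>] by blast
  have \<eta>F: "\<eta> \<in> borel_measurable (\<F> u)" using \<eta> by (simp add: bounded_at_def)
  have "square_integrable M (\<lambda>\<omega>. \<eta> \<omega> $ i $ j *\<^sub>R (H \<omega> $ i))" for i j
    by (rule square_integrable_bounded_scaleR[OF square_integrable_component[OF H(2)] _ c])
      (auto intro!: borel_measurable_nth \<F>_measurable[OF \<eta>F])
  from square_integrable_inner(1)[OF this increment_component(1)[OF k uv]]
  have I: "integrable M (\<lambda>\<omega>. (\<eta> \<omega> $ i $ j * H \<omega> $ i) * \<Delta> k u v \<omega> $ j)" for i j
    by simp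
  have E: "expectation (\<lambda>\<omega>. (\<eta> \<omega> $ i $ j * H \<omega> $ i) * \<Delta> k u v \<omega> $ j) = 0" for i j
    by (rule weighted_increment_moments(1)[OF k k uv _ I])
      (intro borel_measurable_times borel_measurable_nth \<eta>F H)
  have "expectation (\<lambda>\<omega>. H \<omega> \<bullet> (\<eta> \<omega> *v \<Delta> k u v \<omega>))
      = expectation (\<lambda>\<omega>. \<Sum>i\<in>UNIV. \<Sum>j\<in>UNIV. (\<eta> \<omega> $ i $ j * H \<omega> $ i) * \<Delta> k u v \<omega> $ j)"
    by (intro Bochner_Integration.integral_cong refl)
      (simp add: inner_vec_def matrix_vector_mult_def sum_distrib_left mult_ac)
  also have "\<dots> = (\<Sum>i\<in>UNIV. \<Sum>j\<in>UNIV. expectation (\<lambda>\<omega>. (\<eta> \<omega> $ i $ j * H \<omega> $ i) * \<Delta> k u v \<omega> $ j))"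
    using I by (simp del: vector_minus_component)
  also have "\<dots> = 0" by (simp only: E sum.neutral_const)
  finally show ?thesis .
qed

text \<open>In coordinates \<open>\<Sum> \<eta>\<^sub>i\<^sub>j \<eta>'\<^sub>i\<^sub>j\<^sub>' \<Delta>\<^sub>j \<Delta>'\<^sub>j\<^sub>'\<close> only the diagonal \<open>j = j'\<close> survives, and what remains is the Frobenius inner
product of the coefficients.\<close>

lemma increment_covariance:
  fixes \<eta> \<eta>' :: "'w \<Rightarrow> real ^ 'd ^ 'm"
  assumes k: "k \<in> K" and l: "l \<in> K" and uv: "0 \<le> u" "u \<le> v" "v \<le> T"
    and \<eta>: "bounded_at u \<eta>" and \<eta>': "bounded_at u \<eta>'"
  shows "expectation (\<lambda>\<omega>. (\<eta> \<omega> *v \<Delta> k u v \<omega>) \<bullet> (\<eta>' \<omega> *v \<Delta> l u v \<omega>))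
    = of_bool (k = l) * (v - u) * expectation (\<lambda>\<omega>. \<eta> \<omega> \<bullet> \<eta>' \<omega>)"
proof -
  obtain c where c: "\<And>\<omega> i j. \<omega> \<in> space M \<Longrightarrow> \<bar>\<eta> \<omega> $ i $ j\<bar> \<le> c"
    using bounded_at_entry[OF \<eta>] by blast
  obtain c' where c': "\<And>\<omega> i j. \<omega> \<in> space M \<Longrightarrow> \<bar>\<eta>' \<omega> $ i $ j\<bar> \<le> c'"
    using bounded_at_entry[OF \<eta>'] by blast
  have F: "\<eta> \<in> borel_measurable (\<F> u)" "\<eta>' \<in> borel_measurable (\<F> u)"
    using \<eta> \<eta>' by (simp_all add: bounded_at_def)
  have sq1: "square_integrable M (\<lambda>\<omega>. \<eta> \<omega> $ i $ j *\<^sub>R (\<Delta> k u v \<omega> $ j))" for i j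
    by (rule square_integrable_bounded_scaleR[OF increment_component(1)[OF k uv] _ c])
      (intro borel_measurable_nth \<F>_measurable[OF F(1)])
  have sq2: "square_integrable M (\<lambda>\<omega>. \<eta>' \<omega> $ i $ j *\<^sub>R (\<Delta> l u v \<omega> $ j))" for i j
    by (rule square_integrable_bounded_scaleR[OF increment_component(1)[OF l uv] _ c'])
      (intro borel_measurable_nth \<F>_measurable[OF F(2)])
  have I: "integrable M (\<lambda>\<omega>. (\<eta> \<omega> $ i $ j * \<eta>' \<omega> $ i $ j') * (\<Delta> k u v \<omega> $ j * \<Delta> l u v \<omega> $ j'))" for i j j'
    using square_integrable_inner(1)[OF sq1[of i j] sq2[of i j']] by (simp add: mult_ac)
  note E = weighted_increment_moments(2)[OF k l uv _ I]
  have E: "expectation (\<lambda>\<omega>. (\<eta> \<omega> $ i $ j * \<eta>' \<omega> $ i $ j') * (\<Delta> k u v \<omega> $ j * \<Delta> l u v \<omega> $ j'))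
      = of_bool (k = l \<and> j = j') * (v - u) * expectation (\<lambda>\<omega>. \<eta> \<omega> $ i $ j * \<eta>' \<omega> $ i $ j')" for i j j'
    by (rule E) (intro borel_measurable_times borel_measurable_nth F)
  have I': "integrable M (\<lambda>\<omega>. \<eta> \<omega> $ i $ j * \<eta>' \<omega> $ i $ j)" for i j
  proof -
    have "square_integrable M (\<lambda>\<omega>. \<eta> \<omega> $ i $ j)"
      by (rule square_integrable_bounded[where c=c]) (auto intro!: borel_measurable_nth \<F>_measurable[OF F(1)] c)
    moreover have "square_integrable M (\<lambda>\<omega>. \<eta>' \<omega> $ i $ j)"
      by (rule square_integrable_bounded[where c=c']) (auto intro!: borel_measurable_nth \<F>_measurable[OF F(2)] c')
    ultimately show ?thesis using square_integrable_inner(1) by fastforce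
  qed
  have "expectation (\<lambda>\<omega>. (\<eta> \<omega> *v \<Delta> k u v \<omega>) \<bullet> (\<eta>' \<omega> *v \<Delta> l u v \<omega>))
      = expectation (\<lambda>\<omega>. \<Sum>i\<in>UNIV. \<Sum>j\<in>UNIV. \<Sum>j'\<in>UNIV.
          (\<eta> \<omega> $ i $ j * \<eta>' \<omega> $ i $ j') * (\<Delta> k u v \<omega> $ j * \<Delta> l u v \<omega> $ j'))"
    by (intro Bochner_Integration.integral_cong refl)
      (simp add: inner_vec_def matrix_vector_mult_def sum_product mult_ac)
  also have "\<dots> = (\<Sum>i\<in>UNIV. \<Sum>j\<in>UNIV. \<Sum>j'\<in>UNIV.
      expectation (\<lambda>\<omega>. (\<eta> \<omega> $ i $ j * \<eta>' \<omega> $ i $ j') * (\<Delta> k u v \<omega> $ j * \<Delta> l u v \<omega> $ j')))"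
    using I by (simp del: vector_minus_component)
  also have "\<dots> = (\<Sum>i\<in>UNIV. \<Sum>j\<in>UNIV. of_bool (k = l) * (v - u) * expectation (\<lambda>\<omega>. \<eta> \<omega> $ i $ j * \<eta>' \<omega> $ i $ j))"
    unfolding E
    by (intro sum.cong refl) (simp add: of_bool_conj if_distrib[of "\<lambda>x. _ * x"] if_distrib[of "\<lambda>x. x * _"]
        sum.delta' of_bool_def cong: if_cong)
  also have "\<dots> = of_bool (k = l) * (v - u) * (\<Sum>i\<in>UNIV. \<Sum>j\<in>UNIV. expectation (\<lambda>\<omega>. \<eta> \<omega> $ i $ j * \<eta>' \<omega> $ i $ j))"
    by (simp add: sum_distrib_left)
  also have "(\<Sum>i\<in>UNIV. \<Sum>j\<in>UNIV. expectation (\<lambda>\<omega>. \<eta> \<omega> $ i $ j * \<eta>' \<omega> $ i $ j))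
      = expectation (\<lambda>\<omega>. \<eta> \<omega> \<bullet> \<eta>' \<omega>)"
    using I' by (simp add: inner_vec_def)
  finally show ?thesis .
qed

text \<open>When the intervals overlap, they are cut at the later left end \<open>a'\<close> and at the earlier right end \<open>m\<close>. Only
the pair on the common part \<open>(a', m]\<close> contributes; every other pair consists of an increment and a later one.\<close>

lemma increment_pair_aux:
  fixes \<eta> \<eta>' :: "'w \<Rightarrow> real ^ 'd ^ 'm"
  assumes k: "k \<in> K" and l: "l \<in> K" and ab: "0 \<le> a" "a \<le> b" "b \<le> T" and ab': "0 \<le> a'" "a' \<le> b'" "b' \<le> T"
    and aa: "a \<le> a'" and \<eta>: "bounded_at a \<eta>" and \<eta>': "bounded_at a' \<eta>'"
  shows "expectation (\<lambda>\<omega>. (\<eta> \<omega> *v \<Delta> k a b \<omega>) \<bullet> (\<eta>' \<omega> *v \<Delta> l a' b' \<omega>))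
    = of_bool (k = l) * max 0 (min b b' - max a a') * expectation (\<lambda>\<omega>. \<eta> \<omega> \<bullet> \<eta>' \<omega>)"
proof -
  have sq: "square_integrable M (\<lambda>\<omega>. \<zeta> \<omega> *v \<Delta> m r s \<omega>)"
    if "m \<in> K" "0 \<le> r" "r \<le> s" "s \<le> T" "bounded_at w \<zeta>" for m r s w and \<zeta> :: "'w \<Rightarrow> real ^ 'd ^ 'm"
    using that by (intro bounded_mult_square_integrable increment_square_integrable)
  have meas: "(\<lambda>\<omega>. \<zeta> \<omega> *v \<Delta> m r s \<omega>) \<in> borel_measurable (\<F> s)"
    if "m \<in> K" "0 \<le> r" "r \<le> s" "s \<le> T" "bounded_at r \<zeta>" for m r s and \<zeta> :: "'w \<Rightarrow> real ^ 'd ^ 'm"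
    using that bounded_at_mono[OF that(5,3)]
    by (intro borel_measurable_matrix_vector_mult borel_measurable_diff X_adapted) (auto simp: bounded_at_def)
  have orth: "expectation (\<lambda>\<omega>. (\<zeta> \<omega> *v \<Delta> m r s \<omega>) \<bullet> (\<zeta>' \<omega> *v \<Delta> m' s v \<omega>)) = 0"
    if "m \<in> K" "m' \<in> K" "0 \<le> r" "r \<le> s" "s \<le> v" "v \<le> T" "bounded_at r \<zeta>" "bounded_at s \<zeta>'"
    for m m' r s v and \<zeta> \<zeta>' :: "'w \<Rightarrow> real ^ 'd ^ 'm"
    by (rule increment_orthogonal) (use that in \<open>auto intro!: meas sq\<close>)
  show ?thesis
  proof (cases "b \<le> a'")
    case True
    have "expectation (\<lambda>\<omega>. (\<eta> \<omega> *v \<Delta> k a b \<omega>) \<bullet> (\<eta>' \<omega> *v \<Delta> l a' b' \<omega>)) = 0"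
      using ab ab' True k l \<eta> \<eta>'
      by (intro increment_orthogonal \<F>_measurable_mono[OF meas True] sq) auto
    then show ?thesis using True ab ab' by simp
  next
    case False
    define m where "m = min b b'"
    have m: "a' \<le> m" "m \<le> b" "m \<le> b'" "m \<le> T" using False ab ab' by (auto simp: m_def)
    have mcase: "m = b \<or> m = b'" by (auto simp: m_def min_def)
    let ?u1 = "\<lambda>\<omega>. \<eta> \<omega> *v \<Delta> k a a' \<omega>" and ?u2 = "\<lambda>\<omega>. \<eta> \<omega> *v \<Delta> k a' m \<omega>" and ?u3 = "\<lambda>\<omega>. \<eta> \<omega> *v \<Delta> k m b \<omega>"
    let ?w = "\<lambda>\<omega>. \<eta>' \<omega> *v \<Delta> l a' b' \<omega>"
    let ?w1 = "\<lambda>\<omega>. \<eta>' \<omega> *v \<Delta> l a' m \<omega>" and ?w2 = "\<lambda>\<omega>. \<eta>' \<omega> *v \<Delta> l m b' \<omega>"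
    have "0 \<le> m" using m ab' by auto
    have \<eta>a': "bounded_at a' \<eta>" by (rule bounded_at_mono[OF \<eta> aa])
    have \<eta>m: "bounded_at m \<eta>" using bounded_at_mono[OF \<eta>a' m(1)] .
    have \<eta>'m: "bounded_at m \<eta>'" using bounded_at_mono[OF \<eta>' m(1)] .
    have s: "square_integrable M ?u1" "square_integrable M ?u2" "square_integrable M ?u3"
      "square_integrable M ?w" "square_integrable M ?w1" "square_integrable M ?w2"
      using k l ab ab' aa m \<open>0 \<le> m\<close> by (intro sq[OF _ _ _ _ \<eta>] sq[OF _ _ _ _ \<eta>']; simp)+
    note J = square_integrable_inner(1)
    have e11: "expectation (\<lambda>\<omega>. ?u1 \<omega> \<bullet> ?w \<omega>) = 0"
      using k l ab ab' aa \<eta> \<eta>' by (intro orth) auto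
    have e22: "expectation (\<lambda>\<omega>. ?u2 \<omega> \<bullet> ?w1 \<omega>) = of_bool (k = l) * (m - a') * expectation (\<lambda>\<omega>. \<eta> \<omega> \<bullet> \<eta>' \<omega>)"
      using k l ab' m \<eta>a' \<eta>' by (intro increment_covariance) auto
    have e23: "expectation (\<lambda>\<omega>. ?u2 \<omega> \<bullet> ?w2 \<omega>) = 0"
      using k l ab' m \<eta>a' \<eta>'m by (intro orth) auto
    have e32: "expectation (\<lambda>\<omega>. ?u3 \<omega> \<bullet> ?w1 \<omega>) = 0"
      using orth[of l k a' m b \<eta>' \<eta>] k l ab ab' m \<eta>m \<eta>' by (simp add: inner_commute)
    \<comment> \<open>One of the two remaining intervals is empty, since \<open>m\<close> is a right end of the first or of the second interval.\<close>
    have e33: "expectation (\<lambda>\<omega>. ?u3 \<omega> \<bullet> ?w2 \<omega>) = 0" using mcase by auto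
    have "expectation (\<lambda>\<omega>. (\<eta> \<omega> *v \<Delta> k a b \<omega>) \<bullet> ?w \<omega>)
      = expectation (\<lambda>\<omega>. ?u1 \<omega> \<bullet> ?w \<omega> + ?u2 \<omega> \<bullet> ?w1 \<omega> + ?u2 \<omega> \<bullet> ?w2 \<omega> + ?u3 \<omega> \<bullet> ?w1 \<omega> + ?u3 \<omega> \<bullet> ?w2 \<omega>)"
    proof (intro Bochner_Integration.integral_cong refl)
      fix \<omega>
      have u: "\<eta> \<omega> *v \<Delta> k a b \<omega> = ?u1 \<omega> + ?u2 \<omega> + ?u3 \<omega>"
        by (simp flip: matrix_vector_right_distrib)
      have w: "?w \<omega> = ?w1 \<omega> + ?w2 \<omega>" by (simp flip: matrix_vector_right_distrib)
      show "(\<eta> \<omega> *v \<Delta> k a b \<omega>) \<bullet> ?w \<omega> = ?u1 \<omega> \<bullet> ?w \<omega> + ?u2 \<omega> \<bullet> ?w1 \<omega> + ?u2 \<omega> \<bullet> ?w2 \<omega> + ?u3 \<omega> \<bullet> ?w1 \<omega> + ?u3 \<omega> \<bullet> ?w2 \<omega>"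
        unfolding u w by (simp only: inner_add_left inner_add_right add.assoc)
    qed
    also have "\<dots> = expectation (\<lambda>\<omega>. ?u1 \<omega> \<bullet> ?w \<omega>) + expectation (\<lambda>\<omega>. ?u2 \<omega> \<bullet> ?w1 \<omega>)
        + expectation (\<lambda>\<omega>. ?u2 \<omega> \<bullet> ?w2 \<omega>) + expectation (\<lambda>\<omega>. ?u3 \<omega> \<bullet> ?w1 \<omega>) + expectation (\<lambda>\<omega>. ?u3 \<omega> \<bullet> ?w2 \<omega>)"
      using J[OF s(1,4)] J[OF s(2,5)] J[OF s(2,6)] J[OF s(3,5)] J[OF s(3,6)]
      by (simp only: Bochner_Integration.integral_add Bochner_Integration.integrable_add)
    also have "\<dots> = of_bool (k = l) * (m - a') * expectation (\<lambda>\<omega>. \<eta> \<omega> \<bullet> \<eta>' \<omega>)"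
      unfolding e11 e22 e23 e32 e33 by simp
    finally show ?thesis using m aa by (simp add: m_def max_def)
  qed
qed

text \<open>Clamping the end points of an interval may collapse it to a point before its coefficient is known;
this is why adaptedness is asked for nonempty intervals only.\<close>

lemma increment_pair:
  fixes \<eta> \<eta>' :: "'w \<Rightarrow> real ^ 'd ^ 'm"
  assumes k: "k \<in> K" and l: "l \<in> K" and ab: "0 \<le> a" "a \<le> b" "b \<le> T" and ab': "0 \<le> a'" "a' \<le> b'" "b' \<le> T"
    and \<eta>: "a < b \<Longrightarrow> bounded_at a \<eta>" and \<eta>': "a' < b' \<Longrightarrow> bounded_at a' \<eta>'"
  shows "expectation (\<lambda>\<omega>. (\<eta> \<omega> *v \<Delta> k a b \<omega>) \<bullet> (\<eta>' \<omega> *v \<Delta> l a' b' \<omega>))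
    = of_bool (k = l) * max 0 (min b b' - max a a') * expectation (\<lambda>\<omega>. \<eta> \<omega> \<bullet> \<eta>' \<omega>)"
proof (cases "a = b \<or> a' = b'")
  case True
  then have "max 0 (min b b' - max a a') = 0" using ab ab' by auto
  then show ?thesis using True by auto
next
  case False
  then have B: "bounded_at a \<eta>" "bounded_at a' \<eta>'" using ab ab' \<eta> \<eta>' by auto
  show ?thesis
  proof (cases "a \<le> a'")
    case True
    then show ?thesis by (intro increment_pair_aux k l ab ab' B)
  next
    case False
    then have "a' \<le> a" by simp
    from increment_pair_aux[OF l k ab' ab this B(2,1)]
    show ?thesis by (simp add: inner_commute min.commute max.commute eq_commute)
  qed
qed

end

definition time_measure :: "real \<Rightarrow> real measure" where
  "time_measure T = restrict_space lborel {0..T}"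

lemma space_time_measure[simp]: "space (time_measure T) = {0..T}"
  by (simp add: time_measure_def)

lemma sets_time_measure: "sets (time_measure T) = sets (restrict_space borel {0..T})"
  by (simp add: time_measure_def sets_restrict_space)

lemma finite_measure_time_measure: "finite_measure (time_measure T)"
  by (rule finite_measureI) (simp add: time_measure_def emeasure_restrict_space emeasure_lborel_Icc_eq)

lemma nn_integral_time_measure:
  "(\<integral>\<^sup>+u. g u \<partial>time_measure T) = (\<integral>\<^sup>+u\<in>{0..T}. g u \<partial>lborel)"
  unfolding time_measure_def by (rule nn_integral_restrict_space) simp

lemma measurable_time_measure: "f \<in> borel \<rightarrow>\<^sub>M N \<Longrightarrow> f \<in> time_measure T \<rightarrow>\<^sub>M N"
  unfolding time_measure_def by (rule measurable_restrict_space1) simp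

text \<open>The measurability in time and randomness that Fubini's theorem requires, with respect to the whole
sigma-algebra instead of the filtration.\<close>

definition jointly_measurable :: "'w measure \<Rightarrow> real \<Rightarrow> (real \<Rightarrow> 'w \<Rightarrow> 'v::topological_space) \<Rightarrow> bool" where
  "jointly_measurable M T Z \<longleftrightarrow> (\<lambda>(u, \<omega>). Z u \<omega>) \<in> borel_measurable (time_measure T \<Otimes>\<^sub>M M)"

text \<open>A process restricted to a time interval and regarded as an element of \<open>L\<^sup>2\<close> over time and randomness.\<close>

definition on_interval :: "real \<Rightarrow> real \<Rightarrow> (real \<Rightarrow> 'w \<Rightarrow> 'v::real_vector) \<Rightarrow> real \<times> 'w \<Rightarrow> 'v" where
  "on_interval s t Z = (\<lambda>(u, \<omega>). indicator {s..t} u *\<^sub>R Z u \<omega>)"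

lemma on_interval_measurable:
  fixes Z :: "real \<Rightarrow> 'w \<Rightarrow> 'v::euclidean_space"
  assumes "jointly_measurable M T Z"
  shows "on_interval s t Z \<in> borel_measurable (time_measure T \<Otimes>\<^sub>M M)"
proof -
  have [measurable]: "(\<lambda>(u, \<omega>). Z u \<omega>) \<in> borel_measurable (time_measure T \<Otimes>\<^sub>M M)"
    using assms by (simp add: jointly_measurable_def)
  have [measurable]: "(indicator {s..t} :: real \<Rightarrow> real) \<in> borel_measurable (time_measure T)"
    by (rule measurable_time_measure) simp
  have "(\<lambda>x. indicator {s..t} (fst x) *\<^sub>R (case x of (u, \<omega>) \<Rightarrow> Z u \<omega>)) \<in> borel_measurable (time_measure T \<Otimes>\<^sub>M M)"
    by measurable
  then show ?thesis by (simp add: on_interval_def case_prod_beta)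
qed

lemma norm_on_interval_diff_le: "norm (on_interval s t Z x - on_interval s t Z' x) \<le> norm (Z (fst x) (snd x) - Z' (fst x) (snd x))"
  for Z :: "real \<Rightarrow> 'w \<Rightarrow> 'v::euclidean_space"
  by (cases x) (simp add: on_interval_def indicator_def)

lemma (in prob_space) sigma_finite_M: "sigma_finite_measure M"
  by unfold_locales

lemma (in prob_space) pair_sigma_finite_time: "pair_sigma_finite (time_measure T) M"
proof -
  interpret finite_measure "time_measure T" by (rule finite_measure_time_measure)
  show ?thesis by standard
qed

lemma (in prob_space) finite_measure_time_pair: "finite_measure (time_measure T \<Otimes>\<^sub>M M)"
proof -
  interpret pair_sigma_finite "time_measure T" M by (rule pair_sigma_finite_time)
  interpret f: finite_measure "time_measure T" by (rule finite_measure_time_measure)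
  have "emeasure (time_measure T \<Otimes>\<^sub>M M) (space (time_measure T \<Otimes>\<^sub>M M))
      = emeasure (time_measure T) (space (time_measure T)) * emeasure M (space M)"
    unfolding space_pair_measure
    by (rule sigma_finite_measure.emeasure_pair_measure_Times[OF sigma_finite_M]) (rule sets.top)+
  also have "\<dots> \<noteq> \<infinity>" using f.emeasure_finite[of "space (time_measure T)"] by (simp add: emeasure_space_1)
  finally show ?thesis by (rule finite_measureI)
qed

lemma (in prob_space) nn_integral_time_pair:
  assumes "f \<in> borel_measurable (time_measure T \<Otimes>\<^sub>M M)"
  shows "(\<integral>\<^sup>+x. f x \<partial>(time_measure T \<Otimes>\<^sub>M M)) = (\<integral>\<^sup>+\<omega>. (\<integral>\<^sup>+u\<in>{0..T}. f (u, \<omega>) \<partial>lborel) \<partial>M)"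
    and "(\<integral>\<^sup>+x. f x \<partial>(time_measure T \<Otimes>\<^sub>M M)) = (\<integral>\<^sup>+u\<in>{0..T}. (\<integral>\<^sup>+\<omega>. f (u, \<omega>) \<partial>M) \<partial>lborel)"
proof -
  interpret pair_sigma_finite "time_measure T" M by (rule pair_sigma_finite_time)
  show "(\<integral>\<^sup>+x. f x \<partial>(time_measure T \<Otimes>\<^sub>M M)) = (\<integral>\<^sup>+\<omega>. (\<integral>\<^sup>+u\<in>{0..T}. f (u, \<omega>) \<partial>lborel) \<partial>M)"
    using nn_integral_snd[of f] assms by (simp add: nn_integral_time_measure)
  show "(\<integral>\<^sup>+x. f x \<partial>(time_measure T \<Otimes>\<^sub>M M)) = (\<integral>\<^sup>+u\<in>{0..T}. (\<integral>\<^sup>+\<omega>. f (u, \<omega>) \<partial>M) \<partial>lborel)"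
    using sigma_finite_measure.nn_integral_fst[OF sigma_finite_M assms] by (simp add: nn_integral_time_measure)
qed

lemma (in prob_space) integral_time_product:
  fixes \<phi> :: "real \<Rightarrow> real" and \<psi> :: "'a \<Rightarrow> real"
  assumes \<phi>[measurable]: "\<phi> \<in> borel_measurable borel" and b: "\<And>u. \<bar>\<phi> u\<bar> \<le> c" and \<psi>: "integrable M \<psi>"
  shows "integrable (time_measure T \<Otimes>\<^sub>M M) (\<lambda>(u, \<omega>). \<phi> u * \<psi> \<omega>)"
    and "(\<integral>(u, \<omega>). \<phi> u * \<psi> \<omega> \<partial>(time_measure T \<Otimes>\<^sub>M M)) = (\<integral>u. \<phi> u \<partial>time_measure T) * expectation \<psi>"
proof -
  interpret pair_sigma_finite "time_measure T" M by (rule pair_sigma_finite_time)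
  interpret f: finite_measure "time_measure T" by (rule finite_measure_time_measure)
  have [measurable]: "\<phi> \<in> borel_measurable (time_measure T)" by (rule measurable_time_measure) simp
  have [measurable]: "\<psi> \<in> borel_measurable M" using \<psi> by auto
  show I: "integrable (time_measure T \<Otimes>\<^sub>M M) (\<lambda>(u, \<omega>). \<phi> u * \<psi> \<omega>)"
  proof (rule Fubini_integrable)
    have "integrable (time_measure T) (\<lambda>u. \<bar>\<phi> u\<bar> * expectation (\<lambda>\<omega>. \<bar>\<psi> \<omega>\<bar>))"
      by (intro integrable_mult_left f.integrable_const_bound[where B=c]) (auto intro: b)
    then show "integrable (time_measure T) (\<lambda>x. \<integral>y. norm (case (x, y) of (u, \<omega>) \<Rightarrow> \<phi> u * \<psi> \<omega>) \<partial>M)"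
      by (simp add: abs_mult)
  qed (use \<psi> in auto)
  have "(\<integral>(u, \<omega>). \<phi> u * \<psi> \<omega> \<partial>(time_measure T \<Otimes>\<^sub>M M)) = (\<integral>u. (\<integral>\<omega>. \<phi> u * \<psi> \<omega> \<partial>M) \<partial>time_measure T)"
    using integral_fst[OF I] by simp
  then show "(\<integral>(u, \<omega>). \<phi> u * \<psi> \<omega> \<partial>(time_measure T \<Otimes>\<^sub>M M)) = (\<integral>u. \<phi> u \<partial>time_measure T) * expectation \<psi>"
    by simp
qed

text \<open>Clamping the end points of \<open>(a, b]\<close> to \<open>[s, t]\<close> amounts to intersecting with \<open>[s, t]\<close>, up to the points \<open>s\<close>, \<open>a\<close>
and \<open>t\<close>.\<close>

lemma clamp_interval_measure:
  fixes s t a b :: real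
  assumes "0 \<le> s" "s \<le> t" "t \<le> T"
  shows "(\<integral>u. indicator {s..t} u * indicator {a<..b} u \<partial>time_measure T)
    = max 0 (max s (min t b) - max s (min t a))"
proof -
  have "((\<integral>u. indicator {s..t} u * indicator {a<..b} u \<partial>time_measure T) :: real)
      = (\<integral>u. indicator {0..T} u * (indicator {s..t} u * indicator {a<..b} u) \<partial>lborel)"
    unfolding time_measure_def by (subst Bochner_Integration.integral_restrict_space) auto
  also have "\<dots> = (\<integral>u. indicator {max s (min t a)..max s (min t b)} u \<partial>(lborel :: real measure))"
  proof (rule integral_cong_AE)
    have "AE u in (lborel :: real measure). u \<noteq> s \<and> u \<noteq> a \<and> u \<noteq> t"
      by (intro AE_conjI AE_lborel_singleton)
    then show "AE u in lborel. indicator {0..T} u * (indicator {s..t} u * indicator {a<..b} u)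
      = (indicator {max s (min t a)..max s (min t b)} u :: real)"
    proof eventually_elim
      case (elim u)
      then show ?case using assms by (auto simp: indicator_def max_def min_def split: if_splits)
    qed
  qed auto
  also have "\<dots> = max 0 (max s (min t b) - max s (min t a))"
    by (simp add: max_def)
  finally show ?thesis .
qed

lemma clamp_overlap:
  fixes s t :: real
  assumes "s \<le> t"
  shows "max 0 (max s (min t (min b b')) - max s (min t (max a a')))
    = max 0 (min (max s (min t b)) (max s (min t b')) - max (max s (min t a)) (max s (min t a')))"
proof -
  have "min (max s (min t b)) (max s (min t b')) = max s (min t (min b b'))"
    by (simp add: min_max_distrib1 min_max_distrib2 max_def min_def)
  moreover have "max (max s (min t a)) (max s (min t a')) = max s (min t (max a a'))"
    by (simp add: max_def min_def)
  ultimately show ?thesis by (simp only:)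
qed

lemma elem_integral_diff:
  assumes "s \<le> t"
  shows "elem_integral B N \<tau> \<eta> t \<omega> - elem_integral B N \<tau> \<eta> s \<omega>
    = (\<Sum>j<N. \<eta> j \<omega> *v (B (max s (min t (\<tau> (Suc j)))) \<omega> - B (max s (min t (\<tau> j))) \<omega>))"
proof -
  have c: "B (max s (min t r)) \<omega> = B (min t r) \<omega> - B (min s r) \<omega> + B s \<omega>" for r
    using assms by (cases "r \<le> s") (auto simp: max_def min_def)
  show ?thesis
    unfolding elem_integral_def sum_subtractf[symmetric] matrix_vector_mult_diff_distrib[symmetric] c
    by (simp add: algebra_simps)
qed

context brownian_family
begin

lemma elementary_bounded_at:
  "elementary T \<F> N \<tau> \<eta> \<Longrightarrow> j < N \<Longrightarrow> bounded_at (\<tau> j) (\<eta> j)"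
  by (auto simp: elementary_def bounded_at_def)

lemma elementary_mono_time:
  "elementary T \<F> N \<tau> \<eta> \<Longrightarrow> j < N \<Longrightarrow> 0 \<le> \<tau> j \<and> \<tau> j \<le> \<tau> (Suc j) \<and> \<tau> (Suc j) \<le> T"
  by (auto simp: elementary_def)

lemma elementary_clamp:
  assumes "elementary T \<F> N \<tau> \<eta>" "j < N" "0 \<le> s" "s \<le> t" "t \<le> T"
  defines "a \<equiv> max s (min t (\<tau> j))" and "b \<equiv> max s (min t (\<tau> (Suc j)))"
  shows "0 \<le> a" "a \<le> b" "b \<le> T" "a < b \<Longrightarrow> bounded_at a (\<eta> j)"
proof -
  note \<tau> = elementary_mono_time[OF assms(1,2)]
  show "0 \<le> a" "a \<le> b" "b \<le> T" using \<tau> assms(3-5) by (auto simp: a_def b_def)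
  assume "a < b"
  then have "\<tau> j \<le> a" using \<tau> assms(4) by (auto simp: a_def b_def)
  then show "bounded_at a (\<eta> j)" using bounded_at_mono elementary_bounded_at[OF assms(1,2)] by blast
qed

lemma bounded_at_inner_integrable:
  assumes "bounded_at u \<eta>" "bounded_at u' \<eta>'"
  shows "integrable M (\<lambda>\<omega>. \<eta> \<omega> \<bullet> \<eta>' \<omega>)"
proof -
  have "square_integrable M \<eta>" if "bounded_at u \<eta>" for u and \<eta> :: "'w \<Rightarrow> real ^ 'd ^ 'm"
    using that bounded_at_measurable[OF that] by (auto simp: bounded_at_def intro: square_integrable_bounded)
  from square_integrable_inner(1)[OF this[OF assms(1)] this[OF assms(2)]] show ?thesis .
qed

lemma elem_integral_square_integrable:
  assumes k: "k \<in> K" and e: "elementary T \<F> N \<tau> \<eta>" and t: "0 \<le> t" "t \<le> T"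
  shows "square_integrable M (elem_integral (X k) N \<tau> \<eta> t)"
proof -
  have "square_integrable M (\<lambda>\<omega>. \<eta> j \<omega> *v \<Delta> k (min t (\<tau> j)) (min t (\<tau> (Suc j))) \<omega>)" if "j < N" for j
    using elementary_mono_time[OF e that] t
    by (intro bounded_mult_square_integrable[OF elementary_bounded_at[OF e that]] increment_square_integrable k) auto
  then show ?thesis
    unfolding elem_integral_def[abs_def] by (intro square_integrable_sum) auto
qed

lemma elem_integral_orthogonal:
  fixes H :: "'w \<Rightarrow> real ^ 'm"
  assumes k: "k \<in> K" and e: "elementary T \<F> N \<tau> \<eta>" and st: "0 \<le> s" "s \<le> t" "t \<le> T"
    and H: "H \<in> borel_measurable (\<F> s)" "square_integrable M H"
  shows "expectation (\<lambda>\<omega>. H \<omega> \<bullet> (elem_integral (X k) N \<tau> \<eta> t \<omega> - elem_integral (X k) N \<tau> \<eta> s \<omega>)) = 0"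
proof -
  let ?a = "\<lambda>j. max s (min t (\<tau> j))"
  have c: "0 \<le> ?a j" "?a j \<le> ?a (Suc j)" "?a (Suc j) \<le> T" "?a j < ?a (Suc j) \<Longrightarrow> bounded_at (?a j) (\<eta> j)" if "j < N" for j
    using elementary_clamp[OF e that st] by auto
  have sq: "square_integrable M (\<lambda>\<omega>. \<eta> j \<omega> *v \<Delta> k (?a j) (?a (Suc j)) \<omega>)" if "j < N" for j
    using c[OF that] by (intro bounded_mult_square_integrable[OF elementary_bounded_at[OF e that]] increment_square_integrable k) auto
  have z: "expectation (\<lambda>\<omega>. H \<omega> \<bullet> (\<eta> j \<omega> *v \<Delta> k (?a j) (?a (Suc j)) \<omega>)) = 0" if "j < N" for j
  proof (cases "?a j < ?a (Suc j)")
    case True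
    show ?thesis
      by (rule increment_orthogonal[OF k c(1-3)[OF that] _ H(2) c(4)[OF that True]])
        (rule \<F>_measurable_mono[OF H(1)], simp)
  next
    case False
    then have "?a j = ?a (Suc j)" using c(2)[OF that] by linarith
    then show ?thesis by simp
  qed
  have "expectation (\<lambda>\<omega>. H \<omega> \<bullet> (elem_integral (X k) N \<tau> \<eta> t \<omega> - elem_integral (X k) N \<tau> \<eta> s \<omega>))
      = expectation (\<lambda>\<omega>. \<Sum>j<N. H \<omega> \<bullet> (\<eta> j \<omega> *v \<Delta> k (?a j) (?a (Suc j)) \<omega>))"
    by (simp only: elem_integral_diff[OF st(2)] inner_sum_right)
  also have "\<dots> = (\<Sum>j<N. expectation (\<lambda>\<omega>. H \<omega> \<bullet> (\<eta> j \<omega> *v \<Delta> k (?a j) (?a (Suc j)) \<omega>)))"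
    by (rule Bochner_Integration.integral_sum) (use square_integrable_inner(1)[OF H(2) sq] in auto)
  also have "\<dots> = 0" by (rule sum.neutral) (use z in auto)
  finally show ?thesis .
qed

lemma elem_process_square_integrable:
  fixes \<eta> :: "nat \<Rightarrow> 'w \<Rightarrow> real ^ 'd ^ 'm"
  assumes e: "elementary T \<F> N \<tau> \<eta>"
  shows "square_integrable (time_measure T \<Otimes>\<^sub>M M) (\<lambda>(u, \<omega>). elem_process N \<tau> \<eta> u \<omega>)"
proof -
  interpret Q: finite_measure "time_measure T \<Otimes>\<^sub>M M" by (rule finite_measure_time_pair)
  have "square_integrable (time_measure T \<Otimes>\<^sub>M M) (\<lambda>x. indicator {\<tau> j<..\<tau> (Suc j)} (fst x) *\<^sub>R \<eta> j (snd x))"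
    if "j < N" for j
  proof -
    have b: "bounded_at (\<tau> j) (\<eta> j)" by (rule elementary_bounded_at[OF e that])
    then have [measurable]: "\<eta> j \<in> borel_measurable M" by (rule bounded_at_measurable)
    have [measurable]: "(indicator {\<tau> j<..\<tau> (Suc j)} :: real \<Rightarrow> real) \<in> borel_measurable (time_measure T)"
      by (rule measurable_time_measure) simp
    obtain c where c: "\<And>\<omega>. \<omega> \<in> space M \<Longrightarrow> norm (\<eta> j \<omega>) \<le> c"
      using b by (auto simp: bounded_at_def)
    show ?thesis
    proof (rule Q.square_integrable_bounded[where c="\<bar>c\<bar>"])
      show "(\<lambda>x. indicat_real {\<tau> j<..\<tau> (Suc j)} (fst x) *\<^sub>R \<eta> j (snd x)) \<in> borel_measurable (time_measure T \<Otimes>\<^sub>M M)"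
        by measurable
      fix x assume "x \<in> space (time_measure T \<Otimes>\<^sub>M M)"
      then have "norm (\<eta> j (snd x)) \<le> \<bar>c\<bar>" using c[of "snd x"] by (auto simp: space_pair_measure)
      then show "norm (indicat_real {\<tau> j<..\<tau> (Suc j)} (fst x) *\<^sub>R \<eta> j (snd x)) \<le> \<bar>c\<bar>"
        by (simp add: indicator_def)
    qed
  qed
  then have "square_integrable (time_measure T \<Otimes>\<^sub>M M)
      (\<lambda>x. \<Sum>j<N. indicator {\<tau> j<..\<tau> (Suc j)} (fst x) *\<^sub>R \<eta> j (snd x))"
    by (intro square_integrable_sum) auto
  then show ?thesis by (simp add: elem_process_def[abs_def] case_prod_beta')
qed

text \<open>The isometry in polarised form, for two elementary integrands on different partitions and possibly with
different Brownian motions. The polarised form avoids a common refinement of the partitions: the double sum is treated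
one pair of intervals at a time.\<close>

lemma elem_integral_covariance:
  fixes \<eta> \<eta>' :: "nat \<Rightarrow> 'w \<Rightarrow> real ^ 'd ^ 'm"
  assumes k: "k \<in> K" and l: "l \<in> K" and e: "elementary T \<F> N \<tau> \<eta>" and e': "elementary T \<F> N' \<tau>' \<eta>'"
    and st: "0 \<le> s" "s \<le> t" "t \<le> T"
  shows "expectation (\<lambda>\<omega>. (elem_integral (X k) N \<tau> \<eta> t \<omega> - elem_integral (X k) N \<tau> \<eta> s \<omega>)
        \<bullet> (elem_integral (X l) N' \<tau>' \<eta>' t \<omega> - elem_integral (X l) N' \<tau>' \<eta>' s \<omega>))
    = of_bool (k = l) * (\<integral>x. on_interval s t (elem_process N \<tau> \<eta>) x \<bullet> on_interval s t (elem_process N' \<tau>' \<eta>') x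
        \<partial>(time_measure T \<Otimes>\<^sub>M M))"
proof -
  let ?a = "\<lambda>j. max s (min t (\<tau> j))" and ?a' = "\<lambda>j. max s (min t (\<tau>' j))"
  let ?c = "\<lambda>i j. max 0 (min (?a (Suc i)) (?a' (Suc j)) - max (?a i) (?a' j))"
  let ?\<phi> = "\<lambda>i j u. indicator {s..t} u * indicator {max (\<tau> i) (\<tau>' j)<..min (\<tau> (Suc i)) (\<tau>' (Suc j))} u :: real"
  have c: "0 \<le> ?a j" "?a j \<le> ?a (Suc j)" "?a (Suc j) \<le> T" "?a j < ?a (Suc j) \<Longrightarrow> bounded_at (?a j) (\<eta> j)" if "j < N" for j
    using elementary_clamp[OF e that st] by auto
  have c': "0 \<le> ?a' j" "?a' j \<le> ?a' (Suc j)" "?a' (Suc j) \<le> T" "?a' j < ?a' (Suc j) \<Longrightarrow> bounded_at (?a' j) (\<eta>' j)" if "j < N'" for j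
    using elementary_clamp[OF e' that st] by auto
  have sq: "square_integrable M (\<lambda>\<omega>. \<eta> j \<omega> *v \<Delta> k (?a j) (?a (Suc j)) \<omega>)" if "j < N" for j
    using c[OF that] by (intro bounded_mult_square_integrable[OF elementary_bounded_at[OF e that]] increment_square_integrable k) auto
  have sq': "square_integrable M (\<lambda>\<omega>. \<eta>' j \<omega> *v \<Delta> l (?a' j) (?a' (Suc j)) \<omega>)" if "j < N'" for j
    using c'[OF that] by (intro bounded_mult_square_integrable[OF elementary_bounded_at[OF e' that]] increment_square_integrable l) auto
  have ii: "integrable M (\<lambda>\<omega>. \<eta> i \<omega> \<bullet> \<eta>' j \<omega>)" if "i < N" "j < N'" for i j
    by (rule bounded_at_inner_integrable[OF elementary_bounded_at[OF e that(1)] elementary_bounded_at[OF e' that(2)]])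
  have \<phi>m: "?\<phi> i j \<in> borel_measurable borel" for i j by measurable
  have \<phi>b: "\<bar>?\<phi> i j u\<bar> \<le> 1" for i j u by (auto simp: indicator_def)
  note P = integral_time_product[OF \<phi>m \<phi>b ii]
  have \<phi>I: "(\<integral>u. ?\<phi> i j u \<partial>time_measure T) = ?c i j" for i j
    unfolding clamp_interval_measure[OF st] clamp_overlap[OF st(2)] ..
  have "expectation (\<lambda>\<omega>. (elem_integral (X k) N \<tau> \<eta> t \<omega> - elem_integral (X k) N \<tau> \<eta> s \<omega>)
        \<bullet> (elem_integral (X l) N' \<tau>' \<eta>' t \<omega> - elem_integral (X l) N' \<tau>' \<eta>' s \<omega>))
    = expectation (\<lambda>\<omega>. \<Sum>i<N. \<Sum>j<N'. (\<eta> i \<omega> *v \<Delta> k (?a i) (?a (Suc i)) \<omega>) \<bullet> (\<eta>' j \<omega> *v \<Delta> l (?a' j) (?a' (Suc j)) \<omega>))"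
    by (simp only: elem_integral_diff[OF st(2)] inner_sum_right inner_sum_left) (subst sum.swap, rule refl)
  also have "\<dots> = (\<Sum>i<N. \<Sum>j<N'. expectation (\<lambda>\<omega>. (\<eta> i \<omega> *v \<Delta> k (?a i) (?a (Suc i)) \<omega>) \<bullet> (\<eta>' j \<omega> *v \<Delta> l (?a' j) (?a' (Suc j)) \<omega>)))"
    using square_integrable_inner(1)[OF sq sq']
    by (subst Bochner_Integration.integral_sum, force intro!: Bochner_Integration.integrable_sum)
      (intro sum.cong refl Bochner_Integration.integral_sum, auto)
  also have "\<dots> = (\<Sum>i<N. \<Sum>j<N'. of_bool (k = l) * ?c i j * expectation (\<lambda>\<omega>. \<eta> i \<omega> \<bullet> \<eta>' j \<omega>))"
    by (intro sum.cong refl increment_pair k l) (use c c' in auto)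
  also have "\<dots> = of_bool (k = l) * (\<Sum>i<N. \<Sum>j<N'. ?c i j * expectation (\<lambda>\<omega>. \<eta> i \<omega> \<bullet> \<eta>' j \<omega>))"
    by (simp only: sum_distrib_left mult.assoc)
  also have "(\<Sum>i<N. \<Sum>j<N'. ?c i j * expectation (\<lambda>\<omega>. \<eta> i \<omega> \<bullet> \<eta>' j \<omega>))
      = (\<Sum>i<N. \<Sum>j<N'. \<integral>(u, \<omega>). ?\<phi> i j u * (\<eta> i \<omega> \<bullet> \<eta>' j \<omega>) \<partial>(time_measure T \<Otimes>\<^sub>M M))"
    by (intro sum.cong refl) (simp only: P(2) \<phi>I lessThan_iff)
  also have "\<dots> = (\<integral>x. (\<Sum>i<N. \<Sum>j<N'. case x of (u, \<omega>) \<Rightarrow> ?\<phi> i j u * (\<eta> i \<omega> \<bullet> \<eta>' j \<omega>)) \<partial>(time_measure T \<Otimes>\<^sub>M M))"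
    using P(1)
    by (subst Bochner_Integration.integral_sum, force intro!: Bochner_Integration.integrable_sum)
      (intro sum.cong refl Bochner_Integration.integral_sum[symmetric], auto)
  also have "\<dots> = (\<integral>x. on_interval s t (elem_process N \<tau> \<eta>) x \<bullet> on_interval s t (elem_process N' \<tau>' \<eta>') x \<partial>(time_measure T \<Otimes>\<^sub>M M))"
  proof (intro Bochner_Integration.integral_cong refl)
    fix x :: "real \<times> 'w"
    obtain u \<omega> where x: "x = (u, \<omega>)" by (cases x)
    have ind: "?\<phi> i j u = indicator {s..t} u * (indicator {\<tau> i<..\<tau> (Suc i)} u * indicator {\<tau>' j<..\<tau>' (Suc j)} u)" for i j
      by (auto simp: indicator_def)
    have "on_interval s t (elem_process N \<tau> \<eta>) x \<bullet> on_interval s t (elem_process N' \<tau>' \<eta>') x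
      = indicator {s..t} u * (elem_process N \<tau> \<eta> u \<omega> \<bullet> elem_process N' \<tau>' \<eta>' u \<omega>)"
      by (simp add: x on_interval_def indicator_def)
    also have "elem_process N \<tau> \<eta> u \<omega> \<bullet> elem_process N' \<tau>' \<eta>' u \<omega>
      = (\<Sum>i<N. \<Sum>j<N'. (indicator {\<tau> i<..\<tau> (Suc i)} u * indicator {\<tau>' j<..\<tau>' (Suc j)} u) * (\<eta> i \<omega> \<bullet> \<eta>' j \<omega>))"
      unfolding elem_process_def inner_sum_left inner_sum_right
      by (subst sum.swap) (simp add: mult_ac)
    finally show "(\<Sum>i<N. \<Sum>j<N'. case x of (u, \<omega>) \<Rightarrow> ?\<phi> i j u * (\<eta> i \<omega> \<bullet> \<eta>' j \<omega>))
      = on_interval s t (elem_process N \<tau> \<eta>) x \<bullet> on_interval s t (elem_process N' \<tau>' \<eta>') x"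
      unfolding x prod.case ind by (simp only: sum_distrib_left mult.assoc)
  qed
  finally show ?thesis .
qed

end

section \<open>Orthogonality and isometry of stochastic integrals\<close>

lemma prog_measurable_jointly_measurable:
  fixes Z :: "real \<Rightarrow> 'w \<Rightarrow> 'v::topological_space"
  assumes Z: "prog_measurable T F Z" and T: "0 \<le> T" and F: "space (F T) = space M" "sets (F T) \<subseteq> sets M"
  shows "jointly_measurable M T Z"
proof -
  have m: "(\<lambda>(s, \<omega>). Z s \<omega>) \<in> borel_measurable (restrict_space borel {0..T} \<Otimes>\<^sub>M F T)"
    using Z T by (simp add: prog_measurable_def)
  note id1 = measurable_ident_sets[OF sets_time_measure]
  note id2 = measurable_ident_subset[OF F]
  note 1 = measurable_compose[OF measurable_fst id1] and 2 = measurable_compose[OF measurable_snd id2]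
  have "(\<lambda>x. (fst x, snd x)) \<in> time_measure T \<Otimes>\<^sub>M M \<rightarrow>\<^sub>M restrict_space borel {0..T} \<Otimes>\<^sub>M F T"
    by (rule measurable_Pair[OF 1 2])
  from measurable_compose[OF this m] show ?thesis
    by (simp add: jointly_measurable_def case_prod_beta')
qed

lemma prog_measurable_adapted:
  fixes Z :: "real \<Rightarrow> 'w \<Rightarrow> 'v::topological_space"
  assumes Z: "prog_measurable T F Z" and t: "t \<in> {0..T}"
  shows "Z t \<in> borel_measurable (F t)"
proof -
  have m: "(\<lambda>(s, \<omega>). Z s \<omega>) \<in> borel_measurable (restrict_space borel {0..t} \<Otimes>\<^sub>M F t)"
    using Z t by (simp add: prog_measurable_def)
  have "(\<lambda>\<omega>. (t, \<omega>)) \<in> F t \<rightarrow>\<^sub>M restrict_space borel {0..t} \<Otimes>\<^sub>M F t"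
    using t by (intro measurable_Pair measurable_const measurable_ident) (auto simp: space_restrict_space)
  from measurable_compose[OF this m] show ?thesis by simp
qed

lemma jointly_measurable_section:
  assumes "jointly_measurable M T Z" "t \<in> {0..T}"
  shows "Z t \<in> borel_measurable M"
proof -
  have "(\<lambda>\<omega>. (t, \<omega>)) \<in> M \<rightarrow>\<^sub>M time_measure T \<Otimes>\<^sub>M M"
    using assms(2) by (intro measurable_Pair measurable_const measurable_ident) auto
  from measurable_compose[OF this assms(1)[unfolded jointly_measurable_def]] show ?thesis by simp
qed

lemma on_interval_square_integrable:
  fixes Z :: "real \<Rightarrow> 'w \<Rightarrow> 'v::euclidean_space"
  assumes Z: "square_integrable (time_measure T \<Otimes>\<^sub>M M) (\<lambda>(u, \<omega>). Z u \<omega>)"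
  shows "square_integrable (time_measure T \<Otimes>\<^sub>M M) (on_interval s t Z)"
proof (rule square_integrable_bound[OF Z])
  show "on_interval s t Z \<in> borel_measurable (time_measure T \<Otimes>\<^sub>M M)"
    using Z by (intro on_interval_measurable) (simp add: jointly_measurable_def square_integrable_def)
  show "norm (on_interval s t Z x) \<le> norm (case x of (u, \<omega>) \<Rightarrow> Z u \<omega>)" for x
    by (cases x) (simp add: on_interval_def indicator_def)
qed

lemma inner_diff_diff: "(a - a') \<bullet> (b - b') = a \<bullet> b - a \<bullet> b' - (a' \<bullet> b - a' \<bullet> b')"
  by (simp add: inner_diff_left inner_diff_right)

text \<open>The coupled equations are solved in smaller filtrations than the particle system. Their stochastic
integrals are also stochastic integrals in the filtration of the whole family.\<close>

lemma ito_integral_filtration_mono: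
  assumes I: "ito_integral M T F B Z I"
    and sp: "\<And>t. space (F t) = space M" "\<And>t. space (G t) = space M"
    and FG: "\<And>t. sets (F t) \<subseteq> sets (G t)"
  shows "ito_integral M T G B Z I"
proof -
  have m: "f \<in> borel_measurable (F t) \<Longrightarrow> f \<in> borel_measurable (G t)" for f :: "'a \<Rightarrow> 'x::topological_space" and t
    by (erule measurable_sub_algebra) (simp_all add: sp FG)
  have e: "elementary T F N \<tau> \<eta> \<Longrightarrow> elementary T G N \<tau> \<eta>" for N \<tau> and \<eta> :: "nat \<Rightarrow> 'a \<Rightarrow> (real, 'b) vec ^ 'c"
    unfolding elementary_def sp using m by blast
  show ?thesis
    using I m e unfolding ito_integral_def by blast
qed

lemma ito_integral_zero:
  assumes "0 \<le> T"
  shows "ito_integral M T F B (\<lambda>_ _. 0) (\<lambda>_ _. 0)"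
  unfolding ito_integral_def
  by (intro conjI exI[of _ "\<lambda>_. 0"] exI[of _ "\<lambda>_ _. T"] exI[of _ "\<lambda>_ _ _. 0"])
    (use assms in \<open>auto simp: elementary_def elem_process_def elem_integral_def\<close>)

context brownian_family
begin

lemma ito_integral_approximation:
  fixes B :: "real \<Rightarrow> 'w \<Rightarrow> real ^ 'd" and Z :: "real \<Rightarrow> 'w \<Rightarrow> real ^ 'd ^ 'm"
  assumes I: "ito_integral M T \<F> B Z I" and Z: "jointly_measurable M T Z"
  obtains N \<tau> \<eta> where "\<And>n::nat. elementary T \<F> (N n) (\<tau> n) (\<eta> n)"
    and "L2_tendsto (time_measure T \<Otimes>\<^sub>M M) (\<lambda>n (u, \<omega>). elem_process (N n) (\<tau> n) (\<eta> n) u \<omega>) (\<lambda>(u, \<omega>). Z u \<omega>)"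
    and "\<And>t. t \<in> {0..T} \<Longrightarrow> L2_tendsto M (\<lambda>n. elem_integral B (N n) (\<tau> n) (\<eta> n) t) (I t)"
proof -
  obtain N \<tau> \<eta> where e: "\<And>n::nat. elementary T \<F> (N n) (\<tau> n) (\<eta> n)"
    and lim: "(\<lambda>k. \<integral>\<^sup>+\<omega>. (\<integral>\<^sup>+s\<in>{0..T}.
            ennreal ((norm (elem_process (N k) (\<tau> k) (\<eta> k) s \<omega> - Z s \<omega>))\<^sup>2) \<partial>lborel) \<partial>M) \<longlonglongrightarrow> 0"
    and limI: "\<And>t. t\<in>{0..T} \<Longrightarrow> (\<lambda>k. \<integral>\<^sup>+\<omega>.
            ennreal ((norm (elem_integral B (N k) (\<tau> k) (\<eta> k) t \<omega> - I t \<omega>))\<^sup>2) \<partial>M) \<longlonglongrightarrow> 0"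
    using I unfolding ito_integral_def by blast
  have [measurable]: "(\<lambda>(u, \<omega>). Z u \<omega>) \<in> borel_measurable (time_measure T \<Otimes>\<^sub>M M)"
    using Z by (simp add: jointly_measurable_def)
  have "L2_tendsto (time_measure T \<Otimes>\<^sub>M M) (\<lambda>n (u, \<omega>). elem_process (N n) (\<tau> n) (\<eta> n) u \<omega>) (\<lambda>(u, \<omega>). Z u \<omega>)"
    unfolding L2_tendsto_def
  proof (rule Lim_transform_eventually[OF lim], rule always_eventually, rule allI)
    fix n
    have [measurable]: "(\<lambda>(u, \<omega>). elem_process (N n) (\<tau> n) (\<eta> n) u \<omega>) \<in> borel_measurable (time_measure T \<Otimes>\<^sub>M M)"
      using elem_process_square_integrable[OF e[of n]] by (simp add: square_integrable_def)
    have "(\<lambda>x. ennreal ((norm ((case x of (u, \<omega>) \<Rightarrow> elem_process (N n) (\<tau> n) (\<eta> n) u \<omega>) - (case x of (u, \<omega>) \<Rightarrow> Z u \<omega>)))\<^sup>2))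
      \<in> borel_measurable (time_measure T \<Otimes>\<^sub>M M)" by measurable
    from nn_integral_time_pair(1)[OF this]
    show "(\<integral>\<^sup>+\<omega>. (\<integral>\<^sup>+s\<in>{0..T}. ennreal ((norm (elem_process (N n) (\<tau> n) (\<eta> n) s \<omega> - Z s \<omega>))\<^sup>2) \<partial>lborel) \<partial>M)
      = (\<integral>\<^sup>+x. ennreal ((norm ((case x of (u, \<omega>) \<Rightarrow> elem_process (N n) (\<tau> n) (\<eta> n) u \<omega>)
          - (case x of (u, \<omega>) \<Rightarrow> Z u \<omega>)))\<^sup>2) \<partial>(time_measure T \<Otimes>\<^sub>M M))"
      by simp
  qed
  with e limI show ?thesis by (intro that) (auto simp: L2_tendsto_def)
qed

lemma ito_integral_adapted: "ito_integral M T \<F> B Z I \<Longrightarrow> t \<in> {0..T} \<Longrightarrow> I t \<in> borel_measurable (\<F> t)"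
  by (simp add: ito_integral_def)

lemma ito_integral_square_integrable:
  assumes k: "k \<in> K" and I: "ito_integral M T \<F> (X k) Z I" and Z: "jointly_measurable M T Z" and t: "t \<in> {0..T}"
  shows "square_integrable M (I t)"
    and "square_integrable (time_measure T \<Otimes>\<^sub>M M) (on_interval s t Z)"
proof -
  obtain N \<tau> \<eta> where e: "\<And>n::nat. elementary T \<F> (N n) (\<tau> n) (\<eta> n)"
    and lZ: "L2_tendsto (time_measure T \<Otimes>\<^sub>M M) (\<lambda>n (u, \<omega>). elem_process (N n) (\<tau> n) (\<eta> n) u \<omega>) (\<lambda>(u, \<omega>). Z u \<omega>)"
    and lI: "\<And>t. t \<in> {0..T} \<Longrightarrow> L2_tendsto M (\<lambda>n. elem_integral (X k) (N n) (\<tau> n) (\<eta> n) t) (I t)"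
    by (rule ito_integral_approximation[OF I Z], rule that; simp)
  show "square_integrable M (I t)"
    using t by (intro L2_tendsto_square_integrable[OF lI[OF t]] elem_integral_square_integrable[OF k e]
        \<F>_measurable[OF ito_integral_adapted[OF I t]]) auto
  have "square_integrable (time_measure T \<Otimes>\<^sub>M M) (\<lambda>(u, \<omega>). Z u \<omega>)"
    using Z by (intro L2_tendsto_square_integrable[OF lZ] elem_process_square_integrable[OF e])
      (simp add: jointly_measurable_def)
  then show "square_integrable (time_measure T \<Otimes>\<^sub>M M) (on_interval s t Z)"
    by (rule on_interval_square_integrable)
qed

lemma ito_integral_orthogonal:
  assumes k: "k \<in> K" and I: "ito_integral M T \<F> (X k) Z I" and Z: "jointly_measurable M T Z"
    and st: "0 \<le> s" "s \<le> t" "t \<le> T" and H: "H \<in> borel_measurable (\<F> s)" "square_integrable M H"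
  shows "expectation (\<lambda>\<omega>. H \<omega> \<bullet> (I t \<omega> - I s \<omega>)) = 0"
proof -
  have sT: "s \<in> {0..T}" "t \<in> {0..T}" using st by auto
  obtain N \<tau> \<eta> where e: "\<And>n::nat. elementary T \<F> (N n) (\<tau> n) (\<eta> n)"
    and lZ: "L2_tendsto (time_measure T \<Otimes>\<^sub>M M) (\<lambda>n (u, \<omega>). elem_process (N n) (\<tau> n) (\<eta> n) u \<omega>) (\<lambda>(u, \<omega>). Z u \<omega>)"
    and lI: "\<And>t. t \<in> {0..T} \<Longrightarrow> L2_tendsto M (\<lambda>n. elem_integral (X k) (N n) (\<tau> n) (\<eta> n) t) (I t)"
    by (rule ito_integral_approximation[OF I Z], rule that; simp)
  let ?e = "\<lambda>n t \<omega>. elem_integral (X k) (N n) (\<tau> n) (\<eta> n) t \<omega>"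
  have sq: "square_integrable M (?e n r)" if "r \<in> {0..T}" for n r
    using that by (intro elem_integral_square_integrable[OF k e]) auto
  have m: "?e n r \<in> borel_measurable M" if "r \<in> {0..T}" for n r
    using sq[OF that] by (simp add: square_integrable_def)
  have mI: "I r \<in> borel_measurable M" if "r \<in> {0..T}" for r
    by (rule \<F>_measurable[OF ito_integral_adapted[OF I that]])
  have "(\<lambda>n. expectation (\<lambda>\<omega>. H \<omega> \<bullet> (?e n t \<omega> - ?e n s \<omega>))) \<longlonglongrightarrow> expectation (\<lambda>\<omega>. H \<omega> \<bullet> (I t \<omega> - I s \<omega>))"
    using \<F>_measurable[OF H(1)]
    by (intro L2_tendsto_inner L2_tendsto_diff L2_tendsto_const lI sT H square_integrable_diff sq m mI borel_measurable_diff)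
  moreover have "expectation (\<lambda>\<omega>. H \<omega> \<bullet> (?e n t \<omega> - ?e n s \<omega>)) = 0" for n
    by (rule elem_integral_orthogonal[OF k e st H])
  ultimately show ?thesis by (simp add: LIMSEQ_const_iff)
qed

text \<open>Passage to the limit on both sides of the polarised isometry.\<close>

lemma ito_integral_covariance:
  assumes k: "k \<in> K" and l: "l \<in> K"
    and I: "ito_integral M T \<F> (X k) Z I" and Z: "jointly_measurable M T Z"
    and I': "ito_integral M T \<F> (X l) Z' I'" and Z': "jointly_measurable M T Z'"
    and st: "0 \<le> s" "s \<le> t" "t \<le> T"
  shows "expectation (\<lambda>\<omega>. (I t \<omega> - I s \<omega>) \<bullet> (I' t \<omega> - I' s \<omega>))
    = of_bool (k = l) * (\<integral>x. on_interval s t Z x \<bullet> on_interval s t Z' x \<partial>(time_measure T \<Otimes>\<^sub>M M))"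
proof -
  let ?Q = "time_measure T \<Otimes>\<^sub>M M"
  have sT: "s \<in> {0..T}" "t \<in> {0..T}" using st by auto
  obtain N \<tau> \<eta> where e: "\<And>n::nat. elementary T \<F> (N n) (\<tau> n) (\<eta> n)"
    and lZ: "L2_tendsto ?Q (\<lambda>n (u, \<omega>). elem_process (N n) (\<tau> n) (\<eta> n) u \<omega>) (\<lambda>(u, \<omega>). Z u \<omega>)"
    and lI: "\<And>t. t \<in> {0..T} \<Longrightarrow> L2_tendsto M (\<lambda>n. elem_integral (X k) (N n) (\<tau> n) (\<eta> n) t) (I t)"
    by (rule ito_integral_approximation[OF I Z], rule that; simp)
  obtain N' \<tau>' \<eta>' where e': "\<And>n::nat. elementary T \<F> (N' n) (\<tau>' n) (\<eta>' n)"
    and lZ': "L2_tendsto ?Q (\<lambda>n (u, \<omega>). elem_process (N' n) (\<tau>' n) (\<eta>' n) u \<omega>) (\<lambda>(u, \<omega>). Z' u \<omega>)"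
    and lI': "\<And>t. t \<in> {0..T} \<Longrightarrow> L2_tendsto M (\<lambda>n. elem_integral (X l) (N' n) (\<tau>' n) (\<eta>' n) t) (I' t)"
    by (rule ito_integral_approximation[OF I' Z'], rule that; simp)
  let ?e = "\<lambda>n t \<omega>. elem_integral (X k) (N n) (\<tau> n) (\<eta> n) t \<omega>"
  let ?e' = "\<lambda>n t \<omega>. elem_integral (X l) (N' n) (\<tau>' n) (\<eta>' n) t \<omega>"
  let ?p = "\<lambda>n. elem_process (N n) (\<tau> n) (\<eta> n)" and ?p' = "\<lambda>n. elem_process (N' n) (\<tau>' n) (\<eta>' n)"
  have sq: "square_integrable M (?e n r)" "square_integrable M (?e' n r)" if "r \<in> {0..T}" for n r
    using that by (intro elem_integral_square_integrable[OF k e] elem_integral_square_integrable[OF l e']; simp)+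
  have m: "?e n r \<in> borel_measurable M" "?e' n r \<in> borel_measurable M" if "r \<in> {0..T}" for n r
    using sq[OF that] by (simp_all add: square_integrable_def)
  have mI: "I r \<in> borel_measurable M" "I' r \<in> borel_measurable M" if "r \<in> {0..T}" for r
    by (rule \<F>_measurable[OF ito_integral_adapted[OF I that]] \<F>_measurable[OF ito_integral_adapted[OF I' that]])+
  have "(\<lambda>n. expectation (\<lambda>\<omega>. (?e n t \<omega> - ?e n s \<omega>) \<bullet> (?e' n t \<omega> - ?e' n s \<omega>)))
      \<longlonglongrightarrow> expectation (\<lambda>\<omega>. (I t \<omega> - I s \<omega>) \<bullet> (I' t \<omega> - I' s \<omega>))"
    by (intro L2_tendsto_inner L2_tendsto_diff lI lI' sT square_integrable_diff sq m mI borel_measurable_diff)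
  then have lim1: "(\<lambda>n. of_bool (k = l) * (\<integral>x. on_interval s t (?p n) x \<bullet> on_interval s t (?p' n) x \<partial>?Q))
      \<longlonglongrightarrow> expectation (\<lambda>\<omega>. (I t \<omega> - I s \<omega>) \<bullet> (I' t \<omega> - I' s \<omega>))"
    by (simp only: elem_integral_covariance[OF k l e e' st])
  have c: "L2_tendsto ?Q (\<lambda>n. on_interval s t (?p n)) (on_interval s t Z)"
    by (rule L2_tendsto_bound[OF lZ]) (use norm_on_interval_diff_le in \<open>auto simp: case_prod_beta\<close>)
  have c': "L2_tendsto ?Q (\<lambda>n. on_interval s t (?p' n)) (on_interval s t Z')"
    by (rule L2_tendsto_bound[OF lZ']) (use norm_on_interval_diff_le in \<open>auto simp: case_prod_beta\<close>)
  have cs: "square_integrable ?Q (on_interval s t (?p n))" for n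
    by (rule on_interval_square_integrable[OF elem_process_square_integrable[OF e[of n]]])
  have cs': "square_integrable ?Q (on_interval s t (?p' n))" for n
    by (rule on_interval_square_integrable[OF elem_process_square_integrable[OF e'[of n]]])
  have "(\<lambda>n. of_bool (k = l) * (\<integral>x. on_interval s t (?p n) x \<bullet> on_interval s t (?p' n) x \<partial>?Q))
      \<longlonglongrightarrow> of_bool (k = l) * (\<integral>x. on_interval s t Z x \<bullet> on_interval s t Z' x \<partial>?Q)"
    by (intro tendsto_mult tendsto_const L2_tendsto_inner c c' cs cs' on_interval_measurable Z Z')
  from LIMSEQ_unique[OF lim1 this] show ?thesis .
qed

text \<open>The martingale part of the difference of two backward equations. The two integrals against the same
Brownian motion come with different approximating sequences, and so their difference is not treated as one integral:
the square is expanded bilinearly and the polarised isometry applied to the four resulting terms.\<close>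

lemma ito_sum_difference:
  fixes Z Z' :: "'k \<Rightarrow> real \<Rightarrow> 'w \<Rightarrow> real ^ 'd ^ 'm"
  assumes I: "\<And>k. k \<in> K \<Longrightarrow> ito_integral M T \<F> (X k) (Z k) (I k)"
    and Z: "\<And>k. k \<in> K \<Longrightarrow> jointly_measurable M T (Z k)"
    and I': "\<And>k. k \<in> K \<Longrightarrow> ito_integral M T \<F> (X k) (Z' k) (I' k)"
    and Z': "\<And>k. k \<in> K \<Longrightarrow> jointly_measurable M T (Z' k)"
  defines "N \<equiv> \<lambda>t \<omega>. \<Sum>k\<in>K. I k t \<omega> - I' k t \<omega>"
  shows "t \<in> {0..T} \<Longrightarrow> N t \<in> borel_measurable (\<F> t)"
    and "t \<in> {0..T} \<Longrightarrow> square_integrable M (N t)"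
    and "AE \<omega> in M. continuous_on {0..T} (\<lambda>t. N t \<omega>)"
    and "0 \<le> s \<Longrightarrow> s \<le> t \<Longrightarrow> t \<le> T \<Longrightarrow> H \<in> borel_measurable (\<F> s) \<Longrightarrow> square_integrable M H \<Longrightarrow>
      expectation (\<lambda>\<omega>. H \<omega> \<bullet> (N t \<omega> - N s \<omega>)) = 0"
    and "0 \<le> s \<Longrightarrow> s \<le> t \<Longrightarrow> t \<le> T \<Longrightarrow> (\<integral>\<^sup>+\<omega>. ennreal ((norm (N t \<omega> - N s \<omega>))\<^sup>2) \<partial>M)
      = (\<integral>\<^sup>+x. (\<Sum>k\<in>K. ennreal ((norm (Z k (fst x) (snd x) - Z' k (fst x) (snd x)))\<^sup>2)) * indicator {s..t} (fst x)
          \<partial>(time_measure T \<Otimes>\<^sub>M M))"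
proof -
  let ?Q = "time_measure T \<Otimes>\<^sub>M M"
  show "N t \<in> borel_measurable (\<F> t)" if "t \<in> {0..T}" for t
    unfolding N_def
    using ito_integral_adapted[OF I that] ito_integral_adapted[OF I' that]
    by (intro borel_measurable_sum borel_measurable_diff)
  show sqN: "square_integrable M (N t)" if "t \<in> {0..T}" for t
    unfolding N_def
    by (intro square_integrable_sum square_integrable_diff ito_integral_square_integrable(1)[OF _ I Z]
        ito_integral_square_integrable(1)[OF _ I' Z'] that)
  have cI: "\<And>k. k \<in> K \<Longrightarrow> AE \<omega> in M. continuous_on {0..T} (\<lambda>t. I k t \<omega>)"
    and cI': "\<And>k. k \<in> K \<Longrightarrow> AE \<omega> in M. continuous_on {0..T} (\<lambda>t. I' k t \<omega>)"
    using I I' by (auto simp: ito_integral_def)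
  have "AE \<omega> in M. \<forall>k\<in>K. continuous_on {0..T} (\<lambda>t. I k t \<omega>) \<and> continuous_on {0..T} (\<lambda>t. I' k t \<omega>)"
    using K_finite cI cI' by (intro AE_finite_allI) auto
  then show "AE \<omega> in M. continuous_on {0..T} (\<lambda>t. N t \<omega>)"
    unfolding N_def by eventually_elim (intro continuous_on_sum continuous_on_diff; blast)
  have Nd: "N t \<omega> - N s \<omega> = (\<Sum>k\<in>K. (I k t \<omega> - I k s \<omega>) - (I' k t \<omega> - I' k s \<omega>))" for s t \<omega>
    by (simp add: N_def algebra_simps flip: sum_subtractf)
  {
    fix s t assume st: "0 \<le> s" "s \<le> t" "t \<le> T"
    have sT: "s \<in> {0..T}" "t \<in> {0..T}" using st by auto
    let ?d = "\<lambda>k \<omega>. I k t \<omega> - I k s \<omega>" and ?d' = "\<lambda>k \<omega>. I' k t \<omega> - I' k s \<omega>"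
    have sq: "square_integrable M (?d k)" "square_integrable M (?d' k)" if "k \<in> K" for k
      by (intro square_integrable_diff ito_integral_square_integrable(1)[OF _ I Z]
        ito_integral_square_integrable(1)[OF _ I' Z'] that sT)+
    note J = square_integrable_inner(1)
    {
      fix H :: "'w \<Rightarrow> real ^ 'm" assume H: "H \<in> borel_measurable (\<F> s)" "square_integrable M H"
      have "expectation (\<lambda>\<omega>. H \<omega> \<bullet> (N t \<omega> - N s \<omega>))
        = expectation (\<lambda>\<omega>. \<Sum>k\<in>K. H \<omega> \<bullet> ?d k \<omega> - H \<omega> \<bullet> ?d' k \<omega>)"
        by (simp only: Nd inner_sum_right inner_diff_right)
      also have "\<dots> = (\<Sum>k\<in>K. expectation (\<lambda>\<omega>. H \<omega> \<bullet> ?d k \<omega>) - expectation (\<lambda>\<omega>. H \<omega> \<bullet> ?d' k \<omega>))"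
        using J[OF H(2) sq(1)] J[OF H(2) sq(2)]
        by (subst Bochner_Integration.integral_sum)
          (auto intro!: Bochner_Integration.integrable_diff sum.cong Bochner_Integration.integral_diff simp del: inner_diff_right)
      also have "\<dots> = 0"
        using ito_integral_orthogonal[OF _ I Z st H] ito_integral_orthogonal[OF _ I' Z' st H]
        by (intro sum.neutral) auto
      finally show "expectation (\<lambda>\<omega>. H \<omega> \<bullet> (N t \<omega> - N s \<omega>)) = 0" .
    }
    let ?c = "\<lambda>k. on_interval s t (Z k)" and ?c' = "\<lambda>k. on_interval s t (Z' k)"
    let ?z = "\<lambda>k x. ?c k x - ?c' k x"
    have sc: "square_integrable ?Q (?c k)" "square_integrable ?Q (?c' k)" if "k \<in> K" for k
      by (rule ito_integral_square_integrable(2)[OF that I Z sT(2)] ito_integral_square_integrable(2)[OF that I' Z' sT(2)]; fact that)+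
    have pair: "expectation (\<lambda>\<omega>. (?d k \<omega> - ?d' k \<omega>) \<bullet> (?d l \<omega> - ?d' l \<omega>))
      = of_bool (k = l) * (\<integral>x. ?z k x \<bullet> ?z l x \<partial>?Q)" if kl: "k \<in> K" "l \<in> K" for k l
    proof -
      have "expectation (\<lambda>\<omega>. (?d k \<omega> - ?d' k \<omega>) \<bullet> (?d l \<omega> - ?d' l \<omega>))
        = expectation (\<lambda>\<omega>. ?d k \<omega> \<bullet> ?d l \<omega> - ?d k \<omega> \<bullet> ?d' l \<omega> - (?d' k \<omega> \<bullet> ?d l \<omega> - ?d' k \<omega> \<bullet> ?d' l \<omega>))"
        by (rule Bochner_Integration.integral_cong[OF refl], rule inner_diff_diff)
      also have "\<dots> = expectation (\<lambda>\<omega>. ?d k \<omega> \<bullet> ?d l \<omega>) - expectation (\<lambda>\<omega>. ?d k \<omega> \<bullet> ?d' l \<omega>)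
          - (expectation (\<lambda>\<omega>. ?d' k \<omega> \<bullet> ?d l \<omega>) - expectation (\<lambda>\<omega>. ?d' k \<omega> \<bullet> ?d' l \<omega>))"
        using J[OF sq(1)[OF kl(1)] sq(1)[OF kl(2)]] J[OF sq(1)[OF kl(1)] sq(2)[OF kl(2)]]
          J[OF sq(2)[OF kl(1)] sq(1)[OF kl(2)]] J[OF sq(2)[OF kl(1)] sq(2)[OF kl(2)]]
        by (simp only: Bochner_Integration.integral_diff Bochner_Integration.integrable_diff)
      also have "\<dots> = of_bool (k = l) * ((\<integral>x. ?c k x \<bullet> ?c l x \<partial>?Q) - (\<integral>x. ?c k x \<bullet> ?c' l x \<partial>?Q)
          - ((\<integral>x. ?c' k x \<bullet> ?c l x \<partial>?Q) - (\<integral>x. ?c' k x \<bullet> ?c' l x \<partial>?Q)))"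
        unfolding ito_integral_covariance[OF kl I[OF kl(1)] Z[OF kl(1)] I[OF kl(2)] Z[OF kl(2)] st]
          ito_integral_covariance[OF kl I[OF kl(1)] Z[OF kl(1)] I'[OF kl(2)] Z'[OF kl(2)] st]
          ito_integral_covariance[OF kl I'[OF kl(1)] Z'[OF kl(1)] I[OF kl(2)] Z[OF kl(2)] st]
          ito_integral_covariance[OF kl I'[OF kl(1)] Z'[OF kl(1)] I'[OF kl(2)] Z'[OF kl(2)] st]
        by (simp add: algebra_simps)
      also have "(\<integral>x. ?c k x \<bullet> ?c l x \<partial>?Q) - (\<integral>x. ?c k x \<bullet> ?c' l x \<partial>?Q)
          - ((\<integral>x. ?c' k x \<bullet> ?c l x \<partial>?Q) - (\<integral>x. ?c' k x \<bullet> ?c' l x \<partial>?Q))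
        = (\<integral>x. ?c k x \<bullet> ?c l x - ?c k x \<bullet> ?c' l x - (?c' k x \<bullet> ?c l x - ?c' k x \<bullet> ?c' l x) \<partial>?Q)"
        using J[OF sc(1)[OF kl(1)] sc(1)[OF kl(2)]] J[OF sc(1)[OF kl(1)] sc(2)[OF kl(2)]]
          J[OF sc(2)[OF kl(1)] sc(1)[OF kl(2)]] J[OF sc(2)[OF kl(1)] sc(2)[OF kl(2)]]
        by (simp only: Bochner_Integration.integral_diff Bochner_Integration.integrable_diff)
      also have "\<dots> = (\<integral>x. ?z k x \<bullet> ?z l x \<partial>?Q)"
        by (rule Bochner_Integration.integral_cong[OF refl], rule inner_diff_diff[symmetric])
      finally show ?thesis .
    qed
    have sd: "square_integrable M (\<lambda>\<omega>. ?d k \<omega> - ?d' k \<omega>)" if "k \<in> K" for k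
      by (intro square_integrable_diff[OF sq(1) sq(2)] that)
    have sz: "square_integrable ?Q (?z k)" if "k \<in> K" for k
      by (intro square_integrable_diff[OF sc(1) sc(2)] that)
    have "(\<integral>\<omega>. (norm (N t \<omega> - N s \<omega>))\<^sup>2 \<partial>M)
      = expectation (\<lambda>\<omega>. \<Sum>k\<in>K. \<Sum>l\<in>K. (?d k \<omega> - ?d' k \<omega>) \<bullet> (?d l \<omega> - ?d' l \<omega>))"
      unfolding power2_norm_eq_inner Nd
      by (simp only: inner_sum_left inner_sum_right) (subst sum.swap, rule refl)
    also have "\<dots> = (\<Sum>k\<in>K. \<Sum>l\<in>K. expectation (\<lambda>\<omega>. (?d k \<omega> - ?d' k \<omega>) \<bullet> (?d l \<omega> - ?d' l \<omega>)))"
      using J[OF sd sd]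
      by (subst Bochner_Integration.integral_sum, force intro!: Bochner_Integration.integrable_sum simp del: inner_diff_right inner_diff_left)
        (intro sum.cong refl Bochner_Integration.integral_sum, blast)
    also have "\<dots> = (\<Sum>k\<in>K. \<Sum>l\<in>K. of_bool (k = l) * (\<integral>x. ?z k x \<bullet> ?z l x \<partial>?Q))"
      by (intro sum.cong refl pair)
    also have "\<dots> = (\<Sum>k\<in>K. \<integral>x. ?z k x \<bullet> ?z k x \<partial>?Q)"
    proof (intro sum.cong refl)
      fix k assume "k \<in> K"
      have "(\<Sum>l\<in>K. of_bool (k = l) * (\<integral>x. ?z k x \<bullet> ?z l x \<partial>?Q))
        = (\<Sum>l\<in>K. if k = l then (\<integral>x. ?z k x \<bullet> ?z l x \<partial>?Q) else 0)"
        by (intro sum.cong refl) simp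
      also have "\<dots> = (\<integral>x. ?z k x \<bullet> ?z k x \<partial>?Q)"
        using K_finite \<open>k \<in> K\<close> by (subst sum.delta') simp_all
      finally show "(\<Sum>l\<in>K. of_bool (k = l) * (\<integral>x. ?z k x \<bullet> ?z l x \<partial>?Q)) = (\<integral>x. ?z k x \<bullet> ?z k x \<partial>?Q)" .
    qed
    finally have E: "(\<integral>\<omega>. (norm (N t \<omega> - N s \<omega>))\<^sup>2 \<partial>M) = (\<Sum>k\<in>K. \<integral>x. (norm (?z k x))\<^sup>2 \<partial>?Q)"
      by (simp only: power2_norm_eq_inner)
    have "(\<integral>\<^sup>+\<omega>. ennreal ((norm (N t \<omega> - N s \<omega>))\<^sup>2) \<partial>M) = ennreal (\<Sum>k\<in>K. \<integral>x. (norm (?z k x))\<^sup>2 \<partial>?Q)"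
      using nn_integral_square_integrable[OF square_integrable_diff[OF sqN[OF sT(2)] sqN[OF sT(1)]]] E by simp
    also have "\<dots> = (\<Sum>k\<in>K. ennreal (\<integral>x. (norm (?z k x))\<^sup>2 \<partial>?Q))"
      by (rule sum_ennreal[symmetric]) simp
    also have "\<dots> = (\<Sum>k\<in>K. \<integral>\<^sup>+x. ennreal ((norm (?z k x))\<^sup>2) \<partial>?Q)"
      by (intro sum.cong refl nn_integral_square_integrable[OF sz, symmetric])
    also have "\<dots> = (\<integral>\<^sup>+x. (\<Sum>k\<in>K. ennreal ((norm (?z k x))\<^sup>2)) \<partial>?Q)"
    proof (rule nn_integral_sum[symmetric])
      fix k assume "k \<in> K"
      then have [measurable]: "?z k \<in> borel_measurable ?Q" using sz by (simp add: square_integrable_def)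
      show "(\<lambda>x. ennreal ((norm (?z k x))\<^sup>2)) \<in> borel_measurable ?Q" by measurable
    qed
    also have "\<dots> = (\<integral>\<^sup>+x. (\<Sum>k\<in>K. ennreal ((norm (Z k (fst x) (snd x) - Z' k (fst x) (snd x)))\<^sup>2)) * indicator {s..t} (fst x) \<partial>?Q)"
      by (intro nn_integral_cong) (auto simp: on_interval_def indicator_def split: prod.split)
    finally show "(\<integral>\<^sup>+\<omega>. ennreal ((norm (N t \<omega> - N s \<omega>))\<^sup>2) \<partial>M)
      = (\<integral>\<^sup>+x. (\<Sum>k\<in>K. ennreal ((norm (Z k (fst x) (snd x) - Z' k (fst x) (snd x)))\<^sup>2)) * indicator {s..t} (fst x) \<partial>?Q)" .
  }
qed

end

section \<open>Doob's maximal inequality\<close>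

primrec running_max :: "(nat \<Rightarrow> real) \<Rightarrow> nat \<Rightarrow> real" where
  "running_max a 0 = a 0"
| "running_max a (Suc n) = max (running_max a n) (a (Suc n))"

lemma le_running_max: "k \<le> n \<Longrightarrow> a k \<le> running_max a n"
  by (induction n) (auto simp: le_Suc_eq)

lemma running_max_nonneg: "(\<And>k. 0 \<le> a k) \<Longrightarrow> 0 \<le> running_max a n"
  by (cases n) (auto intro: le_max_iff_disj[THEN iffD2])

text \<open>A pathwise form of Doob's inequality. The sum on the right is a discrete integral of the
running maximum; it has nonnegative mean for a submartingale \<open>a\<close>. By induction
\<open>M\<^sub>n\<^sup>2 \<le> 2 M\<^sub>n a\<^sub>n - 2 \<Sum> M\<^sub>k (a\<^sub>k\<^sub>+\<^sub>1 - a\<^sub>k)\<close>, where \<open>M\<close> is the running maximum, and \<open>2 M\<^sub>n a\<^sub>n \<le> M\<^sub>n\<^sup>2 / 2 + 2 a\<^sub>n\<^sup>2\<close>.\<close>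

lemma pathwise_doob:
  assumes a: "\<And>k. 0 \<le> a k"
  shows "(running_max a n)\<^sup>2 \<le> 4 * (a n)\<^sup>2 - 4 * (\<Sum>k<n. running_max a k * (a (Suc k) - a k))"
proof -
  have "(running_max a n)\<^sup>2 \<le> 2 * (running_max a n * a n) - 2 * (\<Sum>k<n. running_max a k * (a (Suc k) - a k))"
  proof (induction n)
    case 0
    then show ?case by (simp add: power2_eq_square)
  next
    case (Suc n)
    let ?y = "running_max a n" and ?x = "a (Suc n)" and ?S = "\<Sum>k<n. running_max a k * (a (Suc k) - a k)"
    show ?case
    proof (cases "?x \<le> ?y")
      case True
      then have "max ?y ?x = ?y" by simp
      then show ?thesis using Suc by (simp add: algebra_simps)
    next
      case False
      then have m: "max ?y ?x = ?x" by simp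
      have "0 \<le> (?x - ?y)\<^sup>2" by simp
      then show ?thesis using Suc by (simp add: m algebra_simps power2_eq_square)
    qed
  qed
  moreover have "2 * (running_max a n * a n) \<le> (running_max a n)\<^sup>2 / 2 + 2 * (a n)\<^sup>2"
    using sum_squares_bound[of "running_max a n / 2" "a n"] by (simp add: power2_eq_square field_simps)
  ultimately show ?thesis by (simp add: field_simps)
qed

text \<open>The \<open>k\<close>-th of the points that divide \<open>[0, T]\<close> into \<open>m + 1\<close> equal parts, constantly \<open>T\<close> from index
\<open>m + 1\<close> on.\<close>

definition grid :: "real \<Rightarrow> nat \<Rightarrow> nat \<Rightarrow> real" where
  "grid T m k = T * (real (min k (Suc m)) / real (Suc m))"

definition grid_index :: "real \<Rightarrow> nat \<Rightarrow> real \<Rightarrow> nat" where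
  "grid_index T m t = nat \<lfloor>t / T * real (Suc m)\<rfloor>"

lemma grid_in: "0 < T \<Longrightarrow> grid T m k \<in> {0..T}"
proof -
  assume T: "0 < T"
  have "real (min k (Suc m)) / real (Suc m) \<le> 1" by (simp add: min_def)
  then have "T * (real (min k (Suc m)) / real (Suc m)) \<le> T * 1" using T by (intro mult_left_mono) auto
  then show ?thesis using T by (simp add: grid_def)
qed

lemma grid_index_le:
  assumes T: "0 < T" and t: "t \<in> {0..T}"
  shows "real (grid_index T m t) \<le> t / T * real (Suc m)" "t / T * real (Suc m) - 1 \<le> real (grid_index T m t)"
    and "grid_index T m t \<le> Suc m"
proof -
  have kr: "real (grid_index T m t) = of_int \<lfloor>t / T * real (Suc m)\<rfloor>"
    using t T by (simp add: grid_index_def)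
  show k1: "real (grid_index T m t) \<le> t / T * real (Suc m)" "t / T * real (Suc m) - 1 \<le> real (grid_index T m t)"
    unfolding kr by linarith+
  have "t / T * real (Suc m) \<le> 1 * real (Suc m)"
    using t T by (intro mult_right_mono) auto
  then have "real (grid_index T m t) \<le> real (Suc m)" using k1(1) by (metis mult_1 order_trans)
  then show "grid_index T m t \<le> Suc m" by (simp only: of_nat_le_iff)
qed

lemma grid_tendsto:
  assumes T: "0 < T" and t: "t \<in> {0..T}"
  shows "(\<lambda>m. grid T m (grid_index T m t)) \<longlonglongrightarrow> t"
proof (rule tendsto_sandwich)
  let ?k = "\<lambda>m. grid_index T m t"
  note k1 = grid_index_le[OF T t]
  have g: "grid T m (?k m) = T * (real (?k m) / real (Suc m))" for m
    using k1(3)[of m] by (simp add: grid_def min_absorb1)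
  have up: "real (?k m) / real (Suc m) \<le> t / T" for m
    using k1(1)[of m] by (simp add: field_simps del: of_nat_Suc)
  have lo: "t / T - 1 / real (Suc m) \<le> real (?k m) / real (Suc m)" for m
    using divide_right_mono[OF k1(2)[of m], of "real (Suc m)"] by (simp add: diff_divide_distrib del: of_nat_Suc)
  have "grid T m (?k m) \<le> T * (t / T)" for m unfolding g using up T by (intro mult_left_mono) auto
  then show "\<forall>\<^sub>F m in sequentially. grid T m (?k m) \<le> t" using T by simp
  have "T * (t / T - 1 / real (Suc m)) \<le> grid T m (?k m)" for m unfolding g using lo T by (intro mult_left_mono) auto
  then show "\<forall>\<^sub>F m in sequentially. T * (t / T - 1 / real (Suc m)) \<le> grid T m (?k m)" by simp
  have "(\<lambda>m. T * (t / T - 1 / real (Suc m))) \<longlonglongrightarrow> T * (t / T - 0)"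
    using LIMSEQ_inverse_real_of_nat by (intro tendsto_intros) (simp add: inverse_eq_divide)
  then show "(\<lambda>m. T * (t / T - 1 / real (Suc m))) \<longlonglongrightarrow> t" using T by simp
qed auto

text \<open>A continuous square-integrable martingale whose increments have the mean square given by integrating \<open>q\<close>
over time and randomness. The martingale property is stated as orthogonality of increments to square-integrable variables of the past, which is what both Doob's inequality and
the energy identity use.\<close>

locale square_martingale = prob_space M for M :: "'w measure" +
  fixes T :: real and F :: "real \<Rightarrow> 'w measure" and N :: "real \<Rightarrow> 'w \<Rightarrow> 'v::euclidean_space"
    and q :: "real \<times> 'w \<Rightarrow> ennreal"
  assumes T_pos: "0 < T"
    and subalgebra: "\<And>t. subalgebra M (F t)"
    and filtration_mono: "\<And>s t. s \<le> t \<Longrightarrow> sets (F s) \<subseteq> sets (F t)"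
    and adapted: "\<And>t. t \<in> {0..T} \<Longrightarrow> N t \<in> borel_measurable (F t)"
    and square: "\<And>t. t \<in> {0..T} \<Longrightarrow> square_integrable M (N t)"
    and continuous: "AE \<omega> in M. continuous_on {0..T} (\<lambda>t. N t \<omega>)"
    and orthogonal: "\<And>s t H. 0 \<le> s \<Longrightarrow> s \<le> t \<Longrightarrow> t \<le> T \<Longrightarrow> H \<in> borel_measurable (F s) \<Longrightarrow>
      square_integrable M H \<Longrightarrow> expectation (\<lambda>\<omega>. H \<omega> \<bullet> (N t \<omega> - N s \<omega>)) = 0"
    and q_measurable[measurable]: "q \<in> borel_measurable (time_measure T \<Otimes>\<^sub>M M)"
    and isometry: "\<And>s t. 0 \<le> s \<Longrightarrow> s \<le> t \<Longrightarrow> t \<le> T \<Longrightarrow>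
      (\<integral>\<^sup>+\<omega>. ennreal ((norm (N t \<omega> - N s \<omega>))\<^sup>2) \<partial>M)
      = (\<integral>\<^sup>+x. q x * indicator {s..t} (fst x) \<partial>(time_measure T \<Otimes>\<^sub>M M))"
begin

lemma F_mono: "f \<in> borel_measurable (F s) \<Longrightarrow> s \<le> t \<Longrightarrow> f \<in> borel_measurable (F t)"
  by (erule measurable_sub_algebra) (use filtration_mono subalgebra in \<open>auto simp: subalgebra_def\<close>)

lemma F_measurable: "f \<in> borel_measurable (F s) \<Longrightarrow> f \<in> borel_measurable M"
  by (rule measurable_from_subalg[OF subalgebra])

text \<open>The weights in the pathwise inequality are tested against the martingale itself: for \<open>H = M\<^sub>k sgn D\<^sub>k\<close> the
variable \<open>H \<bullet> (D\<^sub>k\<^sub>+\<^sub>1 - D\<^sub>k)\<close> has mean zero and is at most \<open>M\<^sub>k (|D\<^sub>k\<^sub>+\<^sub>1| - |D\<^sub>k|)\<close>.\<close>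

lemma doob_discrete:
  assumes t: "\<And>k. t k \<in> {0..T}" "\<And>k. t k \<le> t (Suc k)"
  defines "a \<equiv> \<lambda>\<omega> k. norm (N (t k) \<omega> - N 0 \<omega>)"
  shows "(\<integral>\<^sup>+\<omega>. ennreal ((running_max (a \<omega>) n)\<^sup>2) \<partial>M) \<le> 4 * (\<integral>\<^sup>+\<omega>. ennreal ((norm (N (t n) \<omega> - N 0 \<omega>))\<^sup>2) \<partial>M)"
proof -
  have T0: "0 \<in> {0..T}" using T_pos by simp
  have N0F: "N 0 \<in> borel_measurable (F s)" if "0 \<le> s" for s
    using F_mono[OF adapted[OF T0] that] .
  define D where "D k \<omega> = N (t k) \<omega> - N 0 \<omega>" for k \<omega>
  have a_def': "a \<omega> k = norm (D k \<omega>)" for \<omega> k by (simp add: a_def D_def)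
  have DF: "D k \<in> borel_measurable (F (t k))" for k
    unfolding D_def using t(1)[of k] by (intro borel_measurable_diff adapted N0F) auto
  have Dsq: "square_integrable M (D k)" for k
    unfolding D_def by (intro square_integrable_diff square t T0)
  have asq: "square_integrable M (\<lambda>\<omega>. a \<omega> k)" for k
    unfolding a_def' by (intro square_integrable_norm Dsq)
  have aF: "(\<lambda>\<omega>. a \<omega> k) \<in> borel_measurable (F (t k))" for k
    unfolding a_def' by (rule measurable_compose[OF DF borel_measurable_norm])
  have rF: "(\<lambda>\<omega>. running_max (a \<omega>) k) \<in> borel_measurable (F (t k))" for k
  proof (induction k)
    case (Suc k)
    show ?case using F_mono[OF Suc t(2)] aF[of "Suc k"] by simp
  qed (use aF in simp)
  have a0: "0 \<le> a \<omega> k" for \<omega> k by (simp add: a_def)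
  note r0 = running_max_nonneg[of "a _", OF a0]
  have rsq: "square_integrable M (\<lambda>\<omega>. running_max (a \<omega>) k)" for k
  proof (induction k)
    case (Suc k)
    show ?case
      by (rule square_integrable_bound[OF square_integrable_add[OF Suc asq[of "Suc k"]]])
        (use F_measurable[OF rF[of "Suc k"]] in \<open>auto simp: max_def r0 a0\<close>)
  qed (use asq in simp)
  define H where "H k \<omega> = running_max (a \<omega>) k *\<^sub>R sgn (D k \<omega>)" for k \<omega>
  have sgnm: "(sgn :: 'v \<Rightarrow> 'v) \<in> borel_measurable borel"
    unfolding sgn_div_norm[abs_def] by measurable
  have HF: "H k \<in> borel_measurable (F (t k))" for k
    unfolding H_def by (intro borel_measurable_scaleR rF measurable_compose[OF DF sgnm])
  have Hsq: "square_integrable M (H k)" for k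
    by (rule square_integrable_bound[OF rsq[of k]])
      (use F_measurable[OF HF] r0 in \<open>auto simp: H_def norm_sgn\<close>)
  have I: "integrable M (\<lambda>\<omega>. running_max (a \<omega>) k * (a \<omega> (Suc k) - a \<omega> k))" for k
    using square_integrable_inner(1)[OF rsq square_integrable_diff[OF asq asq]] by simp
  have pos: "0 \<le> expectation (\<lambda>\<omega>. running_max (a \<omega>) k * (a \<omega> (Suc k) - a \<omega> k))" for k
  proof -
    have "0 = expectation (\<lambda>\<omega>. H k \<omega> \<bullet> (N (t (Suc k)) \<omega> - N (t k) \<omega>))"
      using t(1)[of k] t(1)[of "Suc k"] t(2)[of k] by (intro orthogonal[symmetric] HF Hsq) auto
    also have "\<dots> \<le> expectation (\<lambda>\<omega>. running_max (a \<omega>) k * (a \<omega> (Suc k) - a \<omega> k))"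
    proof (rule integral_mono[OF _ I])
      show "integrable M (\<lambda>\<omega>. H k \<omega> \<bullet> (N (t (Suc k)) \<omega> - N (t k) \<omega>))"
        by (intro square_integrable_inner Hsq square_integrable_diff square t)
      fix \<omega>
      have "sgn (D k \<omega>) \<bullet> D (Suc k) \<omega> \<le> norm (sgn (D k \<omega>)) * norm (D (Suc k) \<omega>)" by (rule norm_cauchy_schwarz)
      also have "\<dots> \<le> 1 * norm (D (Suc k) \<omega>)" by (intro mult_right_mono) (auto simp: norm_sgn)
      finally have 1: "sgn (D k \<omega>) \<bullet> D (Suc k) \<omega> \<le> a \<omega> (Suc k)" by (simp add: a_def')
      have 2: "sgn (D k \<omega>) \<bullet> D k \<omega> = a \<omega> k"
        by (cases "D k \<omega> = 0") (simp_all add: a_def' sgn_div_norm dot_square_norm power2_eq_square)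
      have "H k \<omega> \<bullet> (N (t (Suc k)) \<omega> - N (t k) \<omega>) = running_max (a \<omega>) k * (sgn (D k \<omega>) \<bullet> D (Suc k) \<omega> - sgn (D k \<omega>) \<bullet> D k \<omega>)"
        by (simp add: H_def D_def inner_diff_right[symmetric] del: inner_diff_right)
      also have "\<dots> \<le> running_max (a \<omega>) k * (a \<omega> (Suc k) - a \<omega> k)"
        using 1 2 r0[of \<omega> k] by (intro mult_left_mono) auto
      finally show "H k \<omega> \<bullet> (N (t (Suc k)) \<omega> - N (t k) \<omega>) \<le> running_max (a \<omega>) k * (a \<omega> (Suc k) - a \<omega> k)" .
    qed
    finally show ?thesis .
  qed
  have i2: "integrable M (\<lambda>\<omega>. (a \<omega> n)\<^sup>2)" using asq[of n] by (simp add: square_integrable_def)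
  have "expectation (\<lambda>\<omega>. (running_max (a \<omega>) n)\<^sup>2)
    \<le> expectation (\<lambda>\<omega>. 4 * (a \<omega> n)\<^sup>2 - 4 * (\<Sum>k<n. running_max (a \<omega>) k * (a \<omega> (Suc k) - a \<omega> k)))"
  proof (rule integral_mono)
    show "integrable M (\<lambda>\<omega>. (running_max (a \<omega>) n)\<^sup>2)" using rsq[of n] by (simp add: square_integrable_def)
    show "integrable M (\<lambda>\<omega>. 4 * (a \<omega> n)\<^sup>2 - 4 * (\<Sum>k<n. running_max (a \<omega>) k * (a \<omega> (Suc k) - a \<omega> k)))"
      by (intro Bochner_Integration.integrable_diff integrable_mult_right Bochner_Integration.integrable_sum I i2)
  qed (rule pathwise_doob[OF a0])
  also have "\<dots> = 4 * expectation (\<lambda>\<omega>. (a \<omega> n)\<^sup>2)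
      - 4 * (\<Sum>k<n. expectation (\<lambda>\<omega>. running_max (a \<omega>) k * (a \<omega> (Suc k) - a \<omega> k)))"
    using I i2 by (simp add: Bochner_Integration.integral_sum)
  also have "\<dots> \<le> 4 * expectation (\<lambda>\<omega>. (a \<omega> n)\<^sup>2)"
    using sum_nonneg[of "{..<n}", OF pos] by simp
  finally have "ennreal (expectation (\<lambda>\<omega>. (running_max (a \<omega>) n)\<^sup>2)) \<le> ennreal (4 * expectation (\<lambda>\<omega>. (a \<omega> n)\<^sup>2))"
    by (rule ennreal_leI)
  also have "\<dots> = 4 * ennreal (expectation (\<lambda>\<omega>. (a \<omega> n)\<^sup>2))"
    by (simp add: ennreal_mult')
  finally show ?thesis
    using nn_integral_square_integrable[OF rsq[of n]] nn_integral_square_integrable[OF asq[of n]]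
    by (simp add: a_def)
qed

text \<open>The supremum over all times is dominated by the lower limit of the maxima over finer and finer grids, by
continuity; Fatou's lemma controls the mean of this lower limit. The uncountable supremum itself is not claimed to be
measurable, and so a measurable majorant is produced.\<close>

lemma doob_maximal:
  obtains S where "S \<in> borel_measurable M"
    and "AE \<omega> in M. \<forall>t\<in>{0..T}. ennreal ((norm (N t \<omega> - N 0 \<omega>))\<^sup>2) \<le> S \<omega>"
    and "(\<integral>\<^sup>+\<omega>. S \<omega> \<partial>M) \<le> 4 * (\<integral>\<^sup>+\<omega>. ennreal ((norm (N T \<omega> - N 0 \<omega>))\<^sup>2) \<partial>M)"
proof -
  have \<tau>mono: "grid T m k \<le> grid T m (Suc k)" for m k
    unfolding grid_def using T_pos by (intro mult_left_mono divide_right_mono) auto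
  note \<tau>T = grid_in[OF T_pos]
  define R where "R m \<omega> = running_max (\<lambda>k. norm (N (grid T m k) \<omega> - N 0 \<omega>)) (Suc m)" for m \<omega>
  have Nm: "N t \<in> borel_measurable M" if "t \<in> {0..T}" for t
    using square[OF that] by (simp add: square_integrable_def)
  have N0: "N 0 \<in> borel_measurable M" using T_pos by (intro Nm) auto
  have rm: "(\<lambda>\<omega>. running_max (\<lambda>k. norm (N (grid T m k) \<omega> - N 0 \<omega>)) n) \<in> borel_measurable M" for m n
  proof -
    have "(\<lambda>\<omega>. norm (N (grid T m k) \<omega> - N 0 \<omega>)) \<in> borel_measurable M" for k
      by (rule measurable_compose[OF borel_measurable_diff[OF Nm[OF \<tau>T] N0] borel_measurable_norm])
    then show ?thesis by (induction n) (simp_all add: borel_measurable_max)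
  qed
  have [measurable]: "R m \<in> borel_measurable M" for m unfolding R_def by (rule rm)
  define S where "S \<omega> = liminf (\<lambda>m. ennreal ((R m \<omega>)\<^sup>2))" for \<omega>
  have 1: "S \<in> borel_measurable M" unfolding S_def by measurable
  have E: "(\<integral>\<^sup>+\<omega>. ennreal ((R m \<omega>)\<^sup>2) \<partial>M) \<le> 4 * (\<integral>\<^sup>+\<omega>. ennreal ((norm (N T \<omega> - N 0 \<omega>))\<^sup>2) \<partial>M)" for m
  proof -
    have "grid T m (Suc m) = T" by (simp add: grid_def del: of_nat_Suc)
    then show ?thesis using doob_discrete[of "grid T m", OF \<tau>T \<tau>mono, of "Suc m"] by (simp add: R_def del: running_max.simps)
  qed
  have "(\<integral>\<^sup>+\<omega>. S \<omega> \<partial>M) \<le> liminf (\<lambda>m. \<integral>\<^sup>+\<omega>. ennreal ((R m \<omega>)\<^sup>2) \<partial>M)"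
    unfolding S_def by (rule nn_integral_liminf) measurable
  also have "\<dots> \<le> liminf (\<lambda>m::nat. 4 * (\<integral>\<^sup>+\<omega>. ennreal ((norm (N T \<omega> - N 0 \<omega>))\<^sup>2) \<partial>M))"
    by (rule Liminf_mono) (auto intro!: always_eventually E)
  also have "\<dots> = 4 * (\<integral>\<^sup>+\<omega>. ennreal ((norm (N T \<omega> - N 0 \<omega>))\<^sup>2) \<partial>M)"
    by (rule Liminf_const) simp
  finally have 3: "(\<integral>\<^sup>+\<omega>. S \<omega> \<partial>M) \<le> 4 * (\<integral>\<^sup>+\<omega>. ennreal ((norm (N T \<omega> - N 0 \<omega>))\<^sup>2) \<partial>M)" .
  have 2: "AE \<omega> in M. \<forall>t\<in>{0..T}. ennreal ((norm (N t \<omega> - N 0 \<omega>))\<^sup>2) \<le> S \<omega>"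
    using continuous
  proof eventually_elim
    case (elim \<omega>)
    show ?case
    proof
      fix t assume t: "t \<in> {0..T}"
      define k where "k m = grid_index T m t" for m
      have kle: "k m \<le> Suc m" for m unfolding k_def by (rule grid_index_le(3)[OF T_pos t])
      have lim: "(\<lambda>m. grid T m (k m)) \<longlonglongrightarrow> t" unfolding k_def by (rule grid_tendsto[OF T_pos t])
      have "(\<lambda>m. N (grid T m (k m)) \<omega>) \<longlonglongrightarrow> N t \<omega>"
        by (rule continuous_on_tendsto_compose[OF elim lim t]) (use \<tau>T in auto)
      then have "(\<lambda>m. ennreal ((norm (N (grid T m (k m)) \<omega> - N 0 \<omega>))\<^sup>2)) \<longlonglongrightarrow> ennreal ((norm (N t \<omega> - N 0 \<omega>))\<^sup>2)"
        by (intro tendsto_ennrealI tendsto_intros)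
      then have "ennreal ((norm (N t \<omega> - N 0 \<omega>))\<^sup>2) = liminf (\<lambda>m. ennreal ((norm (N (grid T m (k m)) \<omega> - N 0 \<omega>))\<^sup>2))"
        by (intro lim_imp_Liminf[symmetric]) auto
      also have "\<dots> \<le> S \<omega>"
        unfolding S_def
      proof (rule Liminf_mono, rule always_eventually, rule allI)
        fix m
        have "norm (N (grid T m (k m)) \<omega> - N 0 \<omega>) \<le> R m \<omega>"
          unfolding R_def by (rule le_running_max[where a="\<lambda>k. norm (N (grid T m k) \<omega> - N 0 \<omega>)", OF kle])
        then show "ennreal ((norm (N (grid T m (k m)) \<omega> - N 0 \<omega>))\<^sup>2) \<le> ennreal ((R m \<omega>)\<^sup>2)"
          by (intro ennreal_leI power_mono) auto
      qed
      finally show "ennreal ((norm (N t \<omega> - N 0 \<omega>))\<^sup>2) \<le> S \<omega>" .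
    qed
  qed
  from 1 2 3 show ?thesis by (rule that)
qed

end

lemma norm_set_integral_square_le:
  fixes G :: "real \<Rightarrow> 'v::euclidean_space"
  assumes G: "set_integrable lborel {s..t} G" and st: "s \<le> t"
  shows "ennreal ((norm (LINT u:{s..t}|lborel. G u))\<^sup>2)
    \<le> ennreal (t - s) * (\<integral>\<^sup>+u\<in>{s..t}. ennreal ((norm (G u))\<^sup>2) \<partial>lborel)"
proof -
  let ?g = "\<lambda>u. indicator {s..t} u *\<^sub>R G u"
  have gi: "integrable lborel ?g" using G by (simp add: set_integrable_def)
  then have [measurable]: "?g \<in> borel_measurable lborel" by auto
  have "ennreal (norm (LINT u:{s..t}|lborel. G u)) \<le> (\<integral>\<^sup>+u. ennreal (norm (?g u)) \<partial>lborel)"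
    unfolding set_lebesgue_integral_def by (rule integral_norm_bound_ennreal[OF gi])
  also have "\<dots> = (\<integral>\<^sup>+u. ennreal (norm (?g u)) * indicator {s..t} u \<partial>lborel)"
    by (intro nn_integral_cong) (simp add: indicator_def)
  finally have "(ennreal (norm (LINT u:{s..t}|lborel. G u)))\<^sup>2
      \<le> (\<integral>\<^sup>+u. ennreal (norm (?g u)) * indicator {s..t} u \<partial>lborel)\<^sup>2"
    by (rule power_mono) simp
  also have "\<dots> \<le> (\<integral>\<^sup>+u. (ennreal (norm (?g u)))\<^sup>2 \<partial>lborel) * (\<integral>\<^sup>+u. (indicator {s..t} u)\<^sup>2 \<partial>(lborel :: real measure))"
    by (rule Cauchy_Schwarz_nn_integral) measurable
  also have "(\<integral>\<^sup>+u. (indicator {s..t} u)\<^sup>2 \<partial>(lborel :: real measure)) = (\<integral>\<^sup>+u. indicator {s..t} u \<partial>(lborel :: real measure))"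
    by (intro nn_integral_cong) (simp add: indicator_def)
  also have "\<dots> = ennreal (t - s)" using st by simp
  also have "(\<integral>\<^sup>+u. (ennreal (norm (?g u)))\<^sup>2 \<partial>lborel) = (\<integral>\<^sup>+u\<in>{s..t}. ennreal ((norm (G u))\<^sup>2) \<partial>lborel)"
    by (intro nn_integral_cong) (simp add: indicator_def ennreal_power)
  finally show ?thesis by (simp add: ennreal_power mult.commute)
qed

section \<open>A priori estimate for the difference of two backward equations\<close>

text \<open>The quantities on the left also occur on the right with factor one quarter each; they can be absorbed because
they are finite.\<close>

lemma ennreal_absorb:
  fixes x y a h :: ennreal
  assumes x: "x \<le> 2 * a + (x + y + h) / 4" and y: "y \<le> 2 * a + (x + y + h) / 4"
    and fin: "x < \<infinity>" "y < \<infinity>"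
  shows "x + y \<le> 8 * a + h"
proof (cases "a = \<infinity> \<or> h = \<infinity>")
  case True
  then show ?thesis by (auto simp: ennreal_mult_eq_top_iff)
next
  case False
  then obtain a' h' x' y' where e: "a = ennreal a'" "h = ennreal h'" "x = ennreal x'" "y = ennreal y'"
    and nn: "0 \<le> a'" "0 \<le> h'" "0 \<le> x'" "0 \<le> y'"
    using fin by (metis ennreal_cases infinity_ennreal_def less_irrefl)
  have conv: "2 * a + (x + y + h) / 4 = ennreal (2 * a' + (x' + y' + h') / 4)"
  proof -
    have "(x + y + h) / 4 = ennreal ((x' + y' + h') / 4)"
      using nn by (simp add: e divide_ennreal flip: ennreal_plus ennreal_numeral)
    then show ?thesis using nn by (simp add: e ennreal_mult ennreal_plus)
  qed
  have p: "0 \<le> 2 * a' + (x' + y' + h') / 4" using nn by simp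
  have x': "x' \<le> 2 * a' + (x' + y' + h') / 4"
    using x[unfolded conv] unfolding e(3) by (rule ennreal_le_iff[OF p, THEN iffD1])
  have y': "y' \<le> 2 * a' + (x' + y' + h') / 4"
    using y[unfolded conv] unfolding e(4) by (rule ennreal_le_iff[OF p, THEN iffD1])
  have "4 * x' \<le> 8 * a' + x' + y' + h'" "4 * y' \<le> 8 * a' + x' + y' + h'"
    using x' y' by (simp_all add: field_simps)
  then have "x' + y' \<le> 8 * a' + h'" by linarith
  then have "ennreal (x' + y') \<le> ennreal (8 * a' + h')" by (rule ennreal_leI)
  then show ?thesis using nn by (simp add: e ennreal_mult)
qed

text \<open>The length \<open>\<delta> = T / step_count T \<kappa>\<close> satisfies \<open>\<delta> \<le> 1\<close> and \<open>8 \<kappa> \<delta> \<le> 1\<close>, which is what the absorption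
argument on one interval requires.\<close>

definition step_count :: "real \<Rightarrow> real \<Rightarrow> nat" where
  "step_count T \<kappa> = nat \<lceil>T + 8 * T * \<kappa>\<rceil> + 1"

text \<open>It depends on the horizon and on the growth constant only, hence neither on the number of particles nor on
the particle.\<close>

definition a_priori_const :: "real \<Rightarrow> real \<Rightarrow> real" where
  "a_priori_const T \<kappa> = (let n = step_count T \<kappa> in
     2 * T * \<kappa> * (T * 9 ^ n + real n * 9 ^ n + 1) + 33 * (real n * 9 ^ n))"

lemma a_priori_const_pos: "0 < T \<Longrightarrow> 0 < \<kappa> \<Longrightarrow> 0 < a_priori_const T \<kappa>"
  unfolding a_priori_const_def Let_def step_count_def
  by (intro add_pos_pos mult_pos_pos) (auto intro!: add_nonneg_pos)

text \<open>The difference \<open>D\<close> of two backward equations with the same terminal value, drift difference \<open>G\<close> and martingale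
part \<open>N\<close>. The drift grows at most linearly in \<open>D\<close> and in the integrands of \<open>N\<close> (through \<open>q\<close>), up to a source
term \<open>h\<close>. The aim is to bound \<open>D\<close> and \<open>q\<close> by \<open>h\<close>.\<close>

locale bsde_difference = square_martingale M T F N q
  for M :: "'w measure" and T F and N :: "real \<Rightarrow> 'w \<Rightarrow> 'v::euclidean_space" and q +
  fixes D G :: "real \<Rightarrow> 'w \<Rightarrow> 'v" and h :: "real \<times> 'w \<Rightarrow> ennreal" and \<kappa> :: real
  assumes \<kappa>_pos: "0 < \<kappa>"
    and D_adapted: "\<And>t. t \<in> {0..T} \<Longrightarrow> D t \<in> borel_measurable (F t)"
    and D_jointly: "jointly_measurable M T D"
    and G_jointly: "jointly_measurable M T G"
    and h_measurable[measurable]: "h \<in> borel_measurable (time_measure T \<Otimes>\<^sub>M M)"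
    and D_bounded: "\<exists>c<\<infinity>. \<forall>t\<in>{0..T}. (\<integral>\<^sup>+\<omega>. ennreal ((norm (D t \<omega>))\<^sup>2) \<partial>M) \<le> c"
    and q_finite: "(\<integral>\<^sup>+x. q x \<partial>(time_measure T \<Otimes>\<^sub>M M)) < \<infinity>"
    and growth: "\<And>u \<omega>. u \<in> {0..T} \<Longrightarrow> \<omega> \<in> space M \<Longrightarrow>
      ennreal ((norm (G u \<omega>))\<^sup>2) \<le> ennreal \<kappa> * (ennreal ((norm (D u \<omega>))\<^sup>2) + q (u, \<omega>) + h (u, \<omega>))"
    and equation: "AE \<omega> in M. set_integrable lborel {0..T} (\<lambda>s. G s \<omega>) \<and>
      (\<forall>t\<in>{0..T}. D t \<omega> = (LINT s:{t..T}|lborel. G s \<omega>) - (N T \<omega> - N t \<omega>))"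
begin

abbreviation "Q \<equiv> time_measure T \<Otimes>\<^sub>M M"

definition mean_sq :: "real \<Rightarrow> ennreal" where
  "mean_sq t = (\<integral>\<^sup>+\<omega>. ennreal ((norm (D t \<omega>))\<^sup>2) \<partial>M)"

definition energy :: "(real \<times> 'w \<Rightarrow> ennreal) \<Rightarrow> real \<Rightarrow> real \<Rightarrow> ennreal" where
  "energy g s t = (\<integral>\<^sup>+x. g x * indicator {s..t} (fst x) \<partial>Q)"

abbreviation "total_h \<equiv> \<integral>\<^sup>+x. h x \<partial>Q"
abbreviation "D_sq \<equiv> \<lambda>x. ennreal ((norm (D (fst x) (snd x)))\<^sup>2)"
abbreviation "G_sq \<equiv> \<lambda>x. ennreal ((norm (G (fst x) (snd x)))\<^sup>2)"

lemma D_pair[measurable]: "(\<lambda>x. D (fst x) (snd x)) \<in> borel_measurable Q"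
  using D_jointly by (simp add: jointly_measurable_def case_prod_beta')

lemma G_pair[measurable]: "(\<lambda>x. G (fst x) (snd x)) \<in> borel_measurable Q"
  using G_jointly by (simp add: jointly_measurable_def case_prod_beta')

lemma indicator_fst[measurable]: "(\<lambda>x. indicator {s..t} (fst x) :: ennreal) \<in> borel_measurable Q"
  by (rule measurable_compose[OF measurable_fst], rule measurable_time_measure) simp

lemma energy_omega:
  assumes [measurable]: "g \<in> borel_measurable Q" and st: "0 \<le> s" "t \<le> T"
  shows "energy g s t = (\<integral>\<^sup>+\<omega>. (\<integral>\<^sup>+u\<in>{s..t}. g (u, \<omega>) \<partial>lborel) \<partial>M)"
    and "energy g s t = (\<integral>\<^sup>+u\<in>{s..t}. (\<integral>\<^sup>+\<omega>. g (u, \<omega>) \<partial>M) \<partial>lborel)"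
proof -
  have m: "(\<lambda>x. g x * indicator {s..t} (fst x)) \<in> borel_measurable Q" by measurable
  have "energy g s t = (\<integral>\<^sup>+\<omega>. (\<integral>\<^sup>+u\<in>{0..T}. g (u, \<omega>) * indicator {s..t} u \<partial>lborel) \<partial>M)"
    unfolding energy_def nn_integral_time_pair(1)[OF m] by simp
  also have "\<dots> = (\<integral>\<^sup>+\<omega>. (\<integral>\<^sup>+u\<in>{s..t}. g (u, \<omega>) \<partial>lborel) \<partial>M)"
    using st by (intro nn_integral_cong) (auto simp: indicator_def)
  finally show "energy g s t = (\<integral>\<^sup>+\<omega>. (\<integral>\<^sup>+u\<in>{s..t}. g (u, \<omega>) \<partial>lborel) \<partial>M)" .
  have "energy g s t = (\<integral>\<^sup>+u\<in>{0..T}. (\<integral>\<^sup>+\<omega>. g (u, \<omega>) * indicator {s..t} u \<partial>M) \<partial>lborel)"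
    unfolding energy_def nn_integral_time_pair(2)[OF m] by simp
  also have "\<dots> = (\<integral>\<^sup>+u\<in>{s..t}. (\<integral>\<^sup>+\<omega>. g (u, \<omega>) \<partial>M) \<partial>lborel)"
    using st by (intro nn_integral_cong) (auto simp: indicator_def)
  finally show "energy g s t = (\<integral>\<^sup>+u\<in>{s..t}. (\<integral>\<^sup>+\<omega>. g (u, \<omega>) \<partial>M) \<partial>lborel)" .
qed

lemma time_section_measurable:
  assumes g: "g \<in> borel_measurable Q" and st: "0 \<le> s" "t \<le> T"
  shows "(\<lambda>\<omega>. \<integral>\<^sup>+u\<in>{s..t}. g (u, \<omega>) \<partial>lborel) \<in> borel_measurable M"
proof -
  have "(\<lambda>x. g x * indicator {s..t} (fst x)) \<in> borel_measurable Q"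
    by (intro borel_measurable_times_ennreal g indicator_fst)
  from measurable_compose[OF measurable_pair_swap' this]
  have "(\<lambda>(\<omega>, u). g (u, \<omega>) * indicator {s..t} u) \<in> borel_measurable (M \<Otimes>\<^sub>M time_measure T)"
    by (simp add: case_prod_beta')
  then have "(\<lambda>\<omega>. \<integral>\<^sup>+u. g (u, \<omega>) * indicator {s..t} u \<partial>time_measure T) \<in> borel_measurable M"
    by (intro sigma_finite_measure.borel_measurable_nn_integral finite_measure.sigma_finite_measure[OF finite_measure_time_measure])
  also have "(\<lambda>\<omega>. \<integral>\<^sup>+u. g (u, \<omega>) * indicator {s..t} u \<partial>time_measure T) = (\<lambda>\<omega>. \<integral>\<^sup>+u\<in>{s..t}. g (u, \<omega>) \<partial>lborel)"
    unfolding nn_integral_time_measure using st by (intro ext nn_integral_cong) (auto simp: indicator_def)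
  finally show ?thesis .
qed

lemma energy_le: "energy g s t \<le> (\<integral>\<^sup>+x. g x \<partial>Q)"
  unfolding energy_def by (rule nn_integral_mono) (simp add: indicator_def)

lemma energy_mono: "s' \<le> s \<Longrightarrow> t \<le> t' \<Longrightarrow> energy g s t \<le> energy g s' t'"
  unfolding energy_def by (rule nn_integral_mono) (simp add: indicator_def)

lemma energy_split:
  assumes [measurable]: "g \<in> borel_measurable Q"
  shows "energy g r t \<le> energy g r s + energy g s t"
proof -
  have "energy g r t \<le> (\<integral>\<^sup>+x. g x * indicator {r..s} (fst x) + g x * indicator {s..t} (fst x) \<partial>Q)"
    unfolding energy_def by (rule nn_integral_mono) (auto simp: indicator_def)
  also have "\<dots> = energy g r s + energy g s t"
    unfolding energy_def by (rule nn_integral_add) measurable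
  finally show ?thesis .
qed

lemma energy_D_sq_le:
  assumes st: "0 \<le> s" "s \<le> t" "t \<le> T" and c: "\<And>r. r \<in> {s..t} \<Longrightarrow> mean_sq r \<le> c"
  shows "energy D_sq s t \<le> ennreal (t - s) * c"
proof -
  have "energy D_sq s t = (\<integral>\<^sup>+u\<in>{s..t}. mean_sq u \<partial>lborel)"
    using st by (subst energy_omega(2)) (auto simp: mean_sq_def)
  also have "\<dots> \<le> (\<integral>\<^sup>+u. c * indicator {s..t} u \<partial>lborel)"
    using c by (intro nn_integral_mono) (auto simp: indicator_def)
  also have "\<dots> = ennreal (t - s) * c" using st by (simp add: nn_integral_cmult_indicator mult.commute)
  finally show ?thesis .
qed

lemma energy_G_sq_le:
  assumes st: "0 \<le> s" "s \<le> t" "t \<le> T"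
  shows "energy G_sq s t \<le> ennreal \<kappa> * (energy D_sq s t + energy q s t + total_h)"
proof -
  have "energy G_sq s t \<le> (\<integral>\<^sup>+x. ennreal \<kappa> * (D_sq x * indicator {s..t} (fst x) + q x * indicator {s..t} (fst x) + h x) \<partial>Q)"
    unfolding energy_def
  proof (rule nn_integral_mono)
    fix x assume "x \<in> space Q"
    then have x: "fst x \<in> {0..T}" "snd x \<in> space M" by (auto simp: space_pair_measure)
    show "G_sq x * indicator {s..t} (fst x) \<le> ennreal \<kappa> * (D_sq x * indicator {s..t} (fst x) + q x * indicator {s..t} (fst x) + h x)"
      using growth[OF x] by (auto simp: indicator_def)
  qed
  also have "\<dots> = ennreal \<kappa> * (energy D_sq s t + energy q s t + total_h)"
    unfolding energy_def
    by (subst nn_integral_cmult, measurable) (subst nn_integral_add, measurable, subst nn_integral_add, measurable)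
  finally show ?thesis .
qed

lemma D_square: "t \<in> {0..T} \<Longrightarrow> square_integrable M (D t)"
proof -
  assume t: "t \<in> {0..T}"
  obtain c where "c < \<infinity>" "mean_sq t \<le> c" using D_bounded t by (auto simp: mean_sq_def)
  then have "mean_sq t < \<infinity>" by (rule le_less_trans[rotated])
  then show ?thesis
    unfolding mean_sq_def using F_measurable[OF D_adapted[OF t]]
    by (subst square_integrable_iff_nn_integral) auto
qed

lemma equation_between:
  "AE \<omega> in M. set_integrable lborel {0..T} (\<lambda>u. G u \<omega>) \<and>
    (\<forall>s t. 0 \<le> s \<longrightarrow> s \<le> t \<longrightarrow> t \<le> T \<longrightarrow> D s \<omega> + (N t \<omega> - N s \<omega>) = D t \<omega> + (LINT u:{s..t}|lborel. G u \<omega>))"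
  using equation
proof eventually_elim
  case (elim \<omega>)
  have "D s \<omega> + (N t \<omega> - N s \<omega>) = D t \<omega> + (LINT u:{s..t}|lborel. G u \<omega>)" if st: "0 \<le> s" "s \<le> t" "t \<le> T" for s t
  proof -
    have sub: "set_integrable lborel {a..b} (\<lambda>u. G u \<omega>)" if "0 \<le> a" "b \<le> T" for a b
      by (rule set_integrable_subset[OF conjunct1[OF elim]]) (use that in auto)
    have sub': "set_integrable lborel {a<..b} (\<lambda>u. G u \<omega>)" if "0 \<le> a" "b \<le> T" for a b
      by (rule set_integrable_subset[OF conjunct1[OF elim]]) (use that in auto)
    have "(LINT u:{s..T}|lborel. G u \<omega>) = (LINT u:{s..t} \<union> {t<..T}|lborel. G u \<omega>)"
      using st by (intro arg_cong2[where f="\<lambda>A f. set_lebesgue_integral lborel A f"] ivl_disj_un_two(4)[symmetric] refl) auto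
    also have "\<dots> = (LINT u:{s..t}|lborel. G u \<omega>) + (LINT u:{t<..T}|lborel. G u \<omega>)"
      by (rule set_integral_Un) (use st in \<open>auto intro!: set_integrable_subset[OF conjunct1[OF elim]]\<close>)
    also have "(LINT u:{t<..T}|lborel. G u \<omega>) = (LINT u:{t..T}|lborel. G u \<omega>)"
    proof (rule set_integral_cong_set)
      show "set_borel_measurable lborel {t<..T} (\<lambda>u. G u \<omega>)" "set_borel_measurable lborel {t..T} (\<lambda>u. G u \<omega>)"
        using sub'[of t T] sub[of t T] st
        unfolding set_integrable_def set_borel_measurable_def by (auto dest: borel_measurable_integrable)
      have "AE u in (lborel :: real measure). u \<noteq> t" by (rule AE_lborel_singleton)
      then show "AE u in lborel. (u \<in> {t..T}) = (u \<in> {t<..T})" by eventually_elim auto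
    qed
    finally have "(LINT u:{s..T}|lborel. G u \<omega>) = (LINT u:{s..t}|lborel. G u \<omega>) + (LINT u:{t..T}|lborel. G u \<omega>)" .
    moreover have "D s \<omega> = (LINT u:{s..T}|lborel. G u \<omega>) - (N T \<omega> - N s \<omega>)" "D t \<omega> = (LINT u:{t..T}|lborel. G u \<omega>) - (N T \<omega> - N t \<omega>)"
      using elim st by auto
    ultimately show ?thesis by simp
  qed
  then show ?case using elim by blast
qed

lemma mean_sq_T: "mean_sq T = 0"
proof -
  have "AE \<omega> in M. D T \<omega> = 0"
    using equation
  proof eventually_elim
    case (elim \<omega>)
    have "AE u in (lborel :: real measure). u \<noteq> T" by (rule AE_lborel_singleton)
    then have "AE u in lborel. indicator {T..T} u *\<^sub>R G u \<omega> = 0" by eventually_elim auto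
    then have "(LINT u:{T..T}|lborel. G u \<omega>) = 0"
      unfolding set_lebesgue_integral_def by (rule integral_eq_zero_AE)
    then show ?case using elim T_pos by simp
  qed
  then have "AE \<omega> in M. ennreal ((norm (D T \<omega>))\<^sup>2) = 0" by eventually_elim simp
  then have "mean_sq T = (\<integral>\<^sup>+\<omega>. 0 \<partial>M)"
    unfolding mean_sq_def by (rule nn_integral_cong_AE)
  then show ?thesis by simp
qed

text \<open>\<open>D\<^sub>s\<close> is orthogonal to \<open>N\<^sub>t - N\<^sub>s\<close>, so the left-hand side is the second moment of
\<open>D\<^sub>s + (N\<^sub>t - N\<^sub>s) = D\<^sub>t + \<integral>\<^sub>s\<^sup>t G\<close>. This identity replaces Ito's formula for \<open>|D|\<^sup>2\<close>; the price is the factor 2 in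
front of \<open>mean_sq t\<close>, which is harmless as long as the number of steps is fixed.\<close>

lemma energy_step:
  assumes st: "0 \<le> s" "s \<le> t" "t \<le> T"
  shows "mean_sq s + energy q s t \<le> 2 * mean_sq t + ennreal (2 * (t - s)) * energy G_sq s t"
proof -
  have sT: "s \<in> {0..T}" "t \<in> {0..T}" using st by auto
  have sqN: "square_integrable M (\<lambda>\<omega>. N t \<omega> - N s \<omega>)" by (intro square_integrable_diff square sT)
  note sqD = D_square[OF sT(1)]
  have "expectation (\<lambda>\<omega>. (norm (D s \<omega> + (N t \<omega> - N s \<omega>)))\<^sup>2)
    = expectation (\<lambda>\<omega>. (norm (D s \<omega>))\<^sup>2 + 2 * (D s \<omega> \<bullet> (N t \<omega> - N s \<omega>)) + (norm (N t \<omega> - N s \<omega>))\<^sup>2)"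
    by (intro Bochner_Integration.integral_cong refl) (simp only: power2_norm_eq_inner inner_add_left inner_add_right inner_commute mult_2 add.assoc)
  also have "\<dots> = expectation (\<lambda>\<omega>. (norm (D s \<omega>))\<^sup>2) + 2 * expectation (\<lambda>\<omega>. D s \<omega> \<bullet> (N t \<omega> - N s \<omega>)) + expectation (\<lambda>\<omega>. (norm (N t \<omega> - N s \<omega>))\<^sup>2)"
    using sqD sqN square_integrable_inner(1)[OF sqD sqN]
    by (simp add: square_integrable_def)
  also have "expectation (\<lambda>\<omega>. D s \<omega> \<bullet> (N t \<omega> - N s \<omega>)) = 0"
    by (rule orthogonal[OF st D_adapted[OF sT(1)] sqD])
  finally have "expectation (\<lambda>\<omega>. (norm (D s \<omega> + (N t \<omega> - N s \<omega>)))\<^sup>2)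
    = expectation (\<lambda>\<omega>. (norm (D s \<omega>))\<^sup>2) + expectation (\<lambda>\<omega>. (norm (N t \<omega> - N s \<omega>))\<^sup>2)" by simp
  then have "(\<integral>\<^sup>+\<omega>. ennreal ((norm (D s \<omega> + (N t \<omega> - N s \<omega>)))\<^sup>2) \<partial>M) = mean_sq s + energy q s t"
    unfolding mean_sq_def energy_def isometry[OF st, symmetric]
    using nn_integral_square_integrable[OF square_integrable_add[OF sqD sqN]]
      nn_integral_square_integrable[OF sqD] nn_integral_square_integrable[OF sqN] by simp
  then have "mean_sq s + energy q s t = (\<integral>\<^sup>+\<omega>. ennreal ((norm (D s \<omega> + (N t \<omega> - N s \<omega>)))\<^sup>2) \<partial>M)" ..
  also have "\<dots> \<le> (\<integral>\<^sup>+\<omega>. 2 * ennreal ((norm (D t \<omega>))\<^sup>2) + ennreal (2 * (t - s)) * (\<integral>\<^sup>+u\<in>{s..t}. ennreal ((norm (G u \<omega>))\<^sup>2) \<partial>lborel) \<partial>M)"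
  proof (rule nn_integral_mono_AE, use equation_between in eventually_elim)
    case (elim \<omega>)
    let ?L = "LINT u:{s..t}|lborel. G u \<omega>"
    have si: "set_integrable lborel {s..t} (\<lambda>u. G u \<omega>)"
      by (rule set_integrable_subset[OF conjunct1[OF elim]]) (use st in auto)
    have "D s \<omega> + (N t \<omega> - N s \<omega>) = D t \<omega> + ?L" using elim st by blast
    then have "ennreal ((norm (D s \<omega> + (N t \<omega> - N s \<omega>)))\<^sup>2) \<le> 2 * ennreal ((norm (D t \<omega>))\<^sup>2) + 2 * ennreal ((norm ?L)\<^sup>2)"
      using norm_add_power2_le[of "D t \<omega>" ?L] by (intro ennreal_le_twice_add) auto
    also have "\<dots> \<le> 2 * ennreal ((norm (D t \<omega>))\<^sup>2) + 2 * (ennreal (t - s) * (\<integral>\<^sup>+u\<in>{s..t}. ennreal ((norm (G u \<omega>))\<^sup>2) \<partial>lborel))"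
      by (intro add_left_mono mult_left_mono norm_set_integral_square_le si st) simp
    also have "2 * (ennreal (t - s) * (\<integral>\<^sup>+u\<in>{s..t}. ennreal ((norm (G u \<omega>))\<^sup>2) \<partial>lborel))
        = ennreal (2 * (t - s)) * (\<integral>\<^sup>+u\<in>{s..t}. ennreal ((norm (G u \<omega>))\<^sup>2) \<partial>lborel)"
    proof -
      have "ennreal (2 * (t - s)) = 2 * ennreal (t - s)" using st by (subst ennreal_mult) auto
      then show ?thesis by (simp only: mult.assoc)
    qed
    finally show ?case .
  qed
  also have "\<dots> = 2 * mean_sq t + ennreal (2 * (t - s)) * energy G_sq s t"
  proof -
    have [measurable]: "D t \<in> borel_measurable M" by (rule F_measurable[OF D_adapted[OF sT(2)]])
    have G_sq_m: "G_sq \<in> borel_measurable Q" by measurable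
    have eo: "energy G_sq s t = (\<integral>\<^sup>+\<omega>. (\<integral>\<^sup>+u\<in>{s..t}. ennreal ((norm (G u \<omega>))\<^sup>2) \<partial>lborel) \<partial>M)"
      using energy_omega(1)[OF G_sq_m st(1,3)] by simp
    have [measurable]: "(\<lambda>\<omega>. \<integral>\<^sup>+u\<in>{s..t}. ennreal ((norm (G u \<omega>))\<^sup>2) \<partial>lborel) \<in> borel_measurable M"
      using time_section_measurable[OF G_sq_m st(1,3)] by simp
    show ?thesis
      unfolding mean_sq_def eo by (simp add: nn_integral_add nn_integral_cmult)
  qed
  finally show ?thesis .
qed

text \<open>On a short interval the drift contributes at most a quarter of what is to be estimated and is absorbed. The
supremum of \<open>mean_sq\<close> over the interval and the energy of \<open>q\<close> have to be absorbed together.\<close>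

lemma short_interval:
  assumes st: "0 \<le> s0" "s0 \<le> t" "t \<le> T" and short: "t - s0 \<le> 1" "8 * \<kappa> * (t - s0) \<le> 1"
  shows "r \<in> {s0..t} \<Longrightarrow> mean_sq r \<le> 8 * mean_sq t + total_h"
    and "energy q s0 t \<le> 8 * mean_sq t + total_h"
proof -
  define \<Phi> where "\<Phi> = (SUP r\<in>{s0..t}. mean_sq r)"
  have \<Phi>: "mean_sq r \<le> \<Phi>" if "r \<in> {s0..t}" for r unfolding \<Phi>_def using that by (rule SUP_upper)
  obtain c where c: "c < \<infinity>" "\<And>r. r \<in> {0..T} \<Longrightarrow> mean_sq r \<le> c" using D_bounded by (auto simp: mean_sq_def)
  have "\<Phi> \<le> c" unfolding \<Phi>_def using c(2) st by (intro SUP_least) auto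
  then have fin1: "\<Phi> < \<infinity>" using c(1) by (rule le_less_trans)
  have fin2: "energy q s0 t < \<infinity>" using energy_le q_finite by (rule le_less_trans)
  have step: "mean_sq s + energy q s t \<le> 2 * mean_sq t + (\<Phi> + energy q s0 t + total_h) / 4" if s: "s \<in> {s0..t}" for s
  proof -
    have s': "0 \<le> s" "s \<le> t" using s st by auto
    have "energy D_sq s t \<le> ennreal (t - s) * \<Phi>"
      using s by (intro energy_D_sq_le s' st \<Phi>) auto
    also have "\<dots> \<le> 1 * \<Phi>" using s short by (intro mult_right_mono) (auto simp: ennreal_le_1)
    finally have dd: "energy D_sq s t \<le> \<Phi>" by simp
    have qq: "energy q s t \<le> energy q s0 t" using s by (intro energy_mono) auto
    have "ennreal (2 * (t - s)) * energy G_sq s t \<le> ennreal (2 * (t - s)) * (ennreal \<kappa> * (\<Phi> + energy q s0 t + total_h))"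
      using energy_G_sq_le[OF s' st(3)] dd qq
      by (intro mult_left_mono order_trans[OF energy_G_sq_le[OF s' st(3)]] add_mono) auto
    also have "\<dots> = ennreal (2 * (t - s) * \<kappa>) * (\<Phi> + energy q s0 t + total_h)"
      using s' \<kappa>_pos by (simp add: ennreal_mult mult.assoc)
    also have "\<dots> \<le> ennreal (1 / 4) * (\<Phi> + energy q s0 t + total_h)"
    proof (intro mult_right_mono ennreal_leI)
      have "8 * \<kappa> * (t - s) \<le> 8 * \<kappa> * (t - s0)" using s \<kappa>_pos by (intro mult_left_mono) auto
      then have "8 * (\<kappa> * (t - s)) \<le> 1" using short(2) by simp
      moreover have "2 * (t - s) * \<kappa> = 2 * (\<kappa> * (t - s))" by (simp only: ac_simps)
      ultimately show "2 * (t - s) * \<kappa> \<le> 1 / 4" by linarith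
    qed simp
    also have "\<dots> = (\<Phi> + energy q s0 t + total_h) / 4"
    proof -
      have "ennreal (1 / 4) = inverse 4" using inverse_ennreal[of 4] by (simp add: inverse_eq_divide)
      then show ?thesis by (simp add: divide_ennreal_def mult.commute)
    qed
    finally show ?thesis using energy_step[OF s' st(3)] by (meson add_left_mono order_trans)
  qed
  have x: "\<Phi> \<le> 2 * mean_sq t + (\<Phi> + energy q s0 t + total_h) / 4"
    unfolding \<Phi>_def[symmetric] by (subst \<Phi>_def, rule SUP_least, rule order_trans[OF _ step]) auto
  have y: "energy q s0 t \<le> 2 * mean_sq t + (\<Phi> + energy q s0 t + total_h) / 4"
    using st by (intro order_trans[OF _ step[of s0]]) auto
  have sum: "\<Phi> + energy q s0 t \<le> 8 * mean_sq t + total_h" by (rule ennreal_absorb[OF x y fin1 fin2])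
  have e: "energy q s0 t \<le> 8 * mean_sq t + total_h" by (rule order_trans[OF _ sum]) (simp add: add_increasing)
  have "\<Phi> \<le> 8 * mean_sq t + total_h" by (rule order_trans[OF _ sum]) (simp add: add_increasing2)
  then show "r \<in> {s0..t} \<Longrightarrow> mean_sq r \<le> 8 * mean_sq t + total_h" using \<Phi> order_trans by blast
  show "energy q s0 t \<le> 8 * mean_sq t + total_h" by (rule e)
qed

text \<open>Backward iteration of the estimate on short intervals, starting from \<open>D\<^sub>T = 0\<close>. Each step multiplies the
bound by 8 and adds \<open>total_h\<close>, so the powers of 9 suffice.\<close>

lemma global_bounds:
  defines "n \<equiv> step_count T \<kappa>"
  shows "r \<in> {0..T} \<Longrightarrow> mean_sq r \<le> ennreal (9 ^ n) * total_h"
    and "energy q 0 T \<le> ennreal (real n * 9 ^ n) * total_h"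
proof -
  define \<delta> where "\<delta> = T / real n"
  have n: "0 < n" "T + 8 * T * \<kappa> \<le> real n" by (auto simp: n_def step_count_def) linarith
  have p: "0 < T * \<kappa>" using T_pos \<kappa>_pos by simp
  have \<delta>: "0 < \<delta>" "\<delta> \<le> 1" "8 * \<kappa> * \<delta> \<le> 1" "\<delta> * real n = T"
    using n T_pos p by (auto simp: \<delta>_def field_simps)
  have eight: "8 * (ennreal (9 ^ k) * total_h) + total_h \<le> ennreal (9 ^ Suc k) * total_h" for k
  proof -
    have "8 * (ennreal (9 ^ k) * total_h) + total_h = (ennreal (8 * 9 ^ k) + ennreal 1) * total_h"
      by (simp add: distrib_right ennreal_mult mult.assoc)
    also have "\<dots> = ennreal (8 * 9 ^ k + 1) * total_h" by (subst ennreal_plus) auto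
    also have "\<dots> \<le> ennreal (9 ^ Suc k) * total_h" by (intro mult_right_mono ennreal_leI) auto
    finally show ?thesis .
  qed
  have main: "(\<forall>r\<in>{T - real k * \<delta>..T}. mean_sq r \<le> ennreal (9 ^ k) * total_h) \<and>
    energy q (T - real k * \<delta>) T \<le> ennreal (real k * 9 ^ k) * total_h" if "k \<le> n" for k
    using that
  proof (induction k)
    case 0
    have "energy q T T = 0"
      using isometry[of T T] T_pos by (simp add: energy_def)
    then show ?case by (simp add: mean_sq_T)
  next
    case (Suc k)
    let ?t = "T - real k * \<delta>" and ?s = "T - real (Suc k) * \<delta>"
    have kn: "real (Suc k) \<le> real n" using Suc.prems by linarith
    have "real (Suc k) * \<delta> \<le> real n * \<delta>" using kn \<delta>(1) by (intro mult_right_mono) auto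
    then have s0: "0 \<le> ?s" using \<delta>(4) by (simp add: mult.commute)
    have ts: "?t - ?s = \<delta>" by (simp add: algebra_simps)
    have st: "?s \<le> ?t" using ts \<delta>(1) by linarith
    have tT: "?t \<le> T" using \<delta>(1) by simp
    have IH: "\<forall>r\<in>{?t..T}. mean_sq r \<le> ennreal (9 ^ k) * total_h" "energy q ?t T \<le> ennreal (real k * 9 ^ k) * total_h"
      using Suc by auto
    have "mean_sq ?t \<le> ennreal (9 ^ k) * total_h" using IH(1) tT by auto
    then have "8 * mean_sq ?t + total_h \<le> 8 * (ennreal (9 ^ k) * total_h) + total_h" by (intro add_right_mono mult_left_mono) auto
    also note eight[of k]
    finally have b: "8 * mean_sq ?t + total_h \<le> ennreal (9 ^ Suc k) * total_h" .
    have sh: "?t - ?s \<le> 1" "8 * \<kappa> * (?t - ?s) \<le> 1" unfolding ts using \<delta> by auto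
    note S = short_interval[OF s0 st tT sh]
    have mono: "ennreal (9 ^ k) * total_h \<le> ennreal (9 ^ Suc k) * total_h"
      by (intro mult_right_mono ennreal_leI) auto
    have "mean_sq r \<le> ennreal (9 ^ Suc k) * total_h" if "r \<in> {?s..T}" for r
    proof (cases "r \<le> ?t")
      case True
      then show ?thesis using S(1)[of r] b that by auto
    next
      case False
      then show ?thesis using IH(1) that mono by (auto intro: order_trans)
    qed
    moreover have "energy q ?s T \<le> ennreal (real (Suc k) * 9 ^ Suc k) * total_h"
    proof -
      have "energy q ?s T \<le> energy q ?s ?t + energy q ?t T" by (rule energy_split) measurable
      also have "\<dots> \<le> ennreal (9 ^ Suc k) * total_h + ennreal (real k * 9 ^ k) * total_h"
        by (intro add_mono order_trans[OF S(2) b] IH)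
      also have "\<dots> = ennreal (9 ^ Suc k + real k * 9 ^ k) * total_h"
        by (subst ennreal_plus) (auto simp: distrib_right)
      also have "\<dots> \<le> ennreal (real (Suc k) * 9 ^ Suc k) * total_h"
        by (intro mult_right_mono ennreal_leI) (auto simp: algebra_simps)
      finally show ?thesis .
    qed
    ultimately show ?case by blast
  qed
  have z: "T - real n * \<delta> = 0" using \<delta>(4) by (simp add: mult.commute)
  show "r \<in> {0..T} \<Longrightarrow> mean_sq r \<le> ennreal (9 ^ n) * total_h"
    "energy q 0 T \<le> ennreal (real n * 9 ^ n) * total_h"
    using main[OF order_refl] unfolding z by auto
qed

text \<open>In the application the supremum is taken over conditional expectations, which is why one measurable majorant
for all times is produced. The equation bounds \<open>|D\<^sub>t|\<^sup>2\<close> uniformly in \<open>t\<close> by the total energy of the drift and the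
maximal function of \<open>N\<close>, and these have been controlled.\<close>

lemma a_priori_estimate:
  obtains S where "S \<in> borel_measurable M"
    and "AE \<omega> in M. \<forall>t\<in>{0..T}. ennreal ((norm (D t \<omega>))\<^sup>2) + (\<integral>\<^sup>+u\<in>{0..T}. q (u, \<omega>) \<partial>lborel) \<le> S \<omega>"
    and "(\<integral>\<^sup>+\<omega>. S \<omega> \<partial>M) \<le> ennreal (a_priori_const T \<kappa>) * total_h"
proof -
  obtain S0 where S0[measurable]: "S0 \<in> borel_measurable M"
    and S0_le: "AE \<omega> in M. \<forall>t\<in>{0..T}. ennreal ((norm (N t \<omega> - N 0 \<omega>))\<^sup>2) \<le> S0 \<omega>"
    and S0_int: "(\<integral>\<^sup>+\<omega>. S0 \<omega> \<partial>M) \<le> 4 * (\<integral>\<^sup>+\<omega>. ennreal ((norm (N T \<omega> - N 0 \<omega>))\<^sup>2) \<partial>M)"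
    by (rule doob_maximal)
  have T0: "0 \<le> T" using T_pos by simp
  have G_sq_m: "G_sq \<in> borel_measurable Q" by measurable
  define A where "A \<omega> = (\<integral>\<^sup>+u\<in>{0..T}. ennreal ((norm (G u \<omega>))\<^sup>2) \<partial>lborel)" for \<omega>
  define R where "R \<omega> = (\<integral>\<^sup>+u\<in>{0..T}. q (u, \<omega>) \<partial>lborel)" for \<omega>
  have [measurable]: "A \<in> borel_measurable M"
    using time_section_measurable[OF G_sq_m order_refl order_refl] by (simp add: A_def[abs_def])
  have [measurable]: "R \<in> borel_measurable M"
    using time_section_measurable[OF q_measurable order_refl order_refl] by (simp add: R_def[abs_def])
  define S where "S \<omega> = ennreal (2 * T) * A \<omega> + 8 * S0 \<omega> + R \<omega>" for \<omega>
  have 1: "S \<in> borel_measurable M" unfolding S_def by measurable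
  have 2: "AE \<omega> in M. \<forall>t\<in>{0..T}. ennreal ((norm (D t \<omega>))\<^sup>2) + R \<omega> \<le> S \<omega>"
    using equation S0_le
  proof eventually_elim
    case (elim \<omega>)
    show ?case
    proof
      fix t assume t: "t \<in> {0..T}"
      let ?L = "LINT s:{t..T}|lborel. G s \<omega>" and ?N = "N T \<omega> - N t \<omega>"
      have si: "set_integrable lborel {t..T} (\<lambda>u. G u \<omega>)"
        by (rule set_integrable_subset[OF conjunct1[OF elim(1)]]) (use t in auto)
      have D: "D t \<omega> = ?L + - ?N" using elim(1) t by simp
      have L: "ennreal ((norm ?L)\<^sup>2) \<le> ennreal T * A \<omega>"
      proof (rule order_trans[OF norm_set_integral_square_le[OF si]])
        show "ennreal (T - t) * (\<integral>\<^sup>+u\<in>{t..T}. ennreal ((norm (G u \<omega>))\<^sup>2) \<partial>lborel) \<le> ennreal T * A \<omega>"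
          unfolding A_def using t by (intro mult_mono ennreal_leI nn_integral_mono) (auto simp: indicator_def)
      qed (use t in auto)
      have "?N = (N T \<omega> - N 0 \<omega>) + - (N t \<omega> - N 0 \<omega>)" by simp
      then have "ennreal ((norm ?N)\<^sup>2) \<le> 2 * ennreal ((norm (N T \<omega> - N 0 \<omega>))\<^sup>2) + 2 * ennreal ((norm (N t \<omega> - N 0 \<omega>))\<^sup>2)"
        using norm_add_power2_le[of "N T \<omega> - N 0 \<omega>" "- (N t \<omega> - N 0 \<omega>)"]
        by (intro ennreal_le_twice_add) (simp_all add: norm_minus_commute)
      also have "\<dots> \<le> 2 * S0 \<omega> + 2 * S0 \<omega>"
        using elim(2) t T0 by (intro add_mono mult_left_mono) auto
      also have "\<dots> = 4 * S0 \<omega>" by (simp flip: distrib_right)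
      finally have N: "ennreal ((norm ?N)\<^sup>2) \<le> 4 * S0 \<omega>" .
      have "ennreal ((norm (D t \<omega>))\<^sup>2) \<le> 2 * ennreal ((norm ?L)\<^sup>2) + 2 * ennreal ((norm ?N)\<^sup>2)"
        unfolding D using norm_add_power2_le[of ?L "- ?N"] by (intro ennreal_le_twice_add) (simp_all only: norm_minus_cancel zero_le_power2)
      also have "\<dots> \<le> 2 * (ennreal T * A \<omega>) + 2 * (4 * S0 \<omega>)"
        by (intro add_mono mult_left_mono L N) auto
      also have "\<dots> = ennreal (2 * T) * A \<omega> + 8 * S0 \<omega>"
        using T0 by (simp add: ennreal_mult mult.assoc[symmetric])
      finally show "ennreal ((norm (D t \<omega>))\<^sup>2) + R \<omega> \<le> S \<omega>" unfolding S_def by (rule add_right_mono)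
    qed
  qed
  define n where "n = step_count T \<kappa>"
  note gb = global_bounds[folded n_def]
  have eD: "energy D_sq 0 T \<le> ennreal (T * 9 ^ n) * total_h"
  proof -
    have "energy D_sq 0 T \<le> ennreal (T - 0) * (ennreal (9 ^ n) * total_h)"
      by (rule energy_D_sq_le) (use T0 gb in auto)
    then show ?thesis using T0 by (simp add: ennreal_mult mult.assoc)
  qed
  have "energy G_sq 0 T \<le> ennreal \<kappa> * (energy D_sq 0 T + energy q 0 T + total_h)"
    by (rule energy_G_sq_le) (use T0 in auto)
  also have "\<dots> \<le> ennreal \<kappa> * (ennreal (T * 9 ^ n) * total_h + ennreal (real n * 9 ^ n) * total_h + ennreal 1 * total_h)"
    by (intro mult_left_mono add_mono eD gb) auto
  also have "\<dots> = ennreal (\<kappa> * (T * 9 ^ n + real n * 9 ^ n + 1)) * total_h"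
  proof -
    have c: "ennreal a * x + ennreal b * x + ennreal 1 * x = ennreal (a + b + 1) * x" if "0 \<le> a" "0 \<le> b" for a b x
    proof -
      have "ennreal (a + b + 1) = ennreal a + ennreal b + ennreal 1" using that by (subst ennreal_plus; simp)
      then show ?thesis by (simp only: distrib_right)
    qed
    have p: "0 \<le> T * 9 ^ n" "0 \<le> real n * 9 ^ n" using T0 by auto
    have "ennreal (\<kappa> * (T * 9 ^ n + real n * 9 ^ n + 1)) = ennreal \<kappa> * ennreal (T * 9 ^ n + real n * 9 ^ n + 1)"
      using p \<kappa>_pos by (intro ennreal_mult) auto
    then show ?thesis by (simp only: c[OF p] mult.assoc)
  qed
  finally have eG: "energy G_sq 0 T \<le> ennreal (\<kappa> * (T * 9 ^ n + real n * 9 ^ n + 1)) * total_h" .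
  have eN: "(\<integral>\<^sup>+\<omega>. ennreal ((norm (N T \<omega> - N 0 \<omega>))\<^sup>2) \<partial>M) = energy q 0 T"
    using isometry[of 0 T] T0 by (simp add: energy_def)
  have "(\<integral>\<^sup>+\<omega>. S \<omega> \<partial>M) = ennreal (2 * T) * energy G_sq 0 T + 8 * (\<integral>\<^sup>+\<omega>. S0 \<omega> \<partial>M) + energy q 0 T"
    unfolding S_def using energy_omega(1)[OF G_sq_m order_refl order_refl] energy_omega(1)[OF q_measurable order_refl order_refl]
    by (simp add: nn_integral_add nn_integral_cmult flip: A_def R_def)
  also have "\<dots> \<le> ennreal (2 * T) * energy G_sq 0 T + 8 * (4 * energy q 0 T) + energy q 0 T"
    using S0_int unfolding eN by (intro add_mono mult_left_mono) auto
  also have "\<dots> = ennreal (2 * T) * energy G_sq 0 T + 33 * energy q 0 T"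
  proof -
    have "8 * (4 * x) + x = 33 * x" for x :: ennreal
    proof -
      have "8 * (4 * x) + x = (32 + 1) * x" by (simp only: distrib_right) simp
      then show ?thesis by simp
    qed
    then show ?thesis by (simp add: add.assoc)
  qed
  also have "\<dots> \<le> ennreal (2 * T) * (ennreal (\<kappa> * (T * 9 ^ n + real n * 9 ^ n + 1)) * total_h)
      + 33 * (ennreal (real n * 9 ^ n) * total_h)"
    by (intro add_mono mult_left_mono eG gb) auto
  also have "\<dots> = (ennreal (2 * T * (\<kappa> * (T * 9 ^ n + real n * 9 ^ n + 1))) + ennreal (33 * (real n * 9 ^ n))) * total_h"
    using T0 \<kappa>_pos by (simp add: distrib_right ennreal_mult mult.assoc)
  also have "ennreal (2 * T * (\<kappa> * (T * 9 ^ n + real n * 9 ^ n + 1))) + ennreal (33 * (real n * 9 ^ n)) = ennreal (a_priori_const T \<kappa>)"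
    using T0 \<kappa>_pos by (subst ennreal_plus[symmetric]) (auto simp: a_priori_const_def Let_def n_def mult.assoc)
  finally have 3: "(\<integral>\<^sup>+\<omega>. S \<omega> \<partial>M) \<le> ennreal (a_priori_const T \<kappa>) * total_h" .
  from 1 2 3 show ?thesis unfolding R_def by (rule that)
qed

end

section \<open>Versions of processes and transport of Brownian motions\<close>

lemma (in complete_measure) measurable_AE_cong:
  assumes g: "g \<in> M \<rightarrow>\<^sub>M N" and f: "f \<in> space M \<rightarrow> space N" and eq: "AE x in M. f x = g x"
  shows "f \<in> M \<rightarrow>\<^sub>M N"
proof (rule measurableI)
  fix A assume A: "A \<in> sets N"
  show "f -` A \<inter> space M \<in> sets M"
  proof (rule in_sets_AE)
    show "g -` A \<inter> space M \<in> sets M" by (rule measurable_sets[OF g A])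
    show "AE x in M. (x \<in> g -` A \<inter> space M) = (x \<in> f -` A \<inter> space M)"
      using eq by eventually_elim auto
  qed auto
qed (use f in auto)

text \<open>In coordinates, from the corresponding statement for real functions.\<close>

lemma completion_version:
  fixes g :: "'w \<Rightarrow> 'v::euclidean_space"
  assumes g: "g \<in> borel_measurable (completion N)"
  obtains g' where "g' \<in> borel_measurable N" "AE x in N. g x = g' x"
proof -
  have "\<forall>b\<in>Basis. \<exists>h. h \<in> borel_measurable N \<and> (AE x in N. g x \<bullet> b = h x)"
  proof
    fix b :: 'v
    have "(\<lambda>x. g x \<bullet> b) \<in> borel_measurable (completion N)" by (intro borel_measurable_inner g) auto
    then show "\<exists>h. h \<in> borel_measurable N \<and> (AE x in N. g x \<bullet> b = h x)"
      using completion_ex_borel_measurable_real by blast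
  qed
  then obtain h where h: "\<And>b. b \<in> Basis \<Longrightarrow> h b \<in> borel_measurable N" "\<And>b. b \<in> Basis \<Longrightarrow> AE x in N. g x \<bullet> b = h b x"
    by metis
  have "AE x in N. \<forall>b\<in>Basis. g x \<bullet> b = h b x" using h(2) by (intro AE_finite_allI) auto
  then have "AE x in N. g x = (\<Sum>b\<in>Basis. h b x *\<^sub>R b)"
  proof eventually_elim
    case (elim x)
    have "g x = (\<Sum>b\<in>Basis. (g x \<bullet> b) *\<^sub>R b)" by (rule euclidean_representation[symmetric])
    also have "\<dots> = (\<Sum>b\<in>Basis. h b x *\<^sub>R b)" using elim by (intro sum.cong) auto
    finally show ?case .
  qed
  moreover have "(\<lambda>x. \<Sum>b\<in>Basis. h b x *\<^sub>R b) \<in> borel_measurable N"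
    using h(1) by (intro borel_measurable_sum borel_measurable_scaleR) auto
  ultimately show ?thesis by (rule that[rotated])
qed

text \<open>The values at the grid points have versions that are measurable before completion. The limit along the grids
is jointly measurable and agrees with the process at all times simultaneously, almost surely, by continuity. The
supremum \<open>R\<close> of the squared versions over all grid points is a measurable and integrable majorant.\<close>

lemma continuous_version:
  fixes Y :: "real \<Rightarrow> 'w \<Rightarrow> 'v::euclidean_space"
  assumes T: "0 < T" and Y: "\<And>t. t \<in> {0..T} \<Longrightarrow> Y t \<in> borel_measurable (completion N)"
    and cont: "AE \<omega> in N. continuous_on {0..T} (\<lambda>t. Y t \<omega>)"
    and sup: "(\<integral>\<^sup>+\<omega>. (SUP t\<in>{0..T}. ennreal ((norm (Y t \<omega>))\<^sup>2)) \<partial>N) < \<infinity>"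
  obtains V :: "real \<Rightarrow> 'w \<Rightarrow> 'v" and R :: "'w \<Rightarrow> ennreal" where
    "(\<lambda>(t, \<omega>). V t \<omega>) \<in> borel_measurable (borel \<Otimes>\<^sub>M N)"
    "AE \<omega> in N. \<forall>t\<in>{0..T}. Y t \<omega> = V t \<omega>"
    "R \<in> borel_measurable N" "(\<integral>\<^sup>+\<omega>. R \<omega> \<partial>N) < \<infinity>"
    "AE \<omega> in N. \<forall>t\<in>{0..T}. ennreal ((norm (V t \<omega>))\<^sup>2) \<le> R \<omega>"
proof -
  have "\<forall>m k. \<exists>v. v \<in> borel_measurable N \<and> (AE \<omega> in N. Y (grid T m k) \<omega> = v \<omega>)"
    using completion_version[OF Y[OF grid_in[OF T]]] by metis
  then obtain v where v[measurable]: "\<And>m k. v m k \<in> borel_measurable N"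
    and vY: "\<And>m k. AE \<omega> in N. Y (grid T m k) \<omega> = v m k \<omega>" by metis
  define V where "V t \<omega> = lim (\<lambda>m. v m (grid_index T m t) \<omega>)" for t \<omega>
  define R where "R \<omega> = (SUP m. SUP k. ennreal ((norm (v m k \<omega>))\<^sup>2))" for \<omega>
  have gi: "(\<lambda>x :: real \<times> 'w. grid_index T m (fst x)) \<in> borel \<Otimes>\<^sub>M N \<rightarrow>\<^sub>M count_space UNIV" for m
    unfolding grid_index_def by measurable
  have "(\<lambda>x :: real \<times> 'w. v m (grid_index T m (fst x)) (snd x)) \<in> borel_measurable (borel \<Otimes>\<^sub>M N)" for m
    by (rule measurable_compose_countable[OF _ gi]) measurable
  then have 1: "(\<lambda>(t, \<omega>). V t \<omega>) \<in> borel_measurable (borel \<Otimes>\<^sub>M N)"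
    unfolding V_def case_prod_beta' by (rule borel_measurable_lim_metric)
  have Rm: "R \<in> borel_measurable N" unfolding R_def by measurable
  have "AE \<omega> in N. \<forall>m k. Y (grid T m k) \<omega> = v m k \<omega>" by (simp add: AE_all_countable vY)
  then have lim: "AE \<omega> in N. (\<forall>m k. Y (grid T m k) \<omega> = v m k \<omega>) \<and> (\<forall>t\<in>{0..T}. (\<lambda>m. v m (grid_index T m t) \<omega>) \<longlonglongrightarrow> Y t \<omega>)"
    using cont
  proof eventually_elim
    case (elim \<omega>)
    have "(\<lambda>m. Y (grid T m (grid_index T m t)) \<omega>) \<longlonglongrightarrow> Y t \<omega>" if "t \<in> {0..T}" for t
      by (rule continuous_on_tendsto_compose[OF elim(2) grid_tendsto[OF T that] that])
        (use grid_in[OF T] in auto)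
    then show ?case using elim(1) by simp
  qed
  then have 2: "AE \<omega> in N. \<forall>t\<in>{0..T}. Y t \<omega> = V t \<omega>"
    by eventually_elim (auto simp: V_def limI)
  have "AE \<omega> in N. R \<omega> \<le> (SUP t\<in>{0..T}. ennreal ((norm (Y t \<omega>))\<^sup>2))"
    using lim
  proof eventually_elim
    case (elim \<omega>)
    have "ennreal ((norm (v m k \<omega>))\<^sup>2) \<le> (SUP t\<in>{0..T}. ennreal ((norm (Y t \<omega>))\<^sup>2))" for m k
      using elim grid_in[OF T, of m k] by (auto intro!: SUP_upper2[of "grid T m k"])
    then show ?case unfolding R_def by (intro SUP_least)
  qed
  then have "(\<integral>\<^sup>+\<omega>. R \<omega> \<partial>N) \<le> (\<integral>\<^sup>+\<omega>. (SUP t\<in>{0..T}. ennreal ((norm (Y t \<omega>))\<^sup>2)) \<partial>N)"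
    by (rule nn_integral_mono_AE)
  then have R_fin: "(\<integral>\<^sup>+\<omega>. R \<omega> \<partial>N) < \<infinity>" using sup by (rule le_less_trans)
  have 3: "AE \<omega> in N. \<forall>t\<in>{0..T}. ennreal ((norm (V t \<omega>))\<^sup>2) \<le> R \<omega>"
    using lim 2
  proof eventually_elim
    case (elim \<omega>)
    show ?case
    proof
      fix t assume t: "t \<in> {0..T}"
      then have "(\<lambda>m. v m (grid_index T m t) \<omega>) \<longlonglongrightarrow> V t \<omega>" using elim by auto
      then have "(\<lambda>m. ennreal ((norm (v m (grid_index T m t) \<omega>))\<^sup>2)) \<longlonglongrightarrow> ennreal ((norm (V t \<omega>))\<^sup>2)"
        by (intro tendsto_ennrealI tendsto_intros)
      then show "ennreal ((norm (V t \<omega>))\<^sup>2) \<le> R \<omega>"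
        by (rule LIMSEQ_le_const2) (auto simp: R_def intro!: SUP_upper2)
    qed
  qed
  show ?thesis by (rule that[OF 1 2 Rm R_fin 3])
qed

text \<open>All clauses of the definition concern joint laws or almost sure events, which a measure-preserving map
transports.\<close>

lemma brownian_motion_pullback:
  fixes B :: "real \<Rightarrow> 'x \<Rightarrow> real ^ 'd"
  assumes M: "prob_space M" and \<pi>[measurable]: "\<pi> \<in> M \<rightarrow>\<^sub>M P" and distr: "distr M P \<pi> = P" and B: "brownian_motion P T B"
  shows "brownian_motion M T (\<lambda>t \<omega>. B t (\<pi> \<omega>))"
proof -
  interpret M: prob_space M by fact
  interpret P: prob_space P using M.prob_space_distr[OF \<pi>] by (simp add: distr)
  have Bm: "B t \<in> borel_measurable P" if "t \<in> {0..T}" for t by (rule brownian_motion_measurable[OF B that])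
  have ae: "AE \<omega> in M. Pr (\<pi> \<omega>)" if "AE \<omega> in P. Pr \<omega>" for Pr
    by (rule AE_distrD[OF \<pi>], unfold distr, rule that)
  have comp: "distr M L (\<lambda>\<omega>. X (\<pi> \<omega>)) = distr P L X" if "X \<in> P \<rightarrow>\<^sub>M L" for X :: "'x \<Rightarrow> 'z" and L
    using distr_distr[OF that \<pi>] by (simp add: distr comp_def)
  have incr: "distributed M lborel (\<lambda>\<omega>. B t (\<pi> \<omega>) - B s (\<pi> \<omega>))
          (\<lambda>x. ennreal (\<Prod>j\<in>UNIV. normal_density 0 (sqrt (t - s)) (x $ j)))" if st: "0 \<le> s" "s < t" "t \<le> T" for s t
  proof -
    have D: "distributed P lborel (\<lambda>\<omega>. B t \<omega> - B s \<omega>)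
          (\<lambda>x. ennreal (\<Prod>j\<in>UNIV. normal_density 0 (sqrt (t - s)) (x $ j)))"
      using B st unfolding brownian_motion_def by blast
    have X: "(\<lambda>\<omega>. B t \<omega> - B s \<omega>) \<in> P \<rightarrow>\<^sub>M lborel"
      using borel_measurable_diff[OF Bm[of t] Bm[of s]] st by simp
    show ?thesis
      using D comp[OF X] measurable_compose[OF \<pi> X] by (simp add: distributed_def)
  qed
  have ind: "M.indep_vars (\<lambda>_. borel) (\<lambda>j \<omega>. B (\<tau> (Suc j)) (\<pi> \<omega>) - B (\<tau> j) (\<pi> \<omega>)) {..<k}"
    if \<tau>: "\<forall>j\<le>k. \<tau> j \<in> {0..T}" "\<forall>j<k. \<tau> j \<le> \<tau> (Suc j)" for k :: nat and \<tau>
  proof (cases "k = 0")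
    case True
    then show ?thesis by (simp add: M.indep_vars_def M.indep_sets_def)
  next
    case False
    let ?X = "\<lambda>j \<omega>. B (\<tau> (Suc j)) \<omega> - B (\<tau> j) \<omega>"
    have X[measurable]: "?X j \<in> borel_measurable P" if "j \<in> {..<k}" for j
      using that \<tau>(1) by (intro borel_measurable_diff Bm) auto
    have X': "(\<lambda>\<omega>. ?X j (\<pi> \<omega>)) \<in> borel_measurable M" if "j \<in> {..<k}" for j
      by (rule measurable_compose[OF \<pi> X[OF that]])
    have XP: "(\<lambda>\<omega>. \<lambda>j\<in>{..<k}. ?X j \<omega>) \<in> P \<rightarrow>\<^sub>M Pi\<^sub>M {..<k} (\<lambda>_. borel)"
      by (rule measurable_restrict) (rule X)
    have "P.indep_vars (\<lambda>_. borel) ?X {..<k}"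
      using B \<tau> unfolding brownian_motion_def by blast
    then have "distr P (Pi\<^sub>M {..<k} (\<lambda>_. borel)) (\<lambda>\<omega>. \<lambda>j\<in>{..<k}. ?X j \<omega>) = Pi\<^sub>M {..<k} (\<lambda>j. distr P borel (?X j))"
      using False X by (subst (asm) P.indep_vars_iff_distr_eq_PiM') auto
    note law = this
    have "distr M (Pi\<^sub>M {..<k} (\<lambda>_. borel)) (\<lambda>\<omega>. \<lambda>j\<in>{..<k}. ?X j (\<pi> \<omega>)) = Pi\<^sub>M {..<k} (\<lambda>j. distr M borel (\<lambda>\<omega>. ?X j (\<pi> \<omega>)))"
    proof -
      have "Pi\<^sub>M {..<k} (\<lambda>j. distr M borel (\<lambda>\<omega>. ?X j (\<pi> \<omega>))) = Pi\<^sub>M {..<k} (\<lambda>j. distr P borel (?X j))"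
        by (rule PiM_cong[OF refl]) (rule comp[OF X])
      then show ?thesis using comp[OF XP] law by simp
    qed
    then show ?thesis using False X' by (subst M.indep_vars_iff_distr_eq_PiM') auto
  qed
  show ?thesis
    unfolding brownian_motion_def
    using measurable_compose[OF \<pi> Bm] ae[of "\<lambda>\<omega>. B 0 \<omega> = 0"] ae[of "\<lambda>\<omega>. continuous_on {0..T} (\<lambda>t. B t \<omega>)"] B incr ind
    by (auto simp: brownian_motion_def)
qed

section \<open>The product space and conditional expectations given the common noise\<close>

locale product_noise =
  fixes P0 :: "'a measure" and P1 :: "'b measure"
  assumes P0: "prob_space P0" and P1: "prob_space P1"
begin

abbreviation "\<M> \<equiv> prod_space P0 P1"

lemma prob_space_M: "prob_space \<M>"
proof -
  interpret P0: prob_space P0 by (rule P0)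
  interpret P1: prob_space P1 by (rule P1)
  interpret pair_prob_space P0 P1 by standard
  show ?thesis unfolding prod_space_def by (rule P.prob_space_completion)
qed

lemma pair_sigma_finite: "pair_sigma_finite P0 P1"
proof -
  interpret P0: prob_space P0 by (rule P0)
  interpret P1: prob_space P1 by (rule P1)
  show ?thesis by standard
qed

lemma space_M: "space \<M> = space P0 \<times> space P1"
  by (simp add: prod_space_def space_pair_measure)

lemma fst_measurable: "fst \<in> \<M> \<rightarrow>\<^sub>M P0" and snd_measurable: "snd \<in> \<M> \<rightarrow>\<^sub>M P1"
  unfolding prod_space_def by (auto intro: measurable_completion)

lemma distr_fst: "distr \<M> P0 fst = P0"
  unfolding prod_space_def by (simp add: distr_completion prob_space.distr_pair_fst[OF P1])

lemma distr_snd: "distr \<M> P1 snd = P1"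
proof -
  interpret pair_sigma_finite P0 P1 by (rule pair_sigma_finite)
  interpret sw: pair_sigma_finite P1 P0 by standard
  have "distr (P0 \<Otimes>\<^sub>M P1) P1 snd = distr (distr (P1 \<Otimes>\<^sub>M P0) (P0 \<Otimes>\<^sub>M P1) (\<lambda>(x, y). (y, x))) P1 snd"
    by (subst distr_pair_swap) simp
  also have "\<dots> = distr (P1 \<Otimes>\<^sub>M P0) P1 fst"
    by (subst distr_distr) (auto simp: comp_def case_prod_beta')
  also have "\<dots> = P1" by (rule prob_space.distr_pair_fst[OF P0])
  finally show ?thesis unfolding prod_space_def by (simp add: distr_completion)
qed

lemma AE_fst: "(AE \<omega>0 in P0. Pr \<omega>0) \<Longrightarrow> AE \<omega> in \<M>. Pr (fst \<omega>)"
  by (rule AE_distrD[OF fst_measurable], unfold distr_fst)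

lemma AE_sections: "(AE \<omega> in \<M>. Pr \<omega>) \<Longrightarrow> AE \<omega>0 in P0. AE \<omega>1 in P1. Pr (\<omega>0, \<omega>1)"
  unfolding prod_space_def AE_completion_iff by (rule pair_sigma_finite.AE_pair[OF pair_sigma_finite])

lemma cond_exp0_measurable:
  assumes "g \<in> borel_measurable (P0 \<Otimes>\<^sub>M P1)"
  shows "cond_exp0 P1 g \<in> borel_measurable P0"
  unfolding cond_exp0_def using assms
  by (intro sigma_finite_measure.borel_measurable_nn_integral pair_sigma_finite.axioms(2)[OF pair_sigma_finite]) simp

text \<open>Fubini's theorem for the completed product. Sections of a function that is measurable for the completion need
not be measurable, but almost all of them agree almost everywhere with sections of a version that is measurable
for the product.\<close>

lemma nn_integral_cond_exp0:
  assumes g: "g \<in> borel_measurable \<M>"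
  shows "(\<integral>\<^sup>+\<omega>. g \<omega> \<partial>\<M>) = (\<integral>\<^sup>+\<omega>. cond_exp0 P1 g (fst \<omega>) \<partial>\<M>)"
proof -
  obtain g' where g'[measurable]: "g' \<in> borel_measurable (P0 \<Otimes>\<^sub>M P1)" and eq: "AE \<omega> in P0 \<Otimes>\<^sub>M P1. g \<omega> = g' \<omega>"
    using completion_ex_borel_measurable[OF g[unfolded prod_space_def]] by blast
  have eqM: "AE \<omega> in \<M>. g \<omega> = g' \<omega>" unfolding prod_space_def by (rule AE_completion[OF eq])
  have "AE \<omega>0 in P0. cond_exp0 P1 g \<omega>0 = cond_exp0 P1 g' \<omega>0"
    using AE_sections[OF eqM] unfolding cond_exp0_def by eventually_elim (rule nn_integral_cong_AE)
  then have c: "AE \<omega> in \<M>. cond_exp0 P1 g (fst \<omega>) = cond_exp0 P1 g' (fst \<omega>)" by (rule AE_fst)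
  have "(\<integral>\<^sup>+\<omega>. g \<omega> \<partial>\<M>) = (\<integral>\<^sup>+\<omega>. g' \<omega> \<partial>(P0 \<Otimes>\<^sub>M P1))"
    unfolding prod_space_def nn_integral_completion by (rule nn_integral_cong_AE[OF eq])
  also have "\<dots> = (\<integral>\<^sup>+\<omega>0. cond_exp0 P1 g' \<omega>0 \<partial>P0)"
    unfolding cond_exp0_def
    by (rule sigma_finite_measure.nn_integral_fst[OF pair_sigma_finite.axioms(2)[OF pair_sigma_finite], symmetric]) simp
  also have "\<dots> = (\<integral>\<^sup>+\<omega>0. cond_exp0 P1 g' \<omega>0 \<partial>distr \<M> P0 fst)" by (simp add: distr_fst)
  also have "\<dots> = (\<integral>\<^sup>+\<omega>. cond_exp0 P1 g' (fst \<omega>) \<partial>\<M>)"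
    by (rule nn_integral_distr[OF fst_measurable]) (simp add: cond_exp0_measurable)
  also have "\<dots> = (\<integral>\<^sup>+\<omega>. cond_exp0 P1 g (fst \<omega>) \<partial>\<M>)"
    by (rule nn_integral_cong_AE) (use c in eventually_elim, simp)
  finally show ?thesis .
qed

text \<open>The supremum of conditional expectations is at most the conditional expectation of a common majorant. The
nonnegative integral is monotone for arbitrary functions, which matters because the suprema over time are uncountable.\<close>

lemma integral_SUP_cond_exp0_le:
  assumes S: "S \<in> borel_measurable \<M>" and le: "AE \<omega> in \<M>. \<forall>t\<in>A. e t \<omega> \<le> S \<omega>"
  shows "(\<integral>\<^sup>+\<omega>. (SUP t\<in>A. cond_exp0 P1 (e t) (fst \<omega>)) \<partial>\<M>) \<le> (\<integral>\<^sup>+\<omega>. S \<omega> \<partial>\<M>)"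
proof -
  have "AE \<omega>0 in P0. (SUP t\<in>A. cond_exp0 P1 (e t) \<omega>0) \<le> cond_exp0 P1 S \<omega>0"
    using AE_sections[OF le]
  proof eventually_elim
    case (elim \<omega>0)
    show ?case
    proof (rule SUP_least)
      fix t assume "t \<in> A"
      then have "AE \<omega>1 in P1. e t (\<omega>0, \<omega>1) \<le> S (\<omega>0, \<omega>1)" using elim by (auto elim: eventually_mono)
      then show "cond_exp0 P1 (e t) \<omega>0 \<le> cond_exp0 P1 S \<omega>0"
        unfolding cond_exp0_def by (rule nn_integral_mono_AE)
    qed
  qed
  then have "AE \<omega> in \<M>. (SUP t\<in>A. cond_exp0 P1 (e t) (fst \<omega>)) \<le> cond_exp0 P1 S (fst \<omega>)" by (rule AE_fst)
  then have "(\<integral>\<^sup>+\<omega>. (SUP t\<in>A. cond_exp0 P1 (e t) (fst \<omega>)) \<partial>\<M>) \<le> (\<integral>\<^sup>+\<omega>. cond_exp0 P1 S (fst \<omega>) \<partial>\<M>)"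
    by (rule nn_integral_mono_AE)
  then show ?thesis by (simp add: nn_integral_cond_exp0[OF S])
qed

text \<open>A measurable lower bound \<open>g\<close> suffices to compare with the integral of the possibly non-measurable
\<open>w t\<close>, such as the squared Wasserstein distance.\<close>

lemma integral_le_SUP_cond_exp0:
  assumes g: "g \<in> borel_measurable \<M>" and t: "t \<in> A" and le: "AE \<omega> in \<M>. g \<omega> \<le> w t \<omega>"
  shows "(\<integral>\<^sup>+\<omega>. g \<omega> \<partial>\<M>) \<le> (\<integral>\<^sup>+\<omega>. (SUP t\<in>A. cond_exp0 P1 (w t) (fst \<omega>)) \<partial>\<M>)"
proof -
  have "AE \<omega>0 in P0. cond_exp0 P1 g \<omega>0 \<le> (SUP t\<in>A. cond_exp0 P1 (w t) \<omega>0)"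
    using AE_sections[OF le]
  proof eventually_elim
    case (elim \<omega>0)
    then have "cond_exp0 P1 g \<omega>0 \<le> cond_exp0 P1 (w t) \<omega>0"
      unfolding cond_exp0_def by (rule nn_integral_mono_AE)
    then show ?case using t by (rule SUP_upper2[rotated])
  qed
  then have "AE \<omega> in \<M>. cond_exp0 P1 g (fst \<omega>) \<le> (SUP t\<in>A. cond_exp0 P1 (w t) (fst \<omega>))" by (rule AE_fst)
  then show ?thesis unfolding nn_integral_cond_exp0[OF g] by (rule nn_integral_mono_AE)
qed

lemma sample_path_measurable:
  assumes "brownian_motion P T B"
  shows "sample_path T B \<in> P \<rightarrow>\<^sub>M Pi\<^sub>M {0..T} (\<lambda>_. borel)"
  unfolding sample_path_def by (rule measurable_restrict) (rule brownian_motion_measurable[OF assms])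

text \<open>Index 0 is the common noise. Its path depends on the first coordinate only and the other paths on the second,
so an intersection of path events is a rectangle, whose probability factorises.\<close>

lemma brownian_family_product:
  fixes W0 :: "real \<Rightarrow> 'a \<Rightarrow> real ^ 'd" and B :: "nat \<Rightarrow> real \<Rightarrow> 'b \<Rightarrow> real ^ 'd"
  assumes T: "0 < T" and W0: "brownian_motion P0 T W0" and B: "\<And>i. i \<ge> 1 \<Longrightarrow> brownian_motion P1 T (B i)"
    and indep: "prob_space.indep_vars P1 (\<lambda>_. Pi\<^sub>M {0..T} (\<lambda>_. borel)) (\<lambda>i. sample_path T (B i)) {1..n}"
  shows "brownian_family \<M> T {0..n} (\<lambda>k. if k = 0 then ext0 W0 else ext1 (B k))"
proof -
  interpret prob_space \<M> by (rule prob_space_M)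
  interpret p0: prob_space P0 by (rule P0)
  interpret p1: prob_space P1 by (rule P1)
  let ?X = "\<lambda>k. if k = 0 then ext0 W0 else ext1 (B k)"
  let ?S = "Pi\<^sub>M {0..T} (\<lambda>_. borel) :: (real \<Rightarrow> real ^ 'd) measure"
  have bm: "brownian_motion \<M> T (?X k)" if "k \<in> {0..n}" for k
    using brownian_motion_pullback[OF prob_space_M fst_measurable distr_fst W0]
      brownian_motion_pullback[OF prob_space_M snd_measurable distr_snd B[of k]]
    by (auto simp: ext0_def ext1_def)
  have rect: "prob (A0 \<times> A1) = p0.prob A0 * p1.prob A1" if "A0 \<in> sets P0" "A1 \<in> sets P1" for A0 A1
  proof -
    have "emeasure \<M> (A0 \<times> A1) = emeasure P0 A0 * emeasure P1 A1"
      using that sigma_finite_measure.emeasure_pair_measure_Times[OF pair_sigma_finite.axioms(2)[OF pair_sigma_finite], of A0 P0 A1]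
      by (simp add: prod_space_def)
    then show ?thesis by (simp add: measure_def enn2real_mult)
  qed
  have i0: "sample_path T (?X 0) \<omega> = sample_path T W0 (fst \<omega>)" for \<omega>
    by (simp add: sample_path_def ext0_def)
  have ik: "sample_path T (?X k) \<omega> = sample_path T (B k) (snd \<omega>)" if "1 \<le> k" for k \<omega>
    using that by (simp add: sample_path_def ext1_def)
  have "indep_vars (\<lambda>_. ?S) (\<lambda>k. sample_path T (?X k)) {0..n}"
    unfolding indep_vars_def2
  proof (intro conjI ballI indep_setsI)
    fix k assume "k \<in> {0..n}"
    then show m: "sample_path T (?X k) \<in> \<M> \<rightarrow>\<^sub>M ?S" by (rule sample_path_measurable[OF bm])
    then show "{sample_path T (?X k) -` A \<inter> space \<M> |A. A \<in> sets ?S} \<subseteq> events" by (auto intro: measurable_sets)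
  next
    fix A J assume J: "J \<noteq> {}" "J \<subseteq> {0..n}" "finite J"
      and A: "\<forall>j\<in>J. A j \<in> {sample_path T (?X j) -` A \<inter> space \<M> |A. A \<in> sets ?S}"
    have "\<forall>j\<in>J. \<exists>E\<in>sets ?S. A j = sample_path T (?X j) -` E \<inter> space \<M>" using A by blast
    then obtain E where E: "\<And>j. j \<in> J \<Longrightarrow> E j \<in> sets ?S" "\<And>j. j \<in> J \<Longrightarrow> A j = sample_path T (?X j) -` E j \<inter> space \<M>"
      by metis
    define J1 where "J1 = J - {0}"
    have J1: "J1 \<subseteq> {1..n}" "finite J1" using J by (auto simp: J1_def)
    define C where "C k = sample_path T (B k) -` E k \<inter> space P1" for k
    have Csub: "b \<in> C k \<Longrightarrow> b \<in> space P1" for b k by (simp add: C_def)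
    define C0 where "C0 = (if 0 \<in> J then sample_path T W0 -` E 0 \<inter> space P0 else space P0)"
    define C1 where "C1 = (if J1 = {} then space P1 else (\<Inter>k\<in>J1. C k))"
    have C0s: "C0 \<in> sets P0" unfolding C0_def using E(1)[of 0] measurable_sets[OF sample_path_measurable[OF W0]] by auto
    have Cs: "C k \<in> sets P1" if "k \<in> J1" for k
      unfolding C_def using that J1 E(1)[of k] by (intro measurable_sets[OF sample_path_measurable[OF B]]) (auto simp: J1_def)
    have C1s: "C1 \<in> sets P1" unfolding C1_def using Cs J1 by (auto intro!: sets.finite_INT)
    have A0: "A 0 = (sample_path T W0 -` E 0 \<inter> space P0) \<times> space P1" if "0 \<in> J"
      unfolding E(2)[OF that] using i0 by (auto simp: space_M)
    have Ak: "A k = space P0 \<times> C k" if "k \<in> J1" for k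
    proof -
      have k: "k \<in> J" "1 \<le> k" using that J1 by (auto simp: J1_def)
      show ?thesis unfolding E(2)[OF k(1)] C_def using ik[OF k(2)] by (auto simp: space_M)
    qed
    have "(\<Inter>j\<in>J. A j) = C0 \<times> C1"
    proof (cases "0 \<in> J")
      case True
      then have Jeq: "J = insert 0 J1" by (auto simp: J1_def)
      show ?thesis
      proof (cases "J1 = {}")
        case True
        then show ?thesis using Jeq A0 by (simp add: C0_def C1_def)
      next
        case False
        have "(\<Inter>j\<in>J. A j) = A 0 \<inter> (\<Inter>k\<in>J1. space P0 \<times> C k)" unfolding Jeq using Ak by simp
        also have "\<dots> = C0 \<times> C1"
        proof -
          have a0: "A 0 = C0 \<times> space P1" using A0 \<open>0 \<in> J\<close> by (simp add: C0_def)
          have c1: "C1 = (\<Inter>k\<in>J1. C k)" using False by (simp add: C1_def)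
          have C0sub: "x \<in> C0 \<Longrightarrow> x \<in> space P0" for x using sets.sets_into_space[OF C0s] by blast
          obtain k0 where "k0 \<in> J1" using False by blast
          then show ?thesis unfolding a0 c1 using Csub C0sub by blast
        qed
        finally show ?thesis .
      qed
    next
      case False
      then have Jeq: "J = J1" by (auto simp: J1_def)
      then have ne: "J1 \<noteq> {}" using J by simp
      have "(\<Inter>j\<in>J. A j) = (\<Inter>k\<in>J1. space P0 \<times> C k)" unfolding Jeq using Ak by simp
      also have "\<dots> = C0 \<times> C1" using ne False by (auto simp: C0_def C1_def)
      finally show ?thesis .
    qed
    then have "prob (\<Inter>j\<in>J. A j) = p0.prob C0 * p1.prob C1" by (simp add: rect C0s C1s)
    also have "p1.prob C1 = (\<Prod>k\<in>J1. p1.prob (C k))"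
    proof (cases "J1 = {}")
      case True
      then show ?thesis by (simp add: C1_def p1.prob_space)
    next
      case False
      have "p1.indep_sets (\<lambda>i. {sample_path T (B i) -` A \<inter> space P1 |A. A \<in> sets ?S}) {1..n}"
        using indep by (simp add: p1.indep_vars_def2)
      from p1.indep_setsD[OF this J1(1) False J1(2), of C]
      show ?thesis using False E(1) by (force simp: C1_def C_def J1_def)
    qed
    also have "p0.prob C0 * \<dots> = (\<Prod>j\<in>J. prob (A j))"
    proof -
      have k: "prob (A k) = p1.prob (C k)" if "k \<in> J1" for k
        using Ak[OF that] Cs[OF that] by (simp add: rect p0.prob_space)
      show ?thesis
      proof (cases "0 \<in> J")
        case True
        then have Jeq: "J = insert 0 J1" "0 \<notin> J1" by (auto simp: J1_def)
        have "prob (A 0) = p0.prob C0"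
          using A0[OF True] True C0s by (simp add: rect C0_def p1.prob_space)
        then show ?thesis unfolding Jeq(1) using Jeq(2) J1(2) k by simp
      next
        case False
        then have "J = J1" by (auto simp: J1_def)
        then show ?thesis using False k by (simp add: C0_def p0.prob_space)
      qed
    qed
    finally show "prob (\<Inter>j\<in>J. A j) = (\<Prod>j\<in>J. prob (A j))" .
  qed
  then show ?thesis
    using T bm by unfold_locales auto
qed

end

section \<open>Joint measurability of laws and drivers\<close>

lemma P2_algebra_measurableI:
  assumes "f \<in> N \<rightarrow>\<^sub>M prob_algebra borel" "\<And>x. x \<in> space N \<Longrightarrow> f x \<in> P2"
  shows "f \<in> N \<rightarrow>\<^sub>M P2_algebra"
  unfolding P2_algebra_def using assms by (intro measurable_restrict_space2) auto

lemma empirical_in_P2: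
  fixes x :: "nat \<Rightarrow> 'v::euclidean_space"
  assumes n: "n \<ge> 1"
  shows "empirical n x \<in> P2"
proof -
  let ?U = "uniform_count_measure {1..n}"
  interpret U: prob_space ?U by (rule prob_space_uniform_count_measure) (use n in auto)
  have x: "x \<in> ?U \<rightarrow>\<^sub>M borel"
    by (auto simp: measurable_def sets_uniform_count_measure space_uniform_count_measure)
  have "(\<integral>\<^sup>+v. ennreal ((norm v)\<^sup>2) \<partial>empirical n x) = (\<integral>\<^sup>+j. ennreal ((norm (x j))\<^sup>2) \<partial>?U)"
    unfolding empirical_def by (rule nn_integral_distr[OF x]) simp
  also have "\<dots> \<le> (\<integral>\<^sup>+j. ennreal (\<Sum>i=1..n. (norm (x i))\<^sup>2) \<partial>?U)"
    by (rule nn_integral_mono) (auto simp: space_uniform_count_measure intro!: ennreal_leI member_le_sum)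
  also have "\<dots> < \<infinity>" unfolding nn_integral_const U.emeasure_space_1 by simp
  finally show ?thesis
    using U.prob_space_distr[OF x] by (simp add: P2_def empirical_def)
qed

lemma empirical_measurable:
  fixes Y :: "nat \<Rightarrow> real \<Rightarrow> 'w \<Rightarrow> 'v::euclidean_space"
  assumes n: "n \<ge> 1" and Y: "\<And>j. j \<in> {1..n} \<Longrightarrow> jointly_measurable M T (Y j)"
  shows "(\<lambda>(s, \<omega>). empirical n (\<lambda>j. Y j s \<omega>)) \<in> time_measure T \<Otimes>\<^sub>M M \<rightarrow>\<^sub>M P2_algebra"
proof (rule P2_algebra_measurableI)
  have p: "prob_space (empirical n x)" "sets (empirical n x) = sets borel" for x :: "nat \<Rightarrow> 'v"
    using empirical_in_P2[OF n, of x] by (auto simp: P2_def)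
  show "(\<lambda>(s, \<omega>). empirical n (\<lambda>j. Y j s \<omega>)) \<in> time_measure T \<Otimes>\<^sub>M M \<rightarrow>\<^sub>M prob_algebra borel"
  proof (rule measurable_prob_algebraI, goal_cases)
    case (1 x)
    then show ?case by (cases x) (simp add: p)
  next
    case 2
    show ?case
    proof (rule measurable_subprob_algebra, goal_cases)
      case (1 x)
      then show ?case by (cases x) (simp add: p prob_space_imp_subprob_space)
    next
      case (2 x)
      then show ?case by (cases x) (simp add: p)
    next
      case (3 A)
      have [measurable]: "(\<lambda>x. Y j (fst x) (snd x)) \<in> borel_measurable (time_measure T \<Otimes>\<^sub>M M)" if "j \<in> {1..n}" for j
        using Y[OF that] by (simp add: jointly_measurable_def case_prod_beta')
      have "(\<lambda>x. indicator A (Y j (fst x) (snd x)) :: ennreal) \<in> borel_measurable (time_measure T \<Otimes>\<^sub>M M)" if "j \<in> {1..n}" for j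
        using that 3 by measurable
      then have "(\<lambda>x. ennreal (1 / real n) * (\<Sum>j=1..n. indicator A (Y j (fst x) (snd x)))) \<in> borel_measurable (time_measure T \<Otimes>\<^sub>M M)"
        by (intro borel_measurable_times_ennreal borel_measurable_sum) auto
      then show ?case
        using 3 by (simp add: emeasure_empirical[OF n] case_prod_beta')
    qed
  qed
qed (auto simp: empirical_in_P2[OF n])

text \<open>The driver is progressively measurable for the filtration of the common noise, which is contained in the
sigma-algebra of the whole space.\<close>

lemma driver_jointly_measurable:
  fixes f :: "('w, 'm::finite, 'd::finite) driver"
  assumes f: "prog_measurable_driver T F f" and T: "0 \<le> T" and F: "space (F T) = space M" "sets (F T) \<subseteq> sets M"
    and Y: "jointly_measurable M T Y" and Z: "jointly_measurable M T Z" and Z0: "jointly_measurable M T Z0"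
    and \<mu>: "(\<lambda>(s, \<omega>). \<mu> s \<omega>) \<in> time_measure T \<Otimes>\<^sub>M M \<rightarrow>\<^sub>M P2_algebra"
  shows "jointly_measurable M T (\<lambda>s \<omega>. f \<omega> s (Y s \<omega>) (Z s \<omega>) (Z0 s \<omega>) (\<mu> s \<omega>))"
proof -
  have m: "(\<lambda>(s, \<omega>, y, z, z0, \<mu>). f \<omega> s y z z0 \<mu>) \<in> borel_measurable
        (restrict_space borel {0..T} \<Otimes>\<^sub>M F T \<Otimes>\<^sub>M borel \<Otimes>\<^sub>M borel \<Otimes>\<^sub>M borel \<Otimes>\<^sub>M P2_algebra)"
    using f T by (simp add: prog_measurable_driver_def)
  note id1 = measurable_ident_sets[OF sets_time_measure]
  note id2 = measurable_ident_subset[OF F]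
  have "(\<lambda>x. (fst x, snd x, Y (fst x) (snd x), Z (fst x) (snd x), Z0 (fst x) (snd x), \<mu> (fst x) (snd x)))
    \<in> time_measure T \<Otimes>\<^sub>M M \<rightarrow>\<^sub>M restrict_space borel {0..T} \<Otimes>\<^sub>M F T \<Otimes>\<^sub>M borel \<Otimes>\<^sub>M borel \<Otimes>\<^sub>M borel \<Otimes>\<^sub>M P2_algebra"
    using Y Z Z0 \<mu> unfolding jointly_measurable_def case_prod_beta'
    by (intro measurable_Pair measurable_compose[OF measurable_fst id1] measurable_compose[OF measurable_snd id2])
  from measurable_compose[OF this m] show ?thesis
    by (simp add: jointly_measurable_def case_prod_beta')
qed

context product_noise
begin

text \<open>The conditional law at a given \<open>\<omega>0\<close> is a genuine probability measure with finite second moment only for almost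
all \<open>\<omega>0\<close>; off this set the push-forward along a non-measurable section may be meaningless. The version \<open>L\<close> takes values in
\<open>P2\<close> everywhere, so that the driver can be evaluated at it, and it agrees with the conditional law at all times
simultaneously for almost all \<open>\<omega>0\<close>. Completeness of \<open>P1\<close> makes the sections of \<open>Y\<close> measurable.\<close>

lemma cond_law_version:
  fixes Y :: "real \<Rightarrow> 'a \<times> 'b \<Rightarrow> 'v::euclidean_space"
  assumes T: "0 < T" and complete: "complete_measure P1"
    and Y: "\<And>t. t \<in> {0..T} \<Longrightarrow> Y t \<in> borel_measurable \<M>"
    and cont: "AE \<omega> in \<M>. continuous_on {0..T} (\<lambda>t. Y t \<omega>)"
    and sup: "(\<integral>\<^sup>+\<omega>. (SUP t\<in>{0..T}. ennreal ((norm (Y t \<omega>))\<^sup>2)) \<partial>\<M>) < \<infinity>"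
  obtains L where "(\<lambda>(s, \<omega>). L s (fst \<omega>)) \<in> time_measure T \<Otimes>\<^sub>M \<M> \<rightarrow>\<^sub>M P2_algebra"
    and "\<And>s \<omega>0. \<omega>0 \<in> space P0 \<Longrightarrow> L s \<omega>0 \<in> P2"
    and "AE \<omega> in \<M>. \<forall>s\<in>{0..T}. cond_law P1 (Y s) (fst \<omega>) = L s (fst \<omega>)"
proof -
  let ?N = "P0 \<Otimes>\<^sub>M P1"
  obtain V :: "real \<Rightarrow> 'a \<times> 'b \<Rightarrow> 'v" and R :: "'a \<times> 'b \<Rightarrow> ennreal" where
    V: "(\<lambda>(t, \<omega>). V t \<omega>) \<in> borel_measurable (borel \<Otimes>\<^sub>M ?N)"
    and YV: "AE \<omega> in ?N. \<forall>t\<in>{0..T}. Y t \<omega> = V t \<omega>"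
    and R: "R \<in> borel_measurable ?N" "(\<integral>\<^sup>+\<omega>. R \<omega> \<partial>?N) < \<infinity>"
    and VR: "AE \<omega> in ?N. \<forall>t\<in>{0..T}. ennreal ((norm (V t \<omega>))\<^sup>2) \<le> R \<omega>"
    by (rule continuous_version[OF T Y[unfolded prod_space_def] cont[unfolded prod_space_def AE_completion_iff]
          sup[unfolded prod_space_def nn_integral_completion]])
  define K where "K x = distr P1 borel (\<lambda>\<omega>1. V (fst x) (snd x, \<omega>1))" for x
  define m2 where "m2 x = (\<integral>\<^sup>+v. ennreal ((norm v)\<^sup>2) \<partial>K x)" for x
  \<comment> \<open>A default value where the second moment is infinite; any element of \<open>P2\<close> would do.\<close>
  define L where "L s \<omega>0 = (if m2 (s, \<omega>0) < \<infinity> then K (s, \<omega>0) else return borel 0)" for s \<omega>0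
  have P1a: "(\<lambda>_. P1) \<in> borel \<Otimes>\<^sub>M P0 \<rightarrow>\<^sub>M prob_algebra P1"
    by (rule measurable_const) (simp add: space_prob_algebra P1)
  have "(\<lambda>y. (fst (fst y), snd (fst y), snd y)) \<in> (borel \<Otimes>\<^sub>M P0) \<Otimes>\<^sub>M P1 \<rightarrow>\<^sub>M (borel :: real measure) \<Otimes>\<^sub>M ?N"
    by measurable
  from measurable_compose[OF this V]
  have Vm: "(\<lambda>(x, \<omega>1). V (fst x) (snd x, \<omega>1)) \<in> (borel \<Otimes>\<^sub>M P0) \<Otimes>\<^sub>M P1 \<rightarrow>\<^sub>M borel"
    by (simp add: case_prod_beta')
  have Kp: "K \<in> borel \<Otimes>\<^sub>M P0 \<rightarrow>\<^sub>M prob_algebra borel"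
    unfolding K_def[abs_def] by (rule measurable_distr_prob_space2[OF P1a Vm])
  have m2m: "m2 \<in> borel_measurable (borel \<Otimes>\<^sub>M P0)"
    unfolding m2_def[abs_def]
    by (rule measurable_compose[OF measurable_prob_algebraD[OF Kp] nn_integral_measurable_subprob_algebra]) simp
  have Lp: "(\<lambda>x. L (fst x) (snd x)) \<in> borel \<Otimes>\<^sub>M P0 \<rightarrow>\<^sub>M prob_algebra borel"
    unfolding L_def prod.collapse
  proof (rule measurable_If[OF Kp])
    show "(\<lambda>x. return borel 0) \<in> borel \<Otimes>\<^sub>M P0 \<rightarrow>\<^sub>M prob_algebra (borel :: 'v measure)"
      by (rule measurable_const) (simp add: space_prob_algebra prob_space_return)
    show "{x \<in> space (borel \<Otimes>\<^sub>M P0). m2 x < \<infinity>} \<in> sets (borel \<Otimes>\<^sub>M P0)"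
      using m2m by measurable
  qed
  have LP2: "L s \<omega>0 \<in> P2" if "\<omega>0 \<in> space P0" for s \<omega>0
  proof -
    have "(s, \<omega>0) \<in> space (borel \<Otimes>\<^sub>M P0)" using that by (simp add: space_pair_measure)
    then have "K (s, \<omega>0) \<in> space (prob_algebra borel)" by (rule measurable_space[OF Kp])
    then show ?thesis
      by (auto simp: L_def m2_def P2_def space_prob_algebra prob_space_return nn_integral_return)
  qed
  have "(\<lambda>y. (fst y, fst (snd y))) \<in> time_measure T \<Otimes>\<^sub>M \<M> \<rightarrow>\<^sub>M borel \<Otimes>\<^sub>M P0"
  proof (rule measurable_Pair)
    show "(\<lambda>y. fst y) \<in> time_measure T \<Otimes>\<^sub>M \<M> \<rightarrow>\<^sub>M borel"
      by (rule measurable_compose[OF measurable_fst], rule measurable_time_measure) simp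
    show "(\<lambda>y. fst (snd y)) \<in> time_measure T \<Otimes>\<^sub>M \<M> \<rightarrow>\<^sub>M P0"
      by (rule measurable_compose[OF measurable_snd fst_measurable])
  qed
  from measurable_compose[OF this Lp]
  have "(\<lambda>(s, \<omega>). L s (fst \<omega>)) \<in> time_measure T \<Otimes>\<^sub>M \<M> \<rightarrow>\<^sub>M prob_algebra borel"
    by (simp add: case_prod_beta')
  then have 1: "(\<lambda>(s, \<omega>). L s (fst \<omega>)) \<in> time_measure T \<Otimes>\<^sub>M \<M> \<rightarrow>\<^sub>M P2_algebra"
    by (rule P2_algebra_measurableI) (auto simp: space_pair_measure space_M intro: LP2)
  have pairAE: "AE \<omega>0 in P0. AE \<omega>1 in P1. Pr (\<omega>0, \<omega>1)" if "AE \<omega> in ?N. Pr \<omega>" for Pr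
    by (rule pair_sigma_finite.AE_pair[OF pair_sigma_finite that])
  have "(\<integral>\<^sup>+\<omega>0. cond_exp0 P1 R \<omega>0 \<partial>P0) < \<infinity>"
    using R sigma_finite_measure.nn_integral_fst[OF pair_sigma_finite.axioms(2)[OF pair_sigma_finite] R(1)]
    by (simp add: cond_exp0_def)
  then have Rfin: "AE \<omega>0 in P0. cond_exp0 P1 R \<omega>0 \<noteq> \<infinity>"
    by (intro nn_integral_PInf_AE cond_exp0_measurable R) auto
  have "AE \<omega>0 in P0. \<forall>s\<in>{0..T}. cond_law P1 (Y s) \<omega>0 = L s \<omega>0"
    using pairAE[OF YV] pairAE[OF VR] Rfin AE_space
  proof eventually_elim
    case (elim \<omega>0)
    show ?case
    proof
      fix s assume s: "s \<in> {0..T}"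
      have "(\<lambda>\<omega>1. (s, \<omega>0, \<omega>1)) \<in> P1 \<rightarrow>\<^sub>M borel \<Otimes>\<^sub>M ?N"
        using elim(4) by (intro measurable_Pair measurable_const measurable_ident) auto
      from measurable_compose[OF this V]
      have Vs: "(\<lambda>\<omega>1. V s (\<omega>0, \<omega>1)) \<in> borel_measurable P1" by simp
      have eq: "AE \<omega>1 in P1. Y s (\<omega>0, \<omega>1) = V s (\<omega>0, \<omega>1)"
        using elim(1) s by (auto elim: eventually_mono)
      have "cond_law P1 (Y s) \<omega>0 = K (s, \<omega>0)"
        unfolding cond_law_def K_def fst_conv snd_conv
        by (rule distr_cong_AE[OF refl refl eq complete_measure.measurable_AE_cong[OF complete Vs _ eq] Vs]) auto
      moreover have "m2 (s, \<omega>0) < \<infinity>"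
      proof -
        have "m2 (s, \<omega>0) = (\<integral>\<^sup>+\<omega>1. ennreal ((norm (V s (\<omega>0, \<omega>1)))\<^sup>2) \<partial>P1)"
          unfolding m2_def K_def fst_conv snd_conv by (rule nn_integral_distr[OF Vs]) simp
        also have "\<dots> \<le> cond_exp0 P1 R \<omega>0"
          unfolding cond_exp0_def
          by (rule nn_integral_mono_AE) (use elim(2) s in \<open>auto elim: eventually_mono\<close>)
        also have "\<dots> < \<infinity>" using elim(3) by (simp add: top.not_eq_extremum)
        finally show ?thesis .
      qed
      ultimately show "cond_law P1 (Y s) \<omega>0 = L s \<omega>0" by (simp add: L_def)
    qed
  qed
  then have 3: "AE \<omega> in \<M>. \<forall>s\<in>{0..T}. cond_law P1 (Y s) (fst \<omega>) = L s (fst \<omega>)" by (rule AE_fst)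
  show ?thesis by (rule that[OF 1 LP2 3])
qed

end

section \<open>Particles against their coupled copies\<close>

lemma W2_nonneg: "0 \<le> W2 \<mu> \<nu>"
  by (simp add: W2_def)

lemma Sp_two:
  assumes "y \<in> Sp M T F 2"
  shows "prog_measurable T F y" "(\<integral>\<^sup>+\<omega>. (SUP t\<in>{0..T}. ennreal ((norm (y t \<omega>))\<^sup>2)) \<partial>M) < \<infinity>"
proof -
  have p: "norm x powr 2 = (norm x)\<^sup>2" for x :: 'b by simp
  show "prog_measurable T F y" using assms by (simp add: Sp_def)
  show "(\<integral>\<^sup>+\<omega>. (SUP t\<in>{0..T}. ennreal ((norm (y t \<omega>))\<^sup>2)) \<partial>M) < \<infinity>"
    using assms unfolding Sp_def p by simp
qed

lemma bsde_solution_continuous: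
  assumes sol: "bsde_solution M T F K B W0 \<xi> g Y Z Z0" and K: "finite K"
  shows "AE \<omega> in M. continuous_on {0..T} (\<lambda>t. Y t \<omega>)"
proof -
  obtain I I0 where I: "\<And>k. k \<in> K \<Longrightarrow> ito_integral M T F (B k) (Z k) (I k)" and I0: "ito_integral M T F W0 Z0 I0"
    and eq: "AE \<omega> in M. set_integrable lborel {0..T} (\<lambda>s. g s \<omega>) \<and>
           (\<forall>t\<in>{0..T}. Y t \<omega> = \<xi> \<omega> + (LINT s:{t..T}|lborel. g s \<omega>)
              - (\<Sum>k\<in>K. I k T \<omega> - I k t \<omega>) - (I0 T \<omega> - I0 t \<omega>))"
    using sol unfolding bsde_solution_def by blast
  have "AE \<omega> in M. \<forall>k\<in>K. continuous_on {0..T} (\<lambda>t. I k t \<omega>)"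
    using I by (intro AE_finite_allI K) (simp add: ito_integral_def)
  moreover have "AE \<omega> in M. continuous_on {0..T} (\<lambda>t. I0 t \<omega>)" using I0 by (simp add: ito_integral_def)
  ultimately show ?thesis
    using eq
  proof eventually_elim
    case (elim \<omega>)
    have si: "set_integrable lborel {t..T} (\<lambda>s. g s \<omega>)" if "t \<in> {0..T}" for t
      by (rule set_integrable_subset[OF conjunct1[OF elim(3)]]) (use that in auto)
    have "continuous_on {0..T} (\<lambda>t. integral {t..T} (\<lambda>s. g s \<omega>))"
      by (rule indefinite_integral_continuous_1'[OF set_borel_integral_eq_integral(1)[OF conjunct1[OF elim(3)]]])
    then have "continuous_on {0..T} (\<lambda>t. \<xi> \<omega> + integral {t..T} (\<lambda>s. g s \<omega>)
              - (\<Sum>k\<in>K. I k T \<omega> - I k t \<omega>) - (I0 T \<omega> - I0 t \<omega>))"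
      using elim(1,2) by (intro continuous_intros) auto
    then show ?case
    proof (rule continuous_on_eq)
      fix t assume t: "t \<in> {0..T}"
      show "\<xi> \<omega> + integral {t..T} (\<lambda>s. g s \<omega>) - (\<Sum>k\<in>K. I k T \<omega> - I k t \<omega>) - (I0 T \<omega> - I0 t \<omega>) = Y t \<omega>"
        using elim(3) t set_borel_integral_eq_integral(2)[OF si[OF t]] by simp
    qed
  qed
qed

lemma jointly_measurable_time_section:
  assumes Z: "jointly_measurable M T Z" and \<omega>: "\<omega> \<in> space M"
  shows "(\<lambda>u. Z u \<omega>) \<in> borel_measurable (time_measure T)"
proof -
  have "(\<lambda>u. (u, \<omega>)) \<in> time_measure T \<rightarrow>\<^sub>M time_measure T \<Otimes>\<^sub>M M"
    using \<omega> by (intro measurable_Pair measurable_const measurable_ident) auto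
  from measurable_compose[OF this Z[unfolded jointly_measurable_def]] show ?thesis by simp
qed

lemma four_squares: "(a + b + e + w)\<^sup>2 \<le> 4 * (a\<^sup>2 + b\<^sup>2 + e\<^sup>2 + (w::real)\<^sup>2)"
proof -
  have two: "(x + y)\<^sup>2 \<le> 2 * x\<^sup>2 + 2 * y\<^sup>2" for x y :: real
    using sum_squares_bound[of x y] by (simp add: power2_sum)
  show ?thesis using two[of "a + b" "e + w"] two[of a b] two[of e w] by (simp add: add.assoc)
qed

context product_noise
begin

text \<open>The error of a single particle, for all particles with the same constant. The difference of its equation and of
the coupled one is a \<open>bsde_difference\<close> in the filtration of all Brownian motions involved. The Lipschitz condition gives
\<open>|G| \<le> c (|D| + |Z - Z'| + |Z0 - Z0'| + W2)\<close>, but the Wasserstein distance \<open>W2\<close> along the solutions is not a priori a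
measurable process. It is replaced by the smallest nonnegative \<open>w\<close> for which this inequality holds: \<open>w\<close> is measurable
because the driver is, and the Lipschitz condition says that \<open>w \<le> W2\<close>.\<close>

lemma particle_error_estimate:
  fixes W0 :: "real \<Rightarrow> 'a \<Rightarrow> real ^ 'd::finite" and B :: "nat \<Rightarrow> real \<Rightarrow> 'b \<Rightarrow> real ^ 'd"
    and f :: "('a \<times> 'b, 'm::finite, 'd::finite) driver"
    and Y :: "real \<Rightarrow> 'a \<times> 'b \<Rightarrow> real ^ 'm"
    and Yn :: "nat \<Rightarrow> real \<Rightarrow> 'a \<times> 'b \<Rightarrow> real ^ 'm"
    and Zn :: "nat \<Rightarrow> nat \<Rightarrow> real \<Rightarrow> 'a \<times> 'b \<Rightarrow> real ^ 'd ^ 'm"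
    and Z0n :: "nat \<Rightarrow> real \<Rightarrow> 'a \<times> 'b \<Rightarrow> real ^ 'd ^ 'm"
    and Yt :: "real \<Rightarrow> 'a \<times> 'b \<Rightarrow> real ^ 'm"
    and Zt Z0t :: "real \<Rightarrow> 'a \<times> 'b \<Rightarrow> real ^ 'd ^ 'm"
  assumes T: "0 < T" and n: "n \<ge> 1" and i: "i \<in> {1..n}"
    and family: "brownian_family \<M> T {0..n} (\<lambda>k. if k = 0 then ext0 W0 else ext1 (B k))"
    and f_prog: "prog_measurable_driver T (aug_filtration \<M> T {ext0 W0}) f"
    and particles: "particle_solution P0 P1 T W0 B f \<xi>i n Yn Zn Z0n"
    and coupled: "coupled_solution P0 P1 T W0 B f (\<xi>i i) Y i Yt Zt Z0t"
    and lipschitz: "AE \<omega> in \<M>. \<forall>t\<in>{0..T}. \<forall>y y' z z' z0 z0'. \<forall>\<mu>\<in>P2. \<forall>\<nu>\<in>P2.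
      norm (f \<omega> t y z z0 \<mu> - f \<omega> t y' z' z0' \<nu>)
        \<le> Cf * (norm (y - y') + norm (z - z') + norm (z0 - z0') + W2 \<mu> \<nu>)"
    and L: "(\<lambda>(s, \<omega>). L s (fst \<omega>)) \<in> time_measure T \<Otimes>\<^sub>M \<M> \<rightarrow>\<^sub>M P2_algebra"
    and L_P2: "\<And>s \<omega>0. \<omega>0 \<in> space P0 \<Longrightarrow> L s \<omega>0 \<in> P2"
    and L_eq: "AE \<omega> in \<M>. \<forall>s\<in>{0..T}. cond_law P1 (Y s) (fst \<omega>) = L s (fst \<omega>)"
  defines "R \<equiv> (\<integral>\<^sup>+\<omega>. (SUP s\<in>{0..T}. cond_exp0 P1 (\<lambda>\<omega>'. ennreal
          ((W2 (empirical n (\<lambda>j. Yn j s \<omega>')) (cond_law P1 (Y s) (fst \<omega>')))\<^sup>2)) (fst \<omega>)) \<partial>\<M>)"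
  obtains S where "S \<in> borel_measurable \<M>"
    and "AE \<omega> in \<M>. \<forall>t\<in>{0..T}. particle_error T n i (Yn i) (Zn i) (Z0n i) Yt Zt Z0t t \<omega> \<le> S \<omega>"
    and "(\<integral>\<^sup>+\<omega>. S \<omega> \<partial>\<M>) \<le> ennreal (a_priori_const T (4 * (\<bar>Cf\<bar> + 1)\<^sup>2) * T) * R"
proof -
  let ?X = "\<lambda>k. if k = 0 then ext0 W0 else ext1 (B k)"
  interpret BF: brownian_family \<M> T "{0..n}" ?X by (rule family)
  let ?F = "aug_filtration \<M> T (?X ` {0..n})"
  have image: "insert (ext0 W0) ((\<lambda>k. ext1 (B k)) ` {1..n}) = ?X ` {0..n}"
    using n by (force simp: image_iff)
  have T0: "0 \<le> T" using T by simp
  note AP = BF.measurable_paths_family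
  have FM: "sets (?F t) \<subseteq> sets \<M>" for t by (rule aug_filtration_subset[OF AP])
  define H where "H = aug_filtration \<M> T {ext0 W0, ext1 (B i)}"
  have "{ext0 W0, ext1 (B i)} \<subseteq> ?X ` {0..n}" using i by (force simp: image_iff)
  then have HF: "sets (H t) \<subseteq> sets (?F t)" for t unfolding H_def by (intro aug_filtration_mono[OF AP]) auto
  then have HM: "sets (H t) \<subseteq> sets \<M>" for t using FM by blast
  have spH: "space (H t) = space \<M>" for t by (simp add: H_def)
  have W0F: "sets (aug_filtration \<M> T {ext0 W0} t) \<subseteq> sets \<M>" for t
    by (rule order_trans[OF aug_filtration_mono[OF AP _ order_refl] FM]) (force simp: image_iff)
  define g1 where "g1 s \<omega> = f \<omega> s (Yn i s \<omega>) (Zn i i s \<omega>) (Z0n i s \<omega>) (empirical n (\<lambda>j. Yn j s \<omega>))" for s \<omega>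
  \<comment> \<open>\<open>g\<close> is the drift of the coupled equation; \<open>g2\<close> is its jointly measurable version, equal to it at all times almost surely.\<close>
  define g where "g s \<omega> = f \<omega> s (Yt s \<omega>) (Zt s \<omega>) (Z0t s \<omega>) (cond_law P1 (Y s) (fst \<omega>))" for s \<omega>
  define g2 where "g2 s \<omega> = f \<omega> s (Yt s \<omega>) (Zt s \<omega>) (Z0t s \<omega>) (L s (fst \<omega>))" for s \<omega>
  have sol: "bsde_solution \<M> T ?F {1..n} (\<lambda>k. ext1 (B k)) (ext0 W0) (\<xi>i j)
      (\<lambda>s \<omega>. f \<omega> s (Yn j s \<omega>) (Zn j j s \<omega>) (Z0n j s \<omega>) (empirical n (\<lambda>j. Yn j s \<omega>))) (Yn j) (Zn j) (Z0n j)"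
    if "j \<in> {1..n}" for j
    using particles that unfolding particle_solution_def Let_def image by blast
  have Yn_S: "Yn j \<in> Sp \<M> T ?F 2" if "j \<in> {1..n}" for j using sol[OF that] unfolding bsde_solution_def by blast
  have Zn_H: "Zn i k \<in> Hp \<M> T ?F 2" if "k \<in> {1..n}" for k using sol[OF i] that unfolding bsde_solution_def by blast
  have Z0n_H: "Z0n i \<in> Hp \<M> T ?F 2" using sol[OF i] unfolding bsde_solution_def by blast
  obtain I I0 where I: "\<And>k. k \<in> {1..n} \<Longrightarrow> ito_integral \<M> T ?F (ext1 (B k)) (Zn i k) (I k)"
    and I0: "ito_integral \<M> T ?F (ext0 W0) (Z0n i) I0"
    and eq1: "AE \<omega> in \<M>. set_integrable lborel {0..T} (\<lambda>s. g1 s \<omega>) \<and>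
           (\<forall>t\<in>{0..T}. Yn i t \<omega> = \<xi>i i \<omega> + (LINT s:{t..T}|lborel. g1 s \<omega>)
              - (\<Sum>k\<in>{1..n}. I k T \<omega> - I k t \<omega>) - (I0 T \<omega> - I0 t \<omega>))"
    using sol[OF i] unfolding bsde_solution_def g1_def by blast
  have solt: "bsde_solution \<M> T H {i} (\<lambda>k. ext1 (B k)) (ext0 W0) (\<xi>i i) g Yt (\<lambda>_. Zt) Z0t"
    using coupled unfolding coupled_solution_def Let_def H_def g_def[abs_def] by blast
  have Yt_S: "Yt \<in> Sp \<M> T H 2" and Zt_H: "Zt \<in> Hp \<M> T H 2" and Z0t_H: "Z0t \<in> Hp \<M> T H 2"
    using solt unfolding bsde_solution_def by blast+
  obtain J J0 where J: "ito_integral \<M> T H (ext1 (B i)) Zt (J i)" and J0: "ito_integral \<M> T H (ext0 W0) Z0t J0"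
    and eq2: "AE \<omega> in \<M>. set_integrable lborel {0..T} (\<lambda>s. g s \<omega>) \<and>
           (\<forall>t\<in>{0..T}. Yt t \<omega> = \<xi>i i \<omega> + (LINT s:{t..T}|lborel. g s \<omega>)
              - (\<Sum>k\<in>{i}. J k T \<omega> - J k t \<omega>) - (J0 T \<omega> - J0 t \<omega>))"
    using solt unfolding bsde_solution_def by blast
  note JF = ito_integral_filtration_mono[where F=H and G="?F" and M=\<M>, OF _ spH space_aug_filtration HF]
  note jmF = prog_measurable_jointly_measurable[where F="?F" and M=\<M>, OF _ T0 space_aug_filtration FM]
  note jmH = prog_measurable_jointly_measurable[where F=H and M=\<M>, OF _ T0 spH HM]
  have jYn: "jointly_measurable \<M> T (Yn j)" if "j \<in> {1..n}" for j by (rule jmF[OF Sp_two(1)[OF Yn_S[OF that]]])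
  have jZn: "jointly_measurable \<M> T (Zn i k)" if "k \<in> {1..n}" for k using jmF Zn_H[OF that] by (auto simp: Hp_def)
  have jZ0n: "jointly_measurable \<M> T (Z0n i)" using jmF Z0n_H by (auto simp: Hp_def)
  have jYt: "jointly_measurable \<M> T Yt" by (rule jmH[OF Sp_two(1)[OF Yt_S]])
  have jZt: "jointly_measurable \<M> T Zt" using jmH Zt_H by (auto simp: Hp_def)
  have jZ0t: "jointly_measurable \<M> T Z0t" using jmH Z0t_H by (auto simp: Hp_def)

  \<comment> \<open>Both equations are written with one integral per member of the family; the coupled one has the integrand 0 for the noises of the other particles.\<close>
  define \<zeta> where "\<zeta> k = (if k = 0 then Z0n i else Zn i k)" for k
  define \<zeta>' where "\<zeta>' k = (if k = 0 then Z0t else if k = i then Zt else (\<lambda>_ _. 0))" for k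
  define A where "A k = (if k = 0 then I0 else I k)" for k
  define A' where "A' k = (if k = 0 then J0 else if k = i then J i else (\<lambda>_ _. 0))" for k
  have A: "ito_integral \<M> T ?F (?X k) (\<zeta> k) (A k)" if "k \<in> {0..n}" for k
    using I[of k] I0 that by (auto simp: \<zeta>_def A_def)
  have A': "ito_integral \<M> T ?F (?X k) (\<zeta>' k) (A' k)" if "k \<in> {0..n}" for k
    using JF[OF J] JF[OF J0] ito_integral_zero[OF T0] i that by (auto simp: \<zeta>'_def A'_def)
  have j\<zeta>: "jointly_measurable \<M> T (\<zeta> k)" if "k \<in> {0..n}" for k
    using jZn[of k] jZ0n that by (auto simp: \<zeta>_def)
  have j\<zeta>': "jointly_measurable \<M> T (\<zeta>' k)" if "k \<in> {0..n}" for k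
    using jZt jZ0t by (auto simp: \<zeta>'_def jointly_measurable_def)
  define N where "N t \<omega> = (\<Sum>k\<in>{0..n}. A k t \<omega> - A' k t \<omega>)" for t \<omega>
  define q where "q x = (\<Sum>k\<in>{0..n}. ennreal ((norm (\<zeta> k (fst x) (snd x) - \<zeta>' k (fst x) (snd x)))\<^sup>2))" for x
  note isd = BF.ito_sum_difference[OF A j\<zeta> A' j\<zeta>', folded N_def q_def]
  have q_m: "q \<in> borel_measurable (time_measure T \<Otimes>\<^sub>M \<M>)"
    unfolding q_def[abs_def]
  proof (rule borel_measurable_sum)
    fix k assume "k \<in> {0..n}"
    then have [measurable]: "(\<lambda>x. \<zeta> k (fst x) (snd x)) \<in> borel_measurable (time_measure T \<Otimes>\<^sub>M \<M>)"
      "(\<lambda>x. \<zeta>' k (fst x) (snd x)) \<in> borel_measurable (time_measure T \<Otimes>\<^sub>M \<M>)"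
      using j\<zeta> j\<zeta>' by (simp_all add: jointly_measurable_def case_prod_beta')
    show "(\<lambda>x. ennreal ((norm (\<zeta> k (fst x) (snd x) - \<zeta>' k (fst x) (snd x)))\<^sup>2)) \<in> borel_measurable (time_measure T \<Otimes>\<^sub>M \<M>)"
      by measurable
  qed
  interpret SM: square_martingale \<M> T ?F N q
    by unfold_locales
      (use T BF.subalgebra_aug BF.\<F>_mono isd q_m in \<open>simp_all add: N_def[abs_def] q_def\<close>)

  \<comment> \<open>The Lipschitz constant may be 0 or negative; division by \<open>c\<close> requires a positive one.\<close>
  define c where "c = \<bar>Cf\<bar> + 1"
  have c: "0 < c" "Cf \<le> c" by (auto simp: c_def)
  define D where "D t \<omega> = Yn i t \<omega> - Yt t \<omega>" for t \<omega>
  define G where "G t \<omega> = g1 t \<omega> - g2 t \<omega>" for t \<omega>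
  define z where "z t \<omega> = norm (Zn i i t \<omega> - Zt t \<omega>)" for t \<omega>
  define z0 where "z0 t \<omega> = norm (Z0n i t \<omega> - Z0t t \<omega>)" for t \<omega>
  \<comment> \<open>The least nonnegative source that makes the linear growth bound true.\<close>
  define w where "w t \<omega> = max 0 (norm (G t \<omega>) / c - norm (D t \<omega>) - z t \<omega> - z0 t \<omega>)" for t \<omega>
  define h where "h x = ennreal ((w (fst x) (snd x))\<^sup>2)" for x
  have jg1: "jointly_measurable \<M> T g1"
    unfolding g1_def[abs_def]
    by (rule driver_jointly_measurable[OF f_prog T0 space_aug_filtration W0F jYn[OF i] jZn[OF i] jZ0n])
      (rule empirical_measurable[OF n jYn])
  have jg2: "jointly_measurable \<M> T g2"
    unfolding g2_def[abs_def]
    by (rule driver_jointly_measurable[OF f_prog T0 space_aug_filtration W0F jYt jZt jZ0t L])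
  have jG: "jointly_measurable \<M> T G"
    using jg1 jg2 by (simp add: G_def jointly_measurable_def case_prod_beta' borel_measurable_diff)
  have jD: "jointly_measurable \<M> T D"
    using jYn[OF i] jYt by (simp add: D_def jointly_measurable_def case_prod_beta' borel_measurable_diff)
  have h_m: "h \<in> borel_measurable (time_measure T \<Otimes>\<^sub>M \<M>)"
  proof -
    have [measurable]: "(\<lambda>x. G (fst x) (snd x)) \<in> borel_measurable (time_measure T \<Otimes>\<^sub>M \<M>)"
      "(\<lambda>x. D (fst x) (snd x)) \<in> borel_measurable (time_measure T \<Otimes>\<^sub>M \<M>)"
      "(\<lambda>x. Zn i i (fst x) (snd x)) \<in> borel_measurable (time_measure T \<Otimes>\<^sub>M \<M>)"
      "(\<lambda>x. Zt (fst x) (snd x)) \<in> borel_measurable (time_measure T \<Otimes>\<^sub>M \<M>)"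
      "(\<lambda>x. Z0n i (fst x) (snd x)) \<in> borel_measurable (time_measure T \<Otimes>\<^sub>M \<M>)"
      "(\<lambda>x. Z0t (fst x) (snd x)) \<in> borel_measurable (time_measure T \<Otimes>\<^sub>M \<M>)"
      using jG jD jZn[OF i] jZt jZ0n jZ0t by (simp_all add: jointly_measurable_def case_prod_beta')
    show ?thesis unfolding h_def w_def z_def z0_def by measurable
  qed
  have qz: "ennreal ((z u \<omega>)\<^sup>2) + ennreal ((z0 u \<omega>)\<^sup>2) \<le> q (u, \<omega>)" for u \<omega>
  proof -
    have "(\<Sum>k\<in>{0, i}. ennreal ((norm (\<zeta> k u \<omega> - \<zeta>' k u \<omega>))\<^sup>2)) \<le> q (u, \<omega>)"
      unfolding q_def fst_conv snd_conv using i by (intro sum_mono2) auto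
    then show ?thesis using i by (simp add: \<zeta>_def \<zeta>'_def z_def z0_def add.commute)
  qed
  have growth: "ennreal ((norm (G u \<omega>))\<^sup>2) \<le> ennreal (4 * c\<^sup>2) * (ennreal ((norm (D u \<omega>))\<^sup>2) + q (u, \<omega>) + h (u, \<omega>))" for u \<omega>
  proof -
    have "norm (G u \<omega>) / c - norm (D u \<omega>) - z u \<omega> - z0 u \<omega> \<le> w u \<omega>" by (simp add: w_def)
    then have "norm (G u \<omega>) / c \<le> norm (D u \<omega>) + z u \<omega> + z0 u \<omega> + w u \<omega>" by linarith
    then have "norm (G u \<omega>) \<le> c * (norm (D u \<omega>) + z u \<omega> + z0 u \<omega> + w u \<omega>)"
      using c(1) by (simp add: pos_divide_le_eq mult.commute)
    then have "(norm (G u \<omega>))\<^sup>2 \<le> (c * (norm (D u \<omega>) + z u \<omega> + z0 u \<omega> + w u \<omega>))\<^sup>2"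
      by (intro power_mono) auto
    also have "\<dots> = c\<^sup>2 * (norm (D u \<omega>) + z u \<omega> + z0 u \<omega> + w u \<omega>)\<^sup>2" by (rule power_mult_distrib)
    also have "\<dots> \<le> c\<^sup>2 * (4 * ((norm (D u \<omega>))\<^sup>2 + (z u \<omega>)\<^sup>2 + (z0 u \<omega>)\<^sup>2 + (w u \<omega>)\<^sup>2))"
      by (intro mult_left_mono four_squares) auto
    also have "\<dots> = 4 * c\<^sup>2 * ((norm (D u \<omega>))\<^sup>2 + (z u \<omega>)\<^sup>2 + (z0 u \<omega>)\<^sup>2 + (w u \<omega>)\<^sup>2)" by simp
    finally have "ennreal ((norm (G u \<omega>))\<^sup>2) \<le> ennreal (4 * c\<^sup>2 * ((norm (D u \<omega>))\<^sup>2 + (z u \<omega>)\<^sup>2 + (z0 u \<omega>)\<^sup>2 + (w u \<omega>)\<^sup>2))"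
      by (rule ennreal_leI)
    also have "\<dots> = ennreal (4 * c\<^sup>2) * ennreal ((norm (D u \<omega>))\<^sup>2 + (z u \<omega>)\<^sup>2 + (z0 u \<omega>)\<^sup>2 + (w u \<omega>)\<^sup>2)"
      by (rule ennreal_mult) auto
    also have "ennreal ((norm (D u \<omega>))\<^sup>2 + (z u \<omega>)\<^sup>2 + (z0 u \<omega>)\<^sup>2 + (w u \<omega>)\<^sup>2)
      = ennreal ((norm (D u \<omega>))\<^sup>2) + (ennreal ((z u \<omega>)\<^sup>2) + ennreal ((z0 u \<omega>)\<^sup>2)) + h (u, \<omega>)"
      by (simp add: h_def add.assoc)
    also have "ennreal (4 * c\<^sup>2) * \<dots> \<le> ennreal (4 * c\<^sup>2) * (ennreal ((norm (D u \<omega>))\<^sup>2) + q (u, \<omega>) + h (u, \<omega>))"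
      by (intro mult_left_mono add_mono qz) auto
    finally show ?thesis .
  qed
  have equation: "AE \<omega> in \<M>. set_integrable lborel {0..T} (\<lambda>s. G s \<omega>) \<and>
      (\<forall>t\<in>{0..T}. D t \<omega> = (LINT s:{t..T}|lborel. G s \<omega>) - (N T \<omega> - N t \<omega>))"
    using eq1 eq2 L_eq
  proof eventually_elim
    case (elim \<omega>)
    have gg: "g s \<omega> = g2 s \<omega>" if "s \<in> {0..T}" for s
      using elim(3) that by (simp add: g_def g2_def)
    have i1: "set_integrable lborel {0..T} (\<lambda>s. g1 s \<omega>)" using elim(1) by blast
    have i2: "set_integrable lborel {0..T} (\<lambda>s. g2 s \<omega>)"
      using elim(2) set_integrable_cong[of lborel lborel "{0..T}" "{0..T}" "\<lambda>s. g s \<omega>" "\<lambda>s. g2 s \<omega>"] gg by simp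
    have iG: "set_integrable lborel {0..T} (\<lambda>s. G s \<omega>)"
      unfolding G_def by (rule set_integral_diff(1)[OF i1 i2])
    have Nsum: "N t \<omega> = (I0 t \<omega> - J0 t \<omega>) + ((\<Sum>k\<in>{1..n}. I k t \<omega>) - J i t \<omega>)" for t
    proof -
      have set: "{0..n} = insert 0 {1..n}" by auto
      have "(\<Sum>k\<in>{1..n}. A' k t \<omega>) = (\<Sum>k\<in>{1..n}. if k = i then J i t \<omega> else 0)"
        by (intro sum.cong) (auto simp: A'_def)
      also have "\<dots> = J i t \<omega>" using i by simp
      finally have "(\<Sum>k\<in>{1..n}. A' k t \<omega>) = J i t \<omega>" .
      moreover have "(\<Sum>k\<in>{1..n}. A k t \<omega>) = (\<Sum>k\<in>{1..n}. I k t \<omega>)"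
        by (intro sum.cong) (auto simp: A_def)
      ultimately show ?thesis
        unfolding N_def set by (simp add: A_def A'_def sum_subtractf)
    qed
    have "D t \<omega> = (LINT s:{t..T}|lborel. G s \<omega>) - (N T \<omega> - N t \<omega>)" if t: "t \<in> {0..T}" for t
    proof -
      have s1: "set_integrable lborel {t..T} (\<lambda>s. g1 s \<omega>)" by (rule set_integrable_subset[OF i1]) (use t in auto)
      have s2: "set_integrable lborel {t..T} (\<lambda>s. g2 s \<omega>)" by (rule set_integrable_subset[OF i2]) (use t in auto)
      have e1: "(LINT s:{t..T}|lborel. g s \<omega>) = (LINT s:{t..T}|lborel. g2 s \<omega>)"
        by (rule set_lebesgue_integral_cong) (use t gg in auto)
      have e2: "(LINT s:{t..T}|lborel. G s \<omega>) = (LINT s:{t..T}|lborel. g1 s \<omega>) - (LINT s:{t..T}|lborel. g2 s \<omega>)"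
        unfolding G_def by (rule set_integral_diff(2)[OF s1 s2])
      have e3: "Yn i t \<omega> = \<xi>i i \<omega> + (LINT s:{t..T}|lborel. g1 s \<omega>) - (\<Sum>k\<in>{1..n}. I k T \<omega> - I k t \<omega>) - (I0 T \<omega> - I0 t \<omega>)"
        using elim(1) t by blast
      have e4: "Yt t \<omega> = \<xi>i i \<omega> + (LINT s:{t..T}|lborel. g s \<omega>) - (J i T \<omega> - J i t \<omega>) - (J0 T \<omega> - J0 t \<omega>)"
        using elim(2) t by simp
      show ?thesis
        unfolding D_def e3 e4 e1 e2 Nsum sum_subtractf by (simp add: algebra_simps)
    qed
    then show ?case using iG by blast
  qed
  have D_ad: "D t \<in> borel_measurable (?F t)" if t: "t \<in> {0..T}" for t
    unfolding D_def
  proof (rule borel_measurable_diff)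
    show "Yn i t \<in> borel_measurable (?F t)"
      by (rule prog_measurable_adapted[OF Sp_two(1)[OF Yn_S[OF i]] t])
    show "Yt t \<in> borel_measurable (?F t)"
      by (rule measurable_sub_algebra[OF prog_measurable_adapted[OF Sp_two(1)[OF Yt_S] t] _ HF]) (simp only: spH space_aug_filtration)
  qed
  have D_bd: "\<exists>C<\<infinity>. \<forall>t\<in>{0..T}. (\<integral>\<^sup>+\<omega>. ennreal ((norm (D t \<omega>))\<^sup>2) \<partial>\<M>) \<le> C"
  proof -
    let ?a = "\<integral>\<^sup>+\<omega>. (SUP t\<in>{0..T}. ennreal ((norm (Yn i t \<omega>))\<^sup>2)) \<partial>\<M>"
    let ?b = "\<integral>\<^sup>+\<omega>. (SUP t\<in>{0..T}. ennreal ((norm (Yt t \<omega>))\<^sup>2)) \<partial>\<M>"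
    have ab: "?a < \<infinity>" "?b < \<infinity>" by (rule Sp_two(2)[OF Yn_S[OF i]] Sp_two(2)[OF Yt_S])+
    have "(\<integral>\<^sup>+\<omega>. ennreal ((norm (D t \<omega>))\<^sup>2) \<partial>\<M>) \<le> 2 * ?a + 2 * ?b" if t: "t \<in> {0..T}" for t
    proof -
      have [measurable]: "Yn i t \<in> borel_measurable \<M>" "Yt t \<in> borel_measurable \<M>"
        by (rule jointly_measurable_section[OF jYn[OF i] t] jointly_measurable_section[OF jYt t])+
      have "(\<integral>\<^sup>+\<omega>. ennreal ((norm (D t \<omega>))\<^sup>2) \<partial>\<M>)
        \<le> (\<integral>\<^sup>+\<omega>. 2 * ennreal ((norm (Yn i t \<omega>))\<^sup>2) + 2 * ennreal ((norm (Yt t \<omega>))\<^sup>2) \<partial>\<M>)"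
      proof (intro nn_integral_mono ennreal_le_twice_add)
        fix \<omega> show "(norm (D t \<omega>))\<^sup>2 \<le> 2 * (norm (Yn i t \<omega>))\<^sup>2 + 2 * (norm (Yt t \<omega>))\<^sup>2"
          using norm_add_power2_le[of "Yn i t \<omega>" "- Yt t \<omega>"] by (simp add: D_def)
      qed auto
      also have "\<dots> = 2 * (\<integral>\<^sup>+\<omega>. ennreal ((norm (Yn i t \<omega>))\<^sup>2) \<partial>\<M>) + 2 * (\<integral>\<^sup>+\<omega>. ennreal ((norm (Yt t \<omega>))\<^sup>2) \<partial>\<M>)"
        by (simp add: nn_integral_add nn_integral_cmult)
      also have "\<dots> \<le> 2 * ?a + 2 * ?b"
        using t by (intro add_mono mult_left_mono nn_integral_mono SUP_upper) auto
      finally show ?thesis .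
    qed
    moreover have "2 * ?a + 2 * ?b < \<infinity>" using ab by (simp add: ennreal_mult_less_top)
    ultimately show ?thesis by blast
  qed
  have q_fin: "(\<integral>\<^sup>+x. q x \<partial>(time_measure T \<Otimes>\<^sub>M \<M>)) < \<infinity>"
  proof -
    have "(\<integral>\<^sup>+x. q x \<partial>(time_measure T \<Otimes>\<^sub>M \<M>)) = (\<integral>\<^sup>+x. q x * indicator {0..T} (fst x) \<partial>(time_measure T \<Otimes>\<^sub>M \<M>))"
      by (intro nn_integral_cong) (auto simp: space_pair_measure)
    also have "\<dots> = (\<integral>\<^sup>+\<omega>. ennreal ((norm (N T \<omega> - N 0 \<omega>))\<^sup>2) \<partial>\<M>)"
      using SM.isometry[of 0 T] T by simp
    also have "\<dots> < \<infinity>"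
      using square_integrable_diff[OF SM.square[of T] SM.square[of 0]] T
      by (subst nn_integral_square_integrable) auto
    finally show ?thesis .
  qed
  interpret BD: bsde_difference \<M> T ?F N q D G h "4 * c\<^sup>2"
    by unfold_locales (use c D_ad jD jG h_m D_bd q_fin growth equation in auto)
  obtain S where S: "S \<in> borel_measurable \<M>"
    "AE \<omega> in \<M>. \<forall>t\<in>{0..T}. ennreal ((norm (D t \<omega>))\<^sup>2) + (\<integral>\<^sup>+u\<in>{0..T}. q (u, \<omega>) \<partial>lborel) \<le> S \<omega>"
    "(\<integral>\<^sup>+\<omega>. S \<omega> \<partial>\<M>) \<le> ennreal (a_priori_const T (4 * c\<^sup>2)) * (\<integral>\<^sup>+x. h x \<partial>(time_measure T \<Otimes>\<^sub>M \<M>))"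
    by (rule BD.a_priori_estimate)
  have err: "particle_error T n i (Yn i) (Zn i) (Z0n i) Yt Zt Z0t t \<omega>
      \<le> ennreal ((norm (D t \<omega>))\<^sup>2) + (\<integral>\<^sup>+u\<in>{0..T}. q (u, \<omega>) \<partial>lborel)" if \<omega>: "\<omega> \<in> space \<M>" and t: "t \<in> {0..T}" for t \<omega>
  proof -
    let ?q0 = "\<lambda>u. ennreal ((norm (Z0n i u \<omega> - Z0t u \<omega>))\<^sup>2)"
    let ?q1 = "\<lambda>u. \<Sum>k=1..n. ennreal ((norm (Zn i k u \<omega> - of_bool (i = k) *\<^sub>R Zt u \<omega>))\<^sup>2)"
    have q: "q (u, \<omega>) = ?q0 u + ?q1 u" for u
    proof -
      have set: "{0..n} = insert 0 {1..n}" by auto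
      have "(\<Sum>k=1..n. ennreal ((norm (\<zeta> k u \<omega> - \<zeta>' k u \<omega>))\<^sup>2)) = ?q1 u"
        by (intro sum.cong) (auto simp: \<zeta>_def \<zeta>'_def)
      moreover have "\<zeta> 0 = Z0n i" "\<zeta>' 0 = Z0t" by (simp_all add: \<zeta>_def \<zeta>'_def)
      moreover have "q (u, \<omega>) = ennreal ((norm (\<zeta> 0 u \<omega> - \<zeta>' 0 u \<omega>))\<^sup>2)
          + (\<Sum>k=1..n. ennreal ((norm (\<zeta> k u \<omega> - \<zeta>' k u \<omega>))\<^sup>2))"
        unfolding q_def set fst_conv snd_conv by (rule sum.insert) auto
      ultimately show ?thesis by (simp only:)
    qed
    note [measurable] = jointly_measurable_time_section[OF jZ0n \<omega>] jointly_measurable_time_section[OF jZ0t \<omega>]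
      jointly_measurable_time_section[OF jZt \<omega>]
    have m0: "?q0 \<in> borel_measurable (time_measure T)" by measurable
    have m1: "?q1 \<in> borel_measurable (time_measure T)"
    proof (rule borel_measurable_sum)
      fix k assume "k \<in> {1..n}"
      note [measurable] = jointly_measurable_time_section[OF jZn[OF this] \<omega>]
      show "(\<lambda>u. ennreal ((norm (Zn i k u \<omega> - of_bool (i = k) *\<^sub>R Zt u \<omega>))\<^sup>2)) \<in> borel_measurable (time_measure T)"
        by measurable
    qed
    have "(\<integral>\<^sup>+u\<in>{t..T}. ?q0 u \<partial>lborel) + (\<integral>\<^sup>+u\<in>{t..T}. ?q1 u \<partial>lborel)
      \<le> (\<integral>\<^sup>+u\<in>{0..T}. ?q0 u \<partial>lborel) + (\<integral>\<^sup>+u\<in>{0..T}. ?q1 u \<partial>lborel)"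
      using t by (intro add_mono nn_integral_mono) (auto simp: indicator_def)
    also have "\<dots> = (\<integral>\<^sup>+u\<in>{0..T}. q (u, \<omega>) \<partial>lborel)"
      unfolding q nn_integral_time_measure[symmetric] by (rule nn_integral_add[OF m0 m1, symmetric])
    finally show ?thesis
      unfolding particle_error_def by (simp add: D_def add.assoc add_left_mono)
  qed
  have S_err: "AE \<omega> in \<M>. \<forall>t\<in>{0..T}. particle_error T n i (Yn i) (Zn i) (Z0n i) Yt Zt Z0t t \<omega> \<le> S \<omega>"
    using S(2) AE_space by eventually_elim (use err order_trans in blast)
  have h_le: "AE \<omega> in \<M>. \<forall>s\<in>{0..T}. h (s, \<omega>) \<le> ennreal ((W2 (empirical n (\<lambda>j. Yn j s \<omega>)) (cond_law P1 (Y s) (fst \<omega>)))\<^sup>2)"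
    using lipschitz L_eq AE_space
  proof eventually_elim
    case (elim \<omega>)
    show ?case
    proof
      fix s assume s: "s \<in> {0..T}"
      let ?W = "W2 (empirical n (\<lambda>j. Yn j s \<omega>)) (cond_law P1 (Y s) (fst \<omega>))"
      let ?b = "norm (D s \<omega>) + z s \<omega> + z0 s \<omega> + ?W"
      have Ls: "cond_law P1 (Y s) (fst \<omega>) = L s (fst \<omega>)" using elim(2) s by blast
      have "L s (fst \<omega>) \<in> P2" using elim(3) by (intro L_P2) (auto simp: space_M)
      then have "norm (G s \<omega>) \<le> Cf * ?b"
        using elim(1) s empirical_in_P2[OF n] unfolding G_def g1_def g2_def D_def z_def z0_def Ls by blast
      also have "\<dots> \<le> c * ?b"
        using c W2_nonneg by (intro mult_right_mono add_nonneg_nonneg) (auto simp: z_def z0_def)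
      finally have "norm (G s \<omega>) / c \<le> ?b" using c(1) by (simp add: pos_divide_le_eq mult.commute)
      then have "w s \<omega> \<le> ?W" using W2_nonneg by (simp add: w_def)
      then have "(w s \<omega>)\<^sup>2 \<le> ?W\<^sup>2" by (intro power_mono) (auto simp: w_def)
      then show "h (s, \<omega>) \<le> ennreal (?W\<^sup>2)" by (simp add: h_def ennreal_leI)
    qed
  qed
  have "(\<integral>\<^sup>+x. h x \<partial>(time_measure T \<Otimes>\<^sub>M \<M>)) = (\<integral>\<^sup>+u\<in>{0..T}. (\<integral>\<^sup>+\<omega>. h (u, \<omega>) \<partial>\<M>) \<partial>lborel)"
    by (rule prob_space.nn_integral_time_pair(2)[OF prob_space_M h_m])
  also have "\<dots> \<le> (\<integral>\<^sup>+u. R * indicator {0..T} u \<partial>lborel)"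
  proof (rule nn_integral_mono)
    fix u :: real
    show "(\<integral>\<^sup>+\<omega>. h (u, \<omega>) \<partial>\<M>) * indicator {0..T} u \<le> R * indicator {0..T} u"
    proof (cases "u \<in> {0..T}")
      case u: True
      have "(\<integral>\<^sup>+\<omega>. h (u, \<omega>) \<partial>\<M>) \<le> R"
        unfolding R_def
      proof (rule integral_le_SUP_cond_exp0[OF _ u])
        have "(\<lambda>\<omega>. (u, \<omega>)) \<in> \<M> \<rightarrow>\<^sub>M time_measure T \<Otimes>\<^sub>M \<M>"
          using u by (intro measurable_Pair measurable_const measurable_ident) auto
        from measurable_compose[OF this h_m] show "(\<lambda>\<omega>. h (u, \<omega>)) \<in> borel_measurable \<M>" .
        show "AE \<omega> in \<M>. h (u, \<omega>) \<le> ennreal ((W2 (empirical n (\<lambda>j. Yn j u \<omega>)) (cond_law P1 (Y u) (fst \<omega>)))\<^sup>2)"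
          using h_le by eventually_elim (use u in blast)
      qed
      then show ?thesis using u by simp
    qed simp
  qed
  also have "\<dots> = ennreal T * R"
    using T0 by (simp add: nn_integral_cmult_indicator mult.commute)
  finally have "(\<integral>\<^sup>+x. h x \<partial>(time_measure T \<Otimes>\<^sub>M \<M>)) \<le> ennreal T * R" .
  then have "(\<integral>\<^sup>+\<omega>. S \<omega> \<partial>\<M>) \<le> ennreal (a_priori_const T (4 * c\<^sup>2)) * (ennreal T * R)"
    using S(3) by (meson mult_left_mono order_trans zero_le)
  also have "\<dots> = ennreal (a_priori_const T (4 * c\<^sup>2) * T) * R"
    using T0 a_priori_const_pos[OF T, of "4 * c\<^sup>2"] c(1) by (simp add: ennreal_mult mult.assoc)
  finally show ?thesis using that S(1) S_err unfolding c_def by blast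
qed

end

theorem proposition13:
  fixes P0 :: "'a measure" and P1 :: "'b measure" and T Cf p :: real
    and W0 :: "real \<Rightarrow> 'a \<Rightarrow> real ^ 'd"
    and W :: "real \<Rightarrow> 'b \<Rightarrow> real ^ 'd" and B :: "nat \<Rightarrow> real \<Rightarrow> 'b \<Rightarrow> real ^ 'd"
    and \<Psi> :: "(real \<Rightarrow> real ^ 'd) \<Rightarrow> (real \<Rightarrow> real ^ 'd) \<Rightarrow> real ^ 'm"
    and f :: "('a \<times> 'b, 'm, 'd) driver"
    and \<xi> :: "'a \<times> 'b \<Rightarrow> real ^ 'm" and \<xi>i :: "nat \<Rightarrow> 'a \<times> 'b \<Rightarrow> real ^ 'm"
    and Y :: "real \<Rightarrow> 'a \<times> 'b \<Rightarrow> real ^ 'm" and Z Z0 :: "real \<Rightarrow> 'a \<times> 'b \<Rightarrow> real ^ 'd ^ 'm"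
    and Yn :: "nat \<Rightarrow> nat \<Rightarrow> real \<Rightarrow> 'a \<times> 'b \<Rightarrow> real ^ 'm"
    and Zn :: "nat \<Rightarrow> nat \<Rightarrow> nat \<Rightarrow> real \<Rightarrow> 'a \<times> 'b \<Rightarrow> real ^ 'd ^ 'm"
    and Z0n :: "nat \<Rightarrow> nat \<Rightarrow> real \<Rightarrow> 'a \<times> 'b \<Rightarrow> real ^ 'd ^ 'm"
    and Yt :: "nat \<Rightarrow> real \<Rightarrow> 'a \<times> 'b \<Rightarrow> real ^ 'm"
    and Zt Z0t :: "nat \<Rightarrow> real \<Rightarrow> 'a \<times> 'b \<Rightarrow> real ^ 'd ^ 'm"
  assumes T: "T > 0"
    and P0: "prob_space P0" "complete_measure P0"
    and P1: "prob_space P1" "complete_measure P1"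
    and W0: "brownian_motion P0 T W0"
    and W: "brownian_motion P1 T W"
    and B: "\<And>i. i \<ge> 1 \<Longrightarrow> brownian_motion P1 T (B i)"
    and indep: "prob_space.indep_vars P1 (\<lambda>_. Pi\<^sub>M {0..T} (\<lambda>_. borel))
      (\<lambda>i. sample_path T (if i = 0 then W else B i)) (UNIV :: nat set)"
    and f_prog: "prog_measurable_driver T (aug_filtration (prod_space P0 P1) T {ext0 W0}) f"
    and f_common: "\<And>\<omega>0 \<omega>1 \<omega>1'. \<omega>0 \<in> space P0 \<Longrightarrow> \<omega>1 \<in> space P1 \<Longrightarrow> \<omega>1' \<in> space P1 \<Longrightarrow>
      f (\<omega>0, \<omega>1) = f (\<omega>0, \<omega>1')"
    and \<Psi>: "(\<lambda>(w0, w). \<Psi> w0 w) \<in> borel_measurable (path_space T \<Otimes>\<^sub>M path_space T)"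
    and \<xi>: "\<xi> = (\<lambda>\<omega>. \<Psi> (sample_path T W0 (fst \<omega>)) (sample_path T W (snd \<omega>)))"
    and \<xi>i: "\<And>i. i \<ge> 1 \<Longrightarrow> \<xi>i i = (\<lambda>\<omega>. \<Psi> (sample_path T W0 (fst \<omega>)) (sample_path T (B i) (snd \<omega>)))"
    and limit: "limit_solution P0 P1 T W0 W f \<xi> Y Z Z0"
    and particles: "\<And>n. n \<ge> 1 \<Longrightarrow>
      particle_solution P0 P1 T W0 B f \<xi>i n (Yn n) (Zn n) (Z0n n)"
    and coupled: "\<And>i. i \<ge> 1 \<Longrightarrow>
      coupled_solution P0 P1 T W0 B f (\<xi>i i) Y i (Yt i) (Zt i) (Z0t i)"
    and \<xi>_L2: "\<xi> \<in> Lp (prod_space P0 P1) 2"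
    and f_lipschitz: "AE \<omega> in prod_space P0 P1. \<forall>t\<in>{0..T}. \<forall>y y' z z' z0 z0'. \<forall>\<mu>\<in>P2. \<forall>\<nu>\<in>P2.
      norm (f \<omega> t y z z0 \<mu> - f \<omega> t y' z' z0' \<nu>)
        \<le> Cf * (norm (y - y') + norm (z - z') + norm (z0 - z0') + W2 \<mu> \<nu>)"
    and f_L2: "(\<integral>\<^sup>+\<omega>. (\<integral>\<^sup>+s\<in>{0..T}. ennreal ((norm (f \<omega> s 0 0 0 (return borel 0)))\<^sup>2) \<partial>lborel)
      \<partial>prod_space P0 P1) < \<infinity>"
    and p: "p > 4"
    and \<xi>_Lp: "\<xi> \<in> Lp (prod_space P0 P1) p"
    and f_Hp: "(\<lambda>s \<omega>. f \<omega> s 0 0 0 (return borel 0))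
      \<in> Hp (prod_space P0 P1) T (aug_filtration (prod_space P0 P1) T {ext0 W0}) p"
  shows "\<exists>C>0. \<forall>n\<ge>1.
      (\<integral>\<^sup>+\<omega>. (SUP t\<in>{0..T}. cond_exp0 P1 (\<lambda>\<omega>'. ennreal (1 / real n) *
          (\<Sum>i=1..n. particle_error T n i (Yn n i) (Zn n i) (Z0n n i) (Yt i) (Zt i) (Z0t i) t \<omega>'))
          (fst \<omega>)) \<partial>prod_space P0 P1)
      \<le> ennreal C * (\<integral>\<^sup>+\<omega>. (SUP s\<in>{0..T}. cond_exp0 P1 (\<lambda>\<omega>'. ennreal
          ((W2 (empirical n (\<lambda>j. Yn n j s \<omega>')) (cond_law P1 (Y s) (fst \<omega>')))\<^sup>2))
          (fst \<omega>)) \<partial>prod_space P0 P1)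
    \<and> (\<forall>i\<in>{1..n}.
      (\<integral>\<^sup>+\<omega>. (SUP t\<in>{0..T}. cond_exp0 P1
          (particle_error T n i (Yn n i) (Zn n i) (Z0n n i) (Yt i) (Zt i) (Z0t i) t)
          (fst \<omega>)) \<partial>prod_space P0 P1)
      \<le> ennreal C * (\<integral>\<^sup>+\<omega>. (SUP s\<in>{0..T}. cond_exp0 P1 (\<lambda>\<omega>'. ennreal
          ((W2 (empirical n (\<lambda>j. Yn n j s \<omega>')) (cond_law P1 (Y s) (fst \<omega>')))\<^sup>2))
          (fst \<omega>)) \<partial>prod_space P0 P1))"
proof -
  interpret PN: product_noise P0 P1 using P0(1) P1(1) by (rule product_noise.intro)
  let ?M = "prod_space P0 P1"
  have T0: "0 \<le> T" using T by simp
  let ?F = "aug_filtration ?M T {ext0 W0, ext1 W}"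
  have bm0: "brownian_motion ?M T (ext0 W0)"
    using brownian_motion_pullback[OF PN.prob_space_M PN.fst_measurable PN.distr_fst W0] by (simp add: ext0_def)
  have bm1: "brownian_motion ?M T (ext1 W)"
    using brownian_motion_pullback[OF PN.prob_space_M PN.snd_measurable PN.distr_snd W] by (simp add: ext1_def)
  have AP: "measurable_paths ?M T {ext0 W0, ext1 W}"
    using brownian_motion_measurable[OF bm0] brownian_motion_measurable[OF bm1] by (simp add: measurable_paths_def)
  have sol: "bsde_solution ?M T ?F {()} (\<lambda>_. ext1 W) (ext0 W0) \<xi>
        (\<lambda>s \<omega>. f \<omega> s (Y s \<omega>) (Z s \<omega>) (Z0 s \<omega>) (cond_law P1 (Y s) (fst \<omega>))) Y (\<lambda>_. Z) Z0"
    using limit unfolding limit_solution_def Let_def .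
  have YS: "Y \<in> Sp ?M T ?F 2" using sol unfolding bsde_solution_def by blast
  have jY: "jointly_measurable ?M T Y"
    by (rule prog_measurable_jointly_measurable[OF Sp_two(1)[OF YS] T0 space_aug_filtration aug_filtration_subset[OF AP]])
  have Ym: "Y t \<in> borel_measurable ?M" if "t \<in> {0..T}" for t by (rule jointly_measurable_section[OF jY that])
  have Yc: "AE \<omega> in ?M. continuous_on {0..T} (\<lambda>t. Y t \<omega>)" by (rule bsde_solution_continuous[OF sol]) simp
  obtain L where L: "(\<lambda>(s, \<omega>). L s (fst \<omega>)) \<in> time_measure T \<Otimes>\<^sub>M ?M \<rightarrow>\<^sub>M P2_algebra"
    "\<And>s \<omega>0. \<omega>0 \<in> space P0 \<Longrightarrow> L s \<omega>0 \<in> P2"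
    "AE \<omega> in ?M. \<forall>s\<in>{0..T}. cond_law P1 (Y s) (fst \<omega>) = L s (fst \<omega>)"
  proof (rule PN.cond_law_version[OF T P1(2) Ym Yc Sp_two(2)[OF YS]])
    fix L assume "(\<lambda>(s, \<omega>). L s (fst \<omega>)) \<in> time_measure T \<Otimes>\<^sub>M ?M \<rightarrow>\<^sub>M P2_algebra"
      "\<And>s \<omega>0. \<omega>0 \<in> space P0 \<Longrightarrow> L s \<omega>0 \<in> P2"
      "AE \<omega> in ?M. \<forall>s\<in>{0..T}. cond_law P1 (Y s) (fst \<omega>) = L s (fst \<omega>)"
    then show thesis by (rule that)
  qed
  have family: "brownian_family ?M T {0..n} (\<lambda>k. if k = 0 then ext0 W0 else ext1 (B k))" for n
  proof (rule PN.brownian_family_product[OF T W0 B])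
    have "prob_space.indep_vars P1 (\<lambda>_. Pi\<^sub>M {0..T} (\<lambda>_. borel)) (\<lambda>i. sample_path T (if i = 0 then W else B i)) {1..n}"
      by (rule prob_space.indep_vars_subset[OF P1(1) indep]) simp
    then show "prob_space.indep_vars P1 (\<lambda>_. Pi\<^sub>M {0..T} (\<lambda>_. borel)) (\<lambda>i. sample_path T (B i)) {1..n}"
      by (rule prob_space.indep_vars_cong[OF P1(1), THEN iffD1, rotated -1]) auto
  qed
  define C where "C = a_priori_const T (4 * (\<bar>Cf\<bar> + 1)\<^sup>2) * T"
  have C: "0 < C"
    unfolding C_def using T by (intro mult_pos_pos a_priori_const_pos) auto
  show ?thesis
  proof (intro exI[of _ C] conjI C allI impI)
    fix n :: nat assume n: "n \<ge> 1"
    let ?R = "\<integral>\<^sup>+\<omega>. (SUP s\<in>{0..T}. cond_exp0 P1 (\<lambda>\<omega>'. ennreal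
          ((W2 (empirical n (\<lambda>j. Yn n j s \<omega>')) (cond_law P1 (Y s) (fst \<omega>')))\<^sup>2)) (fst \<omega>)) \<partial>?M"
    let ?e = "\<lambda>i. particle_error T n i (Yn n i) (Zn n i) (Z0n n i) (Yt i) (Zt i) (Z0t i)"
    define dominates where "dominates i S \<longleftrightarrow> S \<in> borel_measurable ?M \<and> (AE \<omega> in ?M. \<forall>t\<in>{0..T}. ?e i t \<omega> \<le> S \<omega>)
        \<and> (\<integral>\<^sup>+\<omega>. S \<omega> \<partial>?M) \<le> ennreal C * ?R" for i S
    have "\<forall>i\<in>{1..n}. \<exists>S. dominates i S"
    proof
      fix i assume i: "i \<in> {1..n}"
      then have "i \<ge> 1" by simp
      from PN.particle_error_estimate[OF T n i family f_prog particles[OF n] coupled[OF this] f_lipschitz L]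
      show "\<exists>S. dominates i S" unfolding C_def dominates_def by blast
    qed
    from bchoice[OF this] obtain S where dom: "\<And>i. i \<in> {1..n} \<Longrightarrow> dominates i (S i)" by blast
    have S: "\<And>i. i \<in> {1..n} \<Longrightarrow> S i \<in> borel_measurable ?M"
      "\<And>i. i \<in> {1..n} \<Longrightarrow> AE \<omega> in ?M. \<forall>t\<in>{0..T}. ?e i t \<omega> \<le> S i \<omega>"
      "\<And>i. i \<in> {1..n} \<Longrightarrow> (\<integral>\<^sup>+\<omega>. S i \<omega> \<partial>?M) \<le> ennreal C * ?R"
      using dom by (simp_all only: dominates_def)
    show "\<forall>i\<in>{1..n}. (\<integral>\<^sup>+\<omega>. (SUP t\<in>{0..T}. cond_exp0 P1 (?e i t) (fst \<omega>)) \<partial>?M) \<le> ennreal C * ?R"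
      by (intro ballI order_trans[OF PN.integral_SUP_cond_exp0_le[OF S(1,2)] S(3)])
    let ?S = "\<lambda>\<omega>. ennreal (1 / real n) * (\<Sum>i=1..n. S i \<omega>)"
    have Sm: "?S \<in> borel_measurable ?M"
      by (intro borel_measurable_times_ennreal borel_measurable_sum S(1)) auto
    have "AE \<omega> in ?M. \<forall>i\<in>{1..n}. \<forall>t\<in>{0..T}. ?e i t \<omega> \<le> S i \<omega>"
      by (rule AE_finite_allI[OF _ S(2)]) simp
    then have "AE \<omega> in ?M. \<forall>t\<in>{0..T}. ennreal (1 / real n) * (\<Sum>i=1..n. ?e i t \<omega>) \<le> ?S \<omega>"
      by eventually_elim (intro ballI mult_left_mono sum_mono, auto)
    then have "(\<integral>\<^sup>+\<omega>. (SUP t\<in>{0..T}. cond_exp0 P1 (\<lambda>\<omega>'. ennreal (1 / real n) * (\<Sum>i=1..n. ?e i t \<omega>')) (fst \<omega>)) \<partial>?M)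
        \<le> (\<integral>\<^sup>+\<omega>. ?S \<omega> \<partial>?M)"
      by (rule PN.integral_SUP_cond_exp0_le[OF Sm])
    also have "\<dots> = ennreal (1 / real n) * (\<integral>\<^sup>+\<omega>. (\<Sum>i=1..n. S i \<omega>) \<partial>?M)"
      by (rule nn_integral_cmult) (intro borel_measurable_sum S(1))
    also have "(\<integral>\<^sup>+\<omega>. (\<Sum>i=1..n. S i \<omega>) \<partial>?M) = (\<Sum>i=1..n. \<integral>\<^sup>+\<omega>. S i \<omega> \<partial>?M)"
      by (rule nn_integral_sum) (rule S(1))
    also have "ennreal (1 / real n) * \<dots> \<le> ennreal (1 / real n) * (\<Sum>i=1..n. ennreal C * ?R)"
      by (intro mult_left_mono sum_mono S(3)) auto
    also have "\<dots> = (ennreal (1 / real n) * ennreal (real n)) * (ennreal C * ?R)"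
      by (simp add: ennreal_of_nat_eq_real_of_nat mult.assoc)
    also have "ennreal (1 / real n) * ennreal (real n) = 1"
      using n by (subst ennreal_mult[symmetric]) auto
    finally show "(\<integral>\<^sup>+\<omega>. (SUP t\<in>{0..T}. cond_exp0 P1 (\<lambda>\<omega>'. ennreal (1 / real n) * (\<Sum>i=1..n. ?e i t \<omega>')) (fst \<omega>)) \<partial>?M)
        \<le> ennreal C * ?R" by simp
  qed
qed


end
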